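(* Let $Q$ be a probability measure on a $d$-dimensional differentiable manifold $M$ endowed with a metric $\rho$ such that every closed and bounded subset of $(M,\rho)$ is compact. Let $X_1,X_2,\dots$ be i.i.d. with common distribution $Q$. Assume: (i) the Fréchet mean $\mu_{\mathcal F}$ of $Q$ exists; (ii) there is a coordinate neighborhood $(U,\phi)$ of $M$, $\phi:U\to\mathbb R^d$, with $Q(U)=1$ and $\mu_{\mathcal F}\in U$; (iii) the map $\theta\mapsto(\rho^\phi)^2(\theta,u)$ is twice continuously differentiable on $\phi(U)$ (for each $u\in\phi(U)$); (iv) with $\mu=\phi(\mu_{\mathcal F})$ and $\tilde X_i=\phi(X_i)$, one has $E|\Psi(\tilde X_i;\mu)|^2<\infty$ and $E|D_{r'}\Psi^r(\tilde X_i;\mu)|^2<\infty$ for all $1\le r,r'\le d$, and $E\,u^{r,r'}(\tilde X_i,c)\to0$ as $c\downarrow0$ for all $1\le r,r'\le d$; (v) the matrix $\Lambda=E\big((D_{r'}\Psi^r(\tilde X_i;\mu))\big)_{r,r'=1}^d$ is nonsingular. Then: (a) every measurable selection $\mu_n$ from the sample Fréchet mean set of $\hat Q_n^\phi=\frac1n\sum_{i=1}^n\delta_{\tilde X_i}$ is a consistent estimator of $\mu$; and (b) $\sqrt n(\mu_n-\mu)\xrightarrow{\mathcal L}\mathcal N\big(0,\Lambda^{-1}C(\Lambda^t)^{-1}\big)$, where $C$ is the covariance matrix of $\Psi(\tilde X_i;\mu)$.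
   Context: The metric $\rho$ induces the topology of $M$. The Fréchet mean set of a probability measure $P$ on $(M,\rho)$ is the set of minimizers of $x\mapsto\int\rho^2(x,y)\,P(dy)$; the Fréchet mean exists if this minimizer exists and is unique. For $u,v\in\phi(U)$ put $\rho^\phi(u,v)=\rho(\phi^{-1}(u),\phi^{-1}(v))$. Define $\Psi(u;\theta)=\operatorname{grad}_\theta(\rho^\phi)^2(u,\theta)=\big(\frac{\partial}{\partial\theta^r}(\rho^\phi)^2(u,\theta)\big)_{r=1}^d=(\Psi^r(u;\theta))_{r=1}^d$ (Euclidean gradient), $D_{r'}=\partial/\partial\theta^{r'}$, and $u^{r,r'}(x,\varepsilon)=\sup_{\{\theta:\|\theta-\mu\|\le\varepsilon\}}|D_{r'}\Psi^r(x;\theta)-D_{r'}\Psi^r(x;\mu)|$. A measurable selection $\mu_n$ means $\mu_n=\phi(\mu_{n,\mathcal F})$, where $\mu_{n,\mathcal F}$ is a measurable selection from the Fréchet mean set (w.r.t. $\rho$) of the empirical measure $\hat Q_n=\frac1n\sum_{i=1}^n\delta_{X_i}$ ($\mu_n$ is given an arbitrary fixed value when $\mu_{n,\mathcal F}\notin U$). *)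

theory Defs
  imports "HOL-Probability.Probability"
begin

section \<open>Differentiable manifolds\<close>

definition partial_deriv ::
    "'d::finite \<Rightarrow> (real^'d \<Rightarrow> 'b::real_normed_vector) \<Rightarrow> real^'d \<Rightarrow> 'b" where
  "partial_deriv r f x = vector_derivative (\<lambda>t. f (x + t *\<^sub>R axis r 1)) (at 0)"

text \<open>\<open>k\<close>-fold continuous differentiability; meant for open \<open>S\<close> only.\<close>

primrec Ck_on ::
    "nat \<Rightarrow> (real^'d::finite \<Rightarrow> 'b::real_normed_vector) \<Rightarrow> (real^'d) set \<Rightarrow> bool" where
  "Ck_on 0 f S \<longleftrightarrow> continuous_on S f"
| "Ck_on (Suc k) f S \<longleftrightarrow>
     (\<forall>x\<in>S. f differentiable (at x)) \<and> (\<forall>r. Ck_on k (partial_deriv r f) S)"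

definition smooth_on :: "(real^'d::finite \<Rightarrow> 'b::real_normed_vector) \<Rightarrow> (real^'d) set \<Rightarrow> bool" where
  "smooth_on f S \<longleftrightarrow> (\<forall>k. Ck_on k f S)"

text \<open>A chart is a pair of a domain \<open>U\<close> and a total function \<open>\<phi>\<close> whose values outside \<open>U\<close> carry
  no meaning.\<close>

definition chart :: "'m::topological_space set \<Rightarrow> ('m \<Rightarrow> real^'d::finite) \<Rightarrow> bool" where
  "chart U \<phi> \<longleftrightarrow> open U \<and> open (\<phi> ` U) \<and> homeomorphism U (\<phi> ` U) \<phi> (inv_into U \<phi>)"

definition smooth_compatible ::
    "'m set \<Rightarrow> ('m \<Rightarrow> real^'d::finite) \<Rightarrow> 'm set \<Rightarrow> ('m \<Rightarrow> real^'d) \<Rightarrow> bool" where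
  "smooth_compatible U \<phi> V \<psi> \<longleftrightarrow>
     smooth_on (\<psi> \<circ> inv_into U \<phi>) (\<phi> ` (U \<inter> V)) \<and>
     smooth_on (\<phi> \<circ> inv_into V \<psi>) (\<psi> ` (U \<inter> V))"

text \<open>The underlying space of the manifold is the whole type; that it is Hausdorff and second
  countable is part of the sort. The dimension is \<open>CARD('d)\<close>.\<close>

definition differentiable_atlas ::
    "('m::{t2_space,second_countable_topology} set \<times> ('m \<Rightarrow> real^'d::finite)) set \<Rightarrow> bool" where
  "differentiable_atlas \<A> \<longleftrightarrow>
     (\<forall>(U, \<phi>)\<in>\<A>. chart U \<phi>) \<and> (\<Union>(U, \<phi>)\<in>\<A>. U) = UNIV \<and>
     (\<forall>(U, \<phi>)\<in>\<A>. \<forall>(V, \<psi>)\<in>\<A>. smooth_compatible U \<phi> V \<psi>)"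

text \<open>Membership in the maximal atlas generated by \<open>\<A>\<close>.\<close>

definition coordinate_neighborhood ::
    "('m::{t2_space,second_countable_topology} set \<times> ('m \<Rightarrow> real^'d::finite)) set \<Rightarrow>
     'm set \<Rightarrow> ('m \<Rightarrow> real^'d) \<Rightarrow> bool" where
  "coordinate_neighborhood \<A> U \<phi> \<longleftrightarrow>
     chart U \<phi> \<and> (\<forall>(V, \<psi>)\<in>\<A>. smooth_compatible U \<phi> V \<psi>)"


section \<open>Frechet means\<close>

text \<open>The Frechet function takes values in \<open>[0, \<infinity>]\<close>, so that a divergent integral
  counts as \<open>\<infinity>\<close>.\<close>

definition frechet_function :: "'m::metric_space measure \<Rightarrow> 'm \<Rightarrow> ennreal" where
  "frechet_function P x = (\<integral>\<^sup>+ y. ennreal ((dist x y)\<^sup>2) \<partial>P)"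

definition frechet_mean_set :: "'m::metric_space measure \<Rightarrow> 'm set" where
  "frechet_mean_set P = {x. \<forall>z. frechet_function P x \<le> frechet_function P z}"

definition frechet_mean_exists :: "'m::metric_space measure \<Rightarrow> bool" where
  "frechet_mean_exists P \<longleftrightarrow> (\<exists>!x. x \<in> frechet_mean_set P)"

definition frechet_mean :: "'m::metric_space measure \<Rightarrow> 'm" where
  "frechet_mean P = (THE x. x \<in> frechet_mean_set P)"

definition empirical_measure :: "nat \<Rightarrow> (nat \<Rightarrow> 'm::topological_space) \<Rightarrow> 'm measure" where
  "empirical_measure n x =
     measure_of UNIV (sets borel) (\<lambda>A. (\<Sum>i<n. emeasure (return borel (x i)) A) / of_nat n)"

lemma sets_empirical_measure [simp]: "sets (empirical_measure n x) = sets borel"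
  unfolding empirical_measure_def
  by (metis sets.sigma_sets_eq sets_measure_of space_borel subset_UNIV Pow_UNIV)

lemma emeasure_empirical_measure:
  assumes "A \<in> sets borel"
  shows "emeasure (empirical_measure n x) A =
           (\<Sum>i<n. emeasure (return borel (x i)) A) / of_nat n"
proof (rule emeasure_measure_of[OF empirical_measure_def])
  let ?\<mu> = "\<lambda>A. (\<Sum>i<n. emeasure (return borel (x i)) A) / (of_nat n :: ennreal)"
  show "positive (sets (empirical_measure n x)) ?\<mu>"
    by (simp add: positive_def)
  show "countably_additive (sets (empirical_measure n x)) ?\<mu>"
  proof (rule countably_additiveI)
    fix F :: "nat \<Rightarrow> 'a set"
    assume F: "range F \<subseteq> sets (empirical_measure n x)" "disjoint_family F"
    have "(\<Sum>k. ?\<mu> (F k)) = (\<Sum>k. \<Sum>i<n. emeasure (return borel (x i)) (F k)) / of_nat n"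
      by (simp add: divide_ennreal_def)
    also have "(\<Sum>k. \<Sum>i<n. emeasure (return borel (x i)) (F k)) =
        (\<Sum>i<n. \<Sum>k. emeasure (return borel (x i)) (F k))"
      by (rule suminf_sum) simp
    also have "\<dots> = (\<Sum>i<n. emeasure (return borel (x i)) (\<Union>(range F)))"
      using F by (intro sum.cong refl suminf_emeasure) auto
    finally show "(\<Sum>k. ?\<mu> (F k)) = ?\<mu> (\<Union>(range F))" .
  qed
qed (use assms in auto)


section \<open>The metric in a chart\<close>

definition rho_chart ::
    "'m::metric_space set \<Rightarrow> ('m \<Rightarrow> real^'d::finite) \<Rightarrow> real^'d \<Rightarrow> real^'d \<Rightarrow> real" where
  "rho_chart U \<phi> u v = dist (inv_into U \<phi> u) (inv_into U \<phi> v)"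

definition Psi ::
    "'m::metric_space set \<Rightarrow> ('m \<Rightarrow> real^'d::finite) \<Rightarrow> real^'d \<Rightarrow> real^'d \<Rightarrow> real^'d" where
  "Psi U \<phi> u \<theta> = (\<chi> r. partial_deriv r (\<lambda>\<theta>. (rho_chart U \<phi> u \<theta>)\<^sup>2) \<theta>)"

text \<open>\<open>DPsi U \<phi> u \<theta> $ r $ r'\<close> is \<open>D\<^bsub>r'\<^esub> \<Psi>\<^sup>r(u; \<theta>)\<close>.\<close>

definition DPsi ::
    "'m::metric_space set \<Rightarrow> ('m \<Rightarrow> real^'d::finite) \<Rightarrow> real^'d \<Rightarrow> real^'d \<Rightarrow> real^'d^'d" where
  "DPsi U \<phi> u \<theta> = (\<chi> r r'. partial_deriv r' (\<lambda>\<theta>. Psi U \<phi> u \<theta> $ r) \<theta>)"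

text \<open>\<open>osc_DPsi U \<phi> \<mu> r r' x \<epsilon>\<close> is \<open>u\<^bsup>r,r'\<^esup>(x, \<epsilon>)\<close>. It has the intended meaning only when the
  closed ball around \<open>\<mu>\<close> lies in \<open>\<phi> ` U\<close>; it is used in the limit \<open>\<epsilon> \<down> 0\<close>. The supremum is taken
  in \<open>[0, \<infinity>]\<close>.\<close>

definition osc_DPsi ::
    "'m::metric_space set \<Rightarrow> ('m \<Rightarrow> real^'d::finite) \<Rightarrow> real^'d \<Rightarrow> 'd \<Rightarrow> 'd \<Rightarrow> real^'d \<Rightarrow> real \<Rightarrow> ennreal"
  where
  "osc_DPsi U \<phi> \<mu> r r' x \<epsilon> =
     (SUP \<theta>\<in>{\<theta>. norm (\<theta> - \<mu>) \<le> \<epsilon>}. ennreal \<bar>DPsi U \<phi> x \<theta> $ r $ r' - DPsi U \<phi> x \<mu> $ r $ r'\<bar>)"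


section \<open>Probabilistic notions\<close>

definition covariance_matrix :: "'w measure \<Rightarrow> ('w \<Rightarrow> real^'d::finite) \<Rightarrow> real^'d^'d" where
  "covariance_matrix P Y =
     (\<chi> r s. LINT \<omega>|P. (Y \<omega> $ r - (LINT \<omega>|P. Y \<omega> $ r)) * (Y \<omega> $ s - (LINT \<omega>|P. Y \<omega> $ s)))"

definition std_mvnormal :: "(real^'d::finite) measure" where
  "std_mvnormal = density lborel (\<lambda>z. ennreal (\<Prod>i\<in>UNIV. std_normal_density (z $ i)))"

text \<open>\<open>\<N>(m, S)\<close>, for positive semidefinite and possibly singular \<open>S\<close>, is the law of \<open>m + B Z\<close> with
  \<open>Z\<close> standard normal and \<open>B B\<^sup>t = S\<close>; the law does not depend on the choice of \<open>B\<close>.\<close>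

definition mvnormal :: "real^'d::finite \<Rightarrow> real^'d^'d \<Rightarrow> (real^'d) measure" where
  "mvnormal m S =
     distr std_mvnormal borel (\<lambda>z. m + (SOME B :: real^'d^'d. B ** transpose B = S) *v z)"

definition weakly_converges ::
    "(nat \<Rightarrow> 'b::topological_space measure) \<Rightarrow> 'b measure \<Rightarrow> bool" where
  "weakly_converges N L \<longleftrightarrow>
     (\<forall>f :: 'b \<Rightarrow> real. continuous_on UNIV f \<and> bounded (range f) \<longrightarrow>
        (\<lambda>n. LINT x|N n. f x) \<longlonglongrightarrow> (LINT x|L. f x))"

definition converges_in_law ::
    "'w measure \<Rightarrow> (nat \<Rightarrow> 'w \<Rightarrow> 'b::topological_space) \<Rightarrow> 'b measure \<Rightarrow> bool" where
  "converges_in_law P Y L \<longleftrightarrow> weakly_converges (\<lambda>n. distr P borel (Y n)) L"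

definition consistent_estimator ::
    "'w measure \<Rightarrow> (nat \<Rightarrow> 'w \<Rightarrow> 'b::metric_space) \<Rightarrow> 'b \<Rightarrow> bool" where
  "consistent_estimator P Y y \<longleftrightarrow>
     (\<forall>\<epsilon>>0. (\<lambda>n. measure P {\<omega> \<in> space P. dist (Y n \<omega>) y > \<epsilon>}) \<longlonglongrightarrow> 0)"

text \<open>The sample is \<open>X 0, X 1, \<dots>\<close>; the empirical measure of size \<open>n\<close> uses \<open>X 0, \<dots>, X (n - 1)\<close>.\<close>

definition measurable_frechet_selection ::
    "'w measure \<Rightarrow> (nat \<Rightarrow> 'w \<Rightarrow> 'm::metric_space) \<Rightarrow> (nat \<Rightarrow> 'w \<Rightarrow> 'm) \<Rightarrow> bool" where
  "measurable_frechet_selection P X T \<longleftrightarrow>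
     (\<forall>n\<ge>1. T n \<in> borel_measurable P \<and>
        (\<forall>\<omega>\<in>space P. T n \<omega> \<in> frechet_mean_set (empirical_measure n (\<lambda>i. X i \<omega>))))"

end

theory Submission
  imports Defs
begin

text \<open>Consistency: a minimizer of the sample Frechet function lies within twice the mean distance
  of the sample from the Frechet mean, hence with high probability in a fixed compact ball; there
  the weak law of large numbers on a finite net, together with a Lipschitz bound, makes the sample
  Frechet function uniformly close to its limit, which has a strict minimum.

  Asymptotic normality: in the chart the gradient of the sample Frechet function vanishes at
  \<open>\<mu>\<^sub>n\<close>, and the mean value theorem turns this into
  \<open>S\<^sub>n + \<Lambda> Z\<^sub>n = o(Z\<^sub>n)\<close> in probability, where \<open>Z\<^sub>n = sqrt n (\<mu>\<^sub>n - \<mu>)\<close> and \<open>S\<^sub>n\<close> is the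
  normalized sum of the centered scores. So \<open>Z\<^sub>n\<close> is close to \<open>V\<^sub>n = - \<Lambda>\<^sup>-\<^sup>1 S\<^sub>n\<close>. The
  one-dimensional central limit theorem gives the limits of \<open>E cos (t \<bullet> V\<^sub>n + b)\<close>, and for a tight
  sequence these determine the limit law, because bounded continuous functions are approximated on
  large balls, with control of the global bound, by sums of such cosines.\<close>

section \<open>Multivariate normal laws\<close>

text \<open>No rate for \<open>Z\<^sub>n\<close> is available beforehand, so the linearization error
  is kept proportional to \<open>norm Z\<^sub>n\<close> and absorbed afterwards; tightness of
  \<open>Z\<^sub>n\<close> then follows from that of \<open>V\<^sub>n\<close>. The limit covariance
  may be singular: the normal law is reached through a factor \<open>B\<close> with
  \<open>B B\<^sup>t = S\<close> rather than through a density, and the central limit theorem is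
  supplemented by the case of zero variance. Squared distances are only known to be integrable,
  which itself comes from the uniqueness of the Frechet mean, so the weak law must work with first
  moments and is proved by truncation. Chart expressions carry no information outside
  \<open>U\<close>; they are replaced by Borel functions on the whole manifold that agree with them
  on \<open>U\<close>, a set of full measure.\<close>

lemma psd_form_Cauchy_Schwarz:
  fixes S :: "real^'d::finite^'d"
  assumes sym: "transpose S = S" and psd: "\<And>x. 0 \<le> x \<bullet> (S *v x)"
  shows "(x \<bullet> (S *v y))\<^sup>2 \<le> (x \<bullet> (S *v x)) * (y \<bullet> (S *v y))"
proof -
  have s: "y \<bullet> (S *v x) = x \<bullet> (S *v y)"
    by (metis dot_lmul_matrix inner_commute sym transpose_matrix_vector)
  \<comment> \<open>The form at \<open>x + c *\<^sub>R y\<close> as a polynomial in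
    \<open>c\<close>. If \<open>y \<bullet> (S *v y)\<close> is positive, its value at the
    minimizing \<open>c\<close> is the claim; if it is zero, the polynomial is affine in
    \<open>c\<close> and can stay nonnegative only when the cross term vanishes.\<close>
  have q: "0 \<le> x \<bullet> (S *v x) + 2 * c * (x \<bullet> (S *v y)) + c\<^sup>2 * (y \<bullet> (S *v y))" for c
    using psd[of "x + c *\<^sub>R y"]
    by (simp add: matrix_vector_right_distrib matrix_vector_mult_scaleR inner_add s algebra_simps power2_eq_square)
  show ?thesis
  proof (cases "y \<bullet> (S *v y) = 0")
    case True
    have "x \<bullet> (S *v y) = 0"
    proof (rule ccontr)
      assume n: "x \<bullet> (S *v y) \<noteq> 0"
      show False
        using q[of "- (x \<bullet> (S *v x) + 1) / (2 * (x \<bullet> (S *v y)))"] True n by (simp add: field_simps)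
    qed
    then show ?thesis using True by simp
  next
    case False
    then have pos: "0 < y \<bullet> (S *v y)" using psd[of y] by simp
    show ?thesis
      using q[of "- (x \<bullet> (S *v y)) / (y \<bullet> (S *v y))"] pos
      by (simp add: field_simps power2_eq_square)
  qed
qed

text \<open>Cholesky elimination, one pivot \<open>j\<close> per induction step, for a symmetric
  form supported on \<open>J\<close>. If the pivot is zero, Cauchy-Schwarz kills its whole row and
  the form is already supported on the smaller set. Otherwise a rank-one matrix is split off and the
  Schur complement is positive semidefinite, again by Cauchy-Schwarz. The condition on the columns
  of \<open>B\<close> keeps column \<open>j\<close> free for the next step.\<close>

lemma psd_matrix_factor_on:
  fixes S :: "real^'d::finite^'d"
  assumes "finite J" "transpose S = S" "\<And>x. 0 \<le> x \<bullet> (S *v x)"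
    and "\<And>i j. i \<notin> J \<Longrightarrow> S $ i $ j = 0"
  shows "\<exists>B :: real^'d^'d. B ** transpose B = S \<and> (\<forall>i j. j \<notin> J \<longrightarrow> B $ i $ j = 0)"
  using assms
proof (induction J arbitrary: S rule: finite_induct)
  case empty
  then have "S = 0" by (simp add: vec_eq_iff)
  then show ?case by (intro exI[of _ 0]) (simp add: transpose_def vec_eq_iff matrix_matrix_mult_def)
next
  case (insert j J)
  have symS: "S $ a $ b = S $ b $ a" for a b
    using insert.prems(1) by (metis transpose_def vec_lambda_beta)
  define e :: "real^'d" where "e = axis j 1"
  have Se: "(S *v e) $ i = S $ i $ j" for i
    by (simp add: e_def matrix_vector_mult_basis column_def)
  have xe: "x \<bullet> e = x $ j" for x
    by (simp add: e_def inner_axis)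
  have eSe: "e \<bullet> (S *v e) = S $ j $ j"
    using xe[of "S *v e"] Se[of j] by (simp add: inner_commute)
  show ?case
  proof (cases "S $ j $ j = 0")
    case True
    have "S $ i $ j = 0" for i
      using psd_form_Cauchy_Schwarz[OF insert.prems(1,2), of "axis i 1" e] True eSe Se[of i]
      by (simp add: inner_axis')
    then have "\<exists>B :: real^'d^'d. B ** transpose B = S \<and> (\<forall>i k. k \<notin> J \<longrightarrow> B $ i $ k = 0)"
      using insert.prems symS by (intro insert.IH) (auto, metis insert_iff)
    then show ?thesis by blast
  next
    case False
    then have pos: "0 < S $ j $ j" using insert.prems(2)[of e] eSe by simp
    \<comment> \<open>Normalized so that \<open>c c\<^sup>t\<close> has the same row and column
      \<open>j\<close> as \<open>S\<close>; subtracting it leaves a matrix supported on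
      \<open>J\<close>.\<close>
    define c :: "real^'d" where "c = (1 / sqrt (S $ j $ j)) *\<^sub>R (S *v e)"
    have c: "c $ i * c $ k = S $ i $ j * S $ k $ j / S $ j $ j" for i k
      using pos by (simp add: c_def Se)
    define S' :: "real^'d^'d" where "S' = (\<chi> i k. S $ i $ k - c $ i * c $ k)"
    have S'x: "S' *v x = S *v x - (c \<bullet> x) *\<^sub>R c" for x
      by (simp add: S'_def vec_eq_iff matrix_vector_mult_def inner_vec_def sum_subtractf
          algebra_simps sum_distrib_left)
    have cx: "(c \<bullet> x)\<^sup>2 = (x \<bullet> (S *v e))\<^sup>2 / S $ j $ j" for x
      using pos by (simp add: c_def power_divide inner_commute)
    have "\<exists>B :: real^'d^'d. B ** transpose B = S' \<and> (\<forall>i k. k \<notin> J \<longrightarrow> B $ i $ k = 0)"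
    proof (rule insert.IH)
      show "transpose S' = S'"
        by (simp add: S'_def transpose_def vec_eq_iff symS mult.commute)
    next
      fix x
      have "(c \<bullet> x)\<^sup>2 \<le> x \<bullet> (S *v x)"
        using psd_form_Cauchy_Schwarz[OF insert.prems(1,2), of x e] eSe pos
        by (simp add: cx field_simps)
      then show "0 \<le> x \<bullet> (S' *v x)"
        by (simp add: S'x inner_diff_right power2_eq_square inner_commute)
    next
      fix i k assume i: "i \<notin> J"
      show "S' $ i $ k = 0"
      proof (cases "i = j")
        case True
        then show ?thesis using pos by (simp add: S'_def c symS)
      next
        case False
        then have "S $ i $ k = 0" "S $ i $ j = 0" using i insert.prems(3) by auto
        then show ?thesis by (simp add: S'_def c)
      qed
    qed
    then obtain B :: "real^'d^'d" where B: "B ** transpose B = S'" "\<And>i k. k \<notin> J \<Longrightarrow> B $ i $ k = 0"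
      by blast
    \<comment> \<open>Column \<open>j\<close> of \<open>B\<close> is zero because \<open>j\<close>
      is not in \<open>J\<close>; storing \<open>c\<close> there adds exactly
      \<open>c c\<^sup>t\<close> to the product.\<close>
    define B' :: "real^'d^'d" where "B' = (\<chi> i k. if k = j then c $ i else B $ i $ k)"
    have "(B' ** transpose B') $ i $ k = S $ i $ k" for i k
    proof -
      have "(B' ** transpose B') $ i $ k = (\<Sum>l\<in>UNIV. B' $ i $ l * B' $ k $ l)"
        by (simp add: matrix_matrix_mult_def transpose_def)
      also have "\<dots> = (\<Sum>l\<in>UNIV. B $ i $ l * B $ k $ l + (if l = j then c $ i * c $ k else 0))"
        using B(2)[OF insert.hyps(2)] by (intro sum.cong) (auto simp: B'_def)
      also have "\<dots> = (B ** transpose B) $ i $ k + c $ i * c $ k"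
        by (simp add: sum.distrib matrix_matrix_mult_def transpose_def)
      finally show ?thesis by (simp add: B(1) S'_def)
    qed
    then have "B' ** transpose B' = S" by (simp add: vec_eq_iff)
    moreover have "B' $ i $ k = 0" if "k \<notin> insert j J" for i k
      using that B(2) by (simp add: B'_def)
    ultimately show ?thesis by blast
  qed
qed

lemma psd_matrix_factor:
  fixes S :: "real^'d::finite^'d"
  assumes "transpose S = S" "\<And>x. 0 \<le> x \<bullet> (S *v x)"
  obtains B :: "real^'d^'d" where "B ** transpose B = S"
  using psd_matrix_factor_on[of UNIV S] assms by auto

lemma matrix_inv_mult:
  fixes A :: "real^'n::finite^'n"
  assumes "invertible A"
  shows "A ** matrix_inv A = mat 1" "matrix_inv A ** A = mat 1"
  using someI_ex[OF assms[unfolded invertible_def]] by (auto simp: matrix_inv_def)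

lemma matrix_inv_transpose:
  fixes A :: "real^'n::finite^'n"
  assumes "invertible A"
  shows "matrix_inv (transpose A) = transpose (matrix_inv A)"
proof -
  have "invertible (transpose A)"
    using assms by (rule transpose_invertible)
  then have 1: "matrix_inv (transpose A) ** transpose A = mat 1" by (rule matrix_inv_mult)
  have "transpose A ** transpose (matrix_inv A) = mat 1"
    using matrix_inv_mult(2)[OF assms] by (metis matrix_transpose_mul transpose_mat)
  then show ?thesis
    using 1 by (metis matrix_mul_assoc matrix_mul_lid matrix_mul_rid)
qed

section \<open>Characteristic function of the standard normal law\<close>

lemma borel_measurable_cis [measurable]: "cis \<in> borel_measurable borel"
  by (intro borel_measurable_continuous_onI continuous_intros)

lemma integrable_cis_std_normal_density:
  "integrable lborel (\<lambda>x. std_normal_density x *\<^sub>R cis (t * x))"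
  by (rule Bochner_Integration.integrable_bound[OF integrable_normal_density[of 1 0]])
     (auto simp: cis_conv_exp)

lemma integral_cis_std_normal_density:
  "(LINT x|lborel. std_normal_density x *\<^sub>R cis (t * x)) = of_real (exp (- t\<^sup>2 / 2))"
proof -
  have "char std_normal_distribution t = (LINT x|lborel. std_normal_density x *\<^sub>R iexp (t * x))"
    unfolding char_def by (subst integral_density) auto
  then show ?thesis
    by (simp add: char_std_normal_distribution cis_conv_exp mult.commute)
qed

lemma integral_std_mvnormal:
  fixes f :: "real^'d::finite \<Rightarrow> 'b::{banach,second_countable_topology}"
  assumes "f \<in> borel_measurable borel"
  shows "(LINT z|std_mvnormal. f z) = (LINT z|lborel. (\<Prod>i\<in>UNIV. std_normal_density (z $ i)) *\<^sub>R f z)"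
  unfolding std_mvnormal_def using assms
  by (intro integral_density) (auto intro!: prod_nonneg)

text \<open>Both the density and the exponential factor over the coordinates, so Fubini reduces the
  integral to a product of one-dimensional characteristic functions.\<close>

lemma integral_cis_std_mvnormal:
  fixes a :: "real^'d::finite"
  shows "(LINT z|std_mvnormal. cis (a \<bullet> z)) = of_real (exp (- (norm a)\<^sup>2 / 2))"
proof -
  let ?g = "\<lambda>(b::real^'d) x. std_normal_density x *\<^sub>R cis ((a \<bullet> b) * x)"
  interpret product_sigma_finite "\<lambda>_::real^'d. lborel::real measure"
    by (simp add: product_sigma_finite_def sigma_finite_lborel)
  have coord: "std_normal_density (z $ i) = std_normal_density (z \<bullet> axis i 1)" for z :: "real^'d" and i
    by (simp add: inner_axis)
  \<comment> \<open>The density is a product over the index type, whereas \<open>lborel\<close> is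
    the image of a product measure indexed by \<open>Basis\<close>; this changes the index
    set.\<close>
  have basis: "(\<Prod>i\<in>UNIV. h (axis i 1 :: real^'d)) = (\<Prod>b\<in>Basis. h b)" for h :: "real^'d \<Rightarrow> complex"
  proof -
    have "(Basis::(real^'d) set) = range (\<lambda>i. axis i 1)"
      by (auto simp: Basis_vec_def)
    moreover have "inj (\<lambda>i. axis i 1 :: real^'d)"
      by (auto simp: inj_def axis_eq_axis)
    ultimately show ?thesis using prod.reindex[of "\<lambda>i. axis i 1 :: real^'d" UNIV h] by (simp add: o_def)
  qed
  have split: "(\<Prod>i\<in>UNIV. std_normal_density (z $ i)) *\<^sub>R cis (a \<bullet> z) = (\<Prod>b\<in>Basis. ?g b (z \<bullet> b))" for z :: "real^'d"
  proof -
    have "cis (a \<bullet> z) = (\<Prod>b\<in>Basis. cis ((a \<bullet> b) * (z \<bullet> b)))"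
      by (subst euclidean_inner) (simp add: cis_conv_exp exp_sum sum_distrib_left)
    then show ?thesis
      by (simp add: coord scaleR_conv_of_real prod.distrib basis[of "\<lambda>b. complex_of_real (std_normal_density (z \<bullet> b))"])
  qed
  have "(LINT z|std_mvnormal. cis (a \<bullet> z)) = (LINT z|lborel. (\<Prod>b\<in>Basis. ?g b (z \<bullet> b)))"
    by (subst integral_std_mvnormal) (measurable, simp only: split)
  also have "\<dots> = (LINT f|(\<Pi>\<^sub>M b\<in>Basis. lborel). (\<Prod>b\<in>Basis. ?g b (f b)))"
    by (subst lborel_eq, subst integral_distr) (auto simp: cis_conv_exp intro!: Bochner_Integration.integral_cong prod.cong)
  also have "\<dots> = (\<Prod>b\<in>Basis. of_real (exp (- (a \<bullet> b)\<^sup>2 / 2)))"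
    by (subst product_integral_prod) (auto simp: integrable_cis_std_normal_density integral_cis_std_normal_density)
  also have "\<dots> = of_real (exp (\<Sum>b\<in>Basis. - (a \<bullet> b)\<^sup>2 / 2))"
    by (simp add: exp_sum)
  also have "(\<Sum>b\<in>Basis. - (a \<bullet> b)\<^sup>2 / 2) = - (norm a)\<^sup>2 / 2"
  proof -
    have "(norm a)\<^sup>2 = (\<Sum>b\<in>Basis. (a \<bullet> b)\<^sup>2)"
      by (subst power2_norm_eq_inner, subst euclidean_inner) (simp add: power2_eq_square)
    then show ?thesis by (simp add: sum_negf sum_divide_distrib)
  qed
  finally show ?thesis .
qed

lemma sets_std_mvnormal [simp, measurable_cong]: "sets (std_mvnormal :: (real^'d::finite) measure) = sets borel"
  by (simp add: std_mvnormal_def)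

lemma space_std_mvnormal [simp]: "space std_mvnormal = UNIV"
  by (simp add: std_mvnormal_def)

text \<open>The total mass is the characteristic function at 0. An infinite mass is excluded as
  well, since \<open>measure\<close> would then be 0 instead of 1.\<close>

lemma prob_space_std_mvnormal: "prob_space (std_mvnormal :: (real^'d::finite) measure)"
proof -
  have "(LINT z|(std_mvnormal :: (real^'d) measure). (1::complex)) = 1"
    using integral_cis_std_mvnormal[of "0::real^'d"] by simp
  then have "measure (std_mvnormal :: (real^'d) measure) UNIV = 1"
    by (simp add: scaleR_conv_of_real)
  then have "emeasure (std_mvnormal :: (real^'d) measure) UNIV = 1"
    by (metis emeasure_eq_ennreal_measure ennreal_1 measure_def enn2real_top zero_neq_one)
  then show ?thesis by (intro prob_spaceI) simp
qed

lemma borel_measurable_matrix_vector_mult [measurable]: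
  fixes B :: "real^'d::finite^'e::finite"
  shows "(\<lambda>z. B *v z) \<in> borel_measurable borel"
  by (intro borel_measurable_continuous_onI linear_continuous_on) simp

lemma prob_space_mvnormal: "prob_space (mvnormal m S)"
  unfolding mvnormal_def by (rule prob_space.prob_space_distr[OF prob_space_std_mvnormal]) measurable

text \<open>The factor picked by \<open>SOME\<close> satisfies its specification because positive
  semidefinite matrices can be factored. Seen through \<open>t\<close>, the law depends on
  \<open>B\<close> only via the squared norm of \<open>transpose B *v t\<close>, which equals
  \<open>t \<bullet> (S *v t)\<close>.\<close>

lemma integral_cos_mvnormal:
  fixes S :: "real^'d::finite^'d"
  assumes sym: "transpose S = S" and psd: "\<And>x. 0 \<le> x \<bullet> (S *v x)"
  shows "(LINT x|mvnormal 0 S. cos (t \<bullet> x + b)) = exp (- (t \<bullet> (S *v t)) / 2) * cos b"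
proof -
  define B :: "real^'d^'d" where "B = (SOME B. B ** transpose B = S)"
  have B: "B ** transpose B = S"
    unfolding B_def by (rule someI_ex) (use psd_matrix_factor[OF sym psd] in blast)
  define a where "a = transpose B *v t"
  have a: "a \<bullet> z = t \<bullet> (B *v z)" for z
    by (simp add: a_def dot_lmul_matrix)
  have na: "(norm a)\<^sup>2 = t \<bullet> (S *v t)"
    unfolding power2_norm_eq_inner a unfolding a_def
    by (simp add: B matrix_vector_mul_assoc del: transpose_matrix_vector)
  interpret N: prob_space "std_mvnormal :: (real^'d) measure" by (rule prob_space_std_mvnormal)
  have int: "integrable (std_mvnormal :: (real^'d) measure) (\<lambda>z. cis (a \<bullet> z))"
    by (rule N.integrable_const_bound[of _ 1]) (auto simp: cis_conv_exp)
  have "(LINT x|mvnormal 0 S. cos (t \<bullet> x + b)) = (LINT z|std_mvnormal. cos (t \<bullet> (0 + B *v z) + b))"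
    unfolding mvnormal_def B_def[symmetric] by (rule integral_distr) measurable
  also have "\<dots> = (LINT z|std_mvnormal. cos (a \<bullet> z + b))"
    by (simp only: a add_0_left)
  also have "\<dots> = (LINT z|std_mvnormal. Re (cis b * cis (a \<bullet> z)))"
    by (simp add: cis_mult add.commute)
  also have "\<dots> = Re (cis b * of_real (exp (- (norm a)\<^sup>2 / 2)))"
    using int by (subst integral_Re) (auto simp: integral_cis_std_mvnormal)
  finally show ?thesis by (simp add: na)
qed


section \<open>Weak convergence from trigonometric test functions\<close>

text \<open>Real trigonometric polynomials with arbitrary frequencies. The phase \<open>b\<close>
  takes the place of sines and complex exponentials: it makes the class an algebra through the
  product-to-sum formula, while every generator is still of the one form that the central limit
  theorem controls.\<close>

inductive trig_sum :: "('a::real_inner \<Rightarrow> real) \<Rightarrow> bool" where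
  trig_sum_cos: "trig_sum (\<lambda>x. c * cos (t \<bullet> x + b))"
| trig_sum_add: "trig_sum f \<Longrightarrow> trig_sum g \<Longrightarrow> trig_sum (\<lambda>x. f x + g x)"

lemma trig_sum_cos_mult:
  assumes "trig_sum g"
  shows "trig_sum (\<lambda>x. c * cos (t \<bullet> x + b) * g x)"
  using assms
proof induction
  case (trig_sum_cos c' t' b')
  have "c * cos (t \<bullet> x + b) * (c' * cos (t' \<bullet> x + b')) =
      (c * c' / 2) * cos ((t - t') \<bullet> x + (b - b')) + (c * c' / 2) * cos ((t + t') \<bullet> x + (b + b'))" for x
  proof -
    have "cos (t \<bullet> x + b) * cos (t' \<bullet> x + b') =
        (cos ((t - t') \<bullet> x + (b - b')) + cos ((t + t') \<bullet> x + (b + b'))) / 2"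
      unfolding cos_times_cos by (simp add: inner_add_left inner_diff_left algebra_simps)
    moreover have "c * u * (c' * v) = c * c' / 2 * w + c * c' / 2 * z"
      if "u * v = (w + z) / 2" for u v w z :: real
      using arg_cong[OF that, of "\<lambda>y. c * c' * y"] by (simp add: field_simps)
    ultimately show ?thesis by blast
  qed
  then show ?case
    by (simp only:) (intro trig_sum.intros)
next
  case (trig_sum_add f g)
  then show ?case by (simp only: distrib_left) (rule trig_sum.trig_sum_add)
qed

lemma trig_sum_mult:
  assumes "trig_sum f" "trig_sum g"
  shows "trig_sum (\<lambda>x. f x * g x)"
  using assms(1)
proof induction
  case (trig_sum_cos c t b)
  then show ?case using trig_sum_cos_mult[OF assms(2)] .
next
  case (trig_sum_add f1 f2)
  then show ?case by (simp only: distrib_right) (rule trig_sum.trig_sum_add)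
qed

lemma trig_sum_const: "trig_sum (\<lambda>x. c)"
  using trig_sum_cos[of c 0 0] by simp

lemma trig_sum_sum:
  "finite I \<Longrightarrow> (\<And>i. i \<in> I \<Longrightarrow> trig_sum (f i)) \<Longrightarrow> trig_sum (\<lambda>x. \<Sum>i\<in>I. f i x)"
  by (induction I rule: finite_induct) (auto intro: trig_sum_const trig_sum_add)

lemma linear_eq_sum_axis:
  fixes f :: "real^'d::finite \<Rightarrow> real"
  assumes "linear f"
  shows "f y = (\<Sum>j\<in>UNIV. y $ j * f (axis j 1))"
proof -
  have "(\<Sum>j\<in>UNIV. y $ j *\<^sub>R axis j 1) = y"
    by (simp add: vec_eq_iff axis_def if_distrib cong: if_cong)
  then have "f y = f (\<Sum>j\<in>UNIV. y $ j *\<^sub>R axis j 1)" by simp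
  then show ?thesis using assms by (simp add: linear_sum linear_scale)
qed

text \<open>Carries a Weierstrass polynomial over to the class: if the coordinates of
  \<open>h\<close> belong to the algebra, so does every polynomial in them.\<close>

lemma trig_sum_polynomial:
  fixes h :: "'a::real_inner \<Rightarrow> real^'d::finite"
  assumes "real_polynomial_function p" "\<And>j. trig_sum (\<lambda>x. h x $ j)"
  shows "trig_sum (\<lambda>x. p (h x))"
  using assms(1)
proof induction
  case (linear f)
  then have "f y = (\<Sum>j\<in>UNIV. f (axis j 1) * (y $ j))" for y
    using linear_eq_sum_axis[of f y] by (simp add: bounded_linear.linear mult.commute)
  then have "(\<lambda>x. f (h x)) = (\<lambda>x. \<Sum>j\<in>UNIV. f (axis j 1) * (h x $ j))"
    by blast
  then show ?case
    by (simp only:) (intro trig_sum_sum trig_sum_mult trig_sum_const assms finite)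
qed (auto intro: trig_sum_const trig_sum_add trig_sum_mult)

lemma trig_sum_bounded_continuous:
  assumes "trig_sum f"
  shows "continuous_on UNIV f \<and> (\<exists>K. \<forall>x. \<bar>f x\<bar> \<le> K)"
  using assms
proof induction
  case (trig_sum_cos c t b)
  have "\<bar>c * cos (t \<bullet> x + b)\<bar> \<le> \<bar>c\<bar>" for x
    by (simp add: abs_mult mult_left_le)
  then show ?case by (auto intro!: continuous_intros)
next
  case (trig_sum_add f g)
  then obtain K L where "\<forall>x. \<bar>f x\<bar> \<le> K" "\<forall>x. \<bar>g x\<bar> \<le> L" by blast
  then have "\<bar>f x + g x\<bar> \<le> K + L" for x
    by (meson abs_triangle_ineq add_mono order_trans)
  with trig_sum_add show ?case by (auto intro!: continuous_intros)
qed

text \<open>The coordinate map \<open>x \<mapsto> sin (\<pi> x / (2 L))\<close> is injective on \<open>[-L, L]\<close>, so on the cube every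
  continuous function factors through it, and Weierstrass approximation of the factor is uniform
  on the whole space.\<close>

lemma trig_sum_approximates:
  fixes f :: "real^'d::finite \<Rightarrow> real"
  assumes f: "continuous_on UNIV f" and bd: "\<And>x. \<bar>f x\<bar> \<le> K" and e: "0 < e"
  obtains g where "trig_sum g" "\<And>x. norm x \<le> L \<Longrightarrow> \<bar>f x - g x\<bar> \<le> e" "\<And>x. \<bar>g x\<bar> \<le> K + e"
proof -
  define L' where "L' = max L 1"
  have L': "0 < L'" "L \<le> L'" by (auto simp: L'_def)
  define h :: "real^'d \<Rightarrow> real^'d" where "h x = (\<chi> j. sin (pi / (2 * L') * x $ j))" for x
  \<comment> \<open>On the cube, \<open>arcsin\<close> inverts the coordinates of \<open>h\<close>.
    Every value of \<open>f'\<close> is a value of \<open>f\<close>, so \<open>f'\<close> inherits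
    the bound \<open>K\<close>.\<close>
  define f' where "f' y = f (\<chi> j. 2 * L' / pi * arcsin (y $ j))" for y :: "real^'d"
  let ?Q = "cbox (- 1) (1 :: real^'d)"
  have Q: "y \<in> ?Q \<longleftrightarrow> (\<forall>j. - 1 \<le> y $ j \<and> y $ j \<le> 1)" for y
    by (simp add: mem_box_cart)
  have "continuous_on ?Q f'"
    unfolding f'_def
  proof (rule continuous_on_compose2[OF f])
    show "continuous_on ?Q (\<lambda>y. \<chi> j. 2 * L' / pi * arcsin (y $ j))"
      by (intro continuous_on_vec_lambda continuous_intros) (auto simp: mem_box_cart)
  qed simp
  then obtain p where p: "real_polynomial_function p" "\<And>y. y \<in> ?Q \<Longrightarrow> \<bar>f' y - p y\<bar> < e"
    using Stone_Weierstrass_real_polynomial_function[of ?Q f' e] e by (metis compact_cbox)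
  have hQ: "h x \<in> ?Q" for x by (simp add: Q h_def)
  show ?thesis
  proof
    show "trig_sum (\<lambda>x. p (h x))"
    proof (rule trig_sum_polynomial[OF p(1)])
      fix j
      \<comment> \<open>A sine is a cosine with phase \<open>- (pi / 2)\<close>.\<close>
      have "h x $ j = 1 * cos ((pi / (2 * L')) *\<^sub>R axis j 1 \<bullet> x + (- (pi / 2)))" for x
        by (simp add: h_def inner_axis' cos_diff)
      then show "trig_sum (\<lambda>x. h x $ j)"
        by (simp only:) (rule trig_sum_cos)
    qed
    have ff: "f' (h x) = f x" if "norm x \<le> L" for x
    proof -
      have "2 * L' / pi * arcsin (h x $ j) = x $ j" for j
      proof -
        have "\<bar>x $ j\<bar> \<le> L'" using component_le_norm_cart[of x j] that L' by linarith
        then have "\<bar>pi / (2 * L') * x $ j\<bar> \<le> pi / 2"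
          using L' by (simp add: abs_mult field_simps)
        then have "arcsin (h x $ j) = pi / (2 * L') * x $ j"
          unfolding h_def vec_lambda_beta by (intro arcsin_sin) linarith+
        then show ?thesis using L' by simp
      qed
      then show ?thesis by (simp add: f'_def)
    qed
    show "\<bar>f x - p (h x)\<bar> \<le> e" if "norm x \<le> L" for x
      using p(2)[OF hQ, of x] ff[OF that] by simp
    \<comment> \<open>\<open>h\<close> maps the whole space into the cube, where \<open>p\<close> is
      within \<open>e\<close> of \<open>f'\<close>; hence no restriction on the norm of
      \<open>x\<close>.\<close>
    show "\<bar>p (h x)\<bar> \<le> K + e" for x
      using p(2)[OF hQ, of x] bd[of "\<chi> j. 2 * L' / pi * arcsin (h x $ j)"] unfolding f'_def by linarith
  qed
qed

text \<open>Bad events are only required to be contained in a small event, which avoids all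
  measurability side conditions on \<open>\<Phi>\<close>.\<close>

definition (in prob_space) whp :: "real \<Rightarrow> (nat \<Rightarrow> 'a \<Rightarrow> bool) \<Rightarrow> bool" where
  "whp e \<Phi> \<longleftrightarrow> (\<forall>\<^sub>F n in sequentially. \<exists>A\<in>events. prob A < e \<and> (\<forall>\<omega>\<in>space M - A. \<Phi> n \<omega>))"

section \<open>Calculus of events of high probability\<close>

context prob_space
begin

lemma whp_mono:
  assumes "whp a \<Phi>" "a \<le> b" "\<forall>\<^sub>F n in sequentially. \<forall>\<omega>\<in>space M. \<Phi> n \<omega> \<longrightarrow> \<Psi> n \<omega>"
  shows "whp b \<Psi>"
  using assms(1,3) unfolding whp_def
  by eventually_elim (use assms(2) in \<open>meson DiffD1 less_le_trans\<close>)

lemma whp_conj: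
  assumes "whp a \<Phi>" "whp b \<Psi>"
  shows "whp (a + b) (\<lambda>n \<omega>. \<Phi> n \<omega> \<and> \<Psi> n \<omega>)"
  using assms unfolding whp_def
proof eventually_elim
  case (elim n)
  then obtain A B where AB: "A \<in> events" "prob A < a" "\<forall>\<omega>\<in>space M - A. \<Phi> n \<omega>"
    "B \<in> events" "prob B < b" "\<forall>\<omega>\<in>space M - B. \<Psi> n \<omega>" by blast
  have "prob (A \<union> B) < a + b"
    using measure_Un_le[OF AB(1,4)] AB(2,5) by linarith
  then show ?case using AB by (intro bexI[of _ "A \<union> B"]) auto
qed

lemma whp_AE:
  assumes "0 < e" "\<forall>\<^sub>F n in sequentially. AE \<omega> in M. \<Phi> n \<omega>"
  shows "whp e \<Phi>"
  unfolding whp_def using assms(2)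
proof eventually_elim
  case (elim n)
  then obtain N where "N \<in> null_sets M" "{\<omega> \<in> space M. \<not> \<Phi> n \<omega>} \<subseteq> N"
    by (auto elim!: AE_E intro: null_setsI)
  then show ?case using assms(1) by (intro bexI[of _ N]) (auto simp: measure_eq_0_null_sets)
qed

text \<open>Each single family must be available at every level, because the allowance
  \<open>e\<close> is halved with each element of \<open>J\<close>.\<close>

lemma whp_Ball:
  assumes "finite J" "\<And>j e. j \<in> J \<Longrightarrow> 0 < e \<Longrightarrow> whp e (\<Phi> j)" "0 < e"
  shows "whp e (\<lambda>n \<omega>. \<forall>j\<in>J. \<Phi> j n \<omega>)"
  using assms
proof (induction J arbitrary: e rule: finite_induct)
  case empty
  then show ?case by (intro whp_AE) auto
next
  case (insert j J)
  have "whp (e / 2 + e / 2) (\<lambda>n \<omega>. \<Phi> j n \<omega> \<and> (\<forall>j\<in>J. \<Phi> j n \<omega>))"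
    by (intro whp_conj insert) (use insert.prems in auto)
  then show ?case by simp
qed

text \<open>The difference is at most \<open>e\<close> off the bad event \<open>A\<close> and at
  most \<open>K + K'\<close> on it.\<close>

lemma abs_expectation_diff_le:
  fixes f g :: "'a \<Rightarrow> real"
  assumes [measurable]: "f \<in> borel_measurable M" "g \<in> borel_measurable M" "A \<in> events"
    and K: "\<And>\<omega>. \<bar>f \<omega>\<bar> \<le> K" "\<And>\<omega>. \<bar>g \<omega>\<bar> \<le> K'" and e: "0 \<le> e"
    and le: "\<And>\<omega>. \<omega> \<in> space M - A \<Longrightarrow> \<bar>f \<omega> - g \<omega>\<bar> \<le> e"
  shows "\<bar>expectation f - expectation g\<bar> \<le> e + (K + K') * prob A"
proof -
  have fi: "integrable M f" by (rule integrable_const_bound[of _ K]) (auto simp: K)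
  have gi: "integrable M g" by (rule integrable_const_bound[of _ K']) (auto simp: K)
  have KK: "0 \<le> K + K'" using K[of undefined] by linarith
  have "\<bar>expectation f - expectation g\<bar> = \<bar>expectation (\<lambda>\<omega>. f \<omega> - g \<omega>)\<bar>"
    using fi gi by simp
  also have "\<dots> \<le> expectation (\<lambda>\<omega>. \<bar>f \<omega> - g \<omega>\<bar>)"
    by (rule integral_abs_bound)
  also have "\<dots> \<le> expectation (\<lambda>\<omega>. e + (K + K') * indicator A \<omega>)"
  proof (rule integral_mono)
    fix \<omega> assume w: "\<omega> \<in> space M"
    have "\<bar>f \<omega> - g \<omega>\<bar> \<le> K + K'" using K(1)[of \<omega>] K(2)[of \<omega>] by linarith
    then show "\<bar>f \<omega> - g \<omega>\<bar> \<le> e + (K + K') * indicator A \<omega>"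
      using le[of \<omega>] w e KK by (auto split: split_indicator)
  qed (use fi gi in \<open>auto simp: emeasure_eq_measure intro!: integrable_real_indicator Bochner_Integration.integrable_add\<close>)
  also have "\<dots> = e + (K + K') * prob A"
    using assms(3) by (subst Bochner_Integration.integral_add)
      (auto simp: emeasure_eq_measure prob_space intro!: integrable_real_indicator)
  finally show ?thesis .
qed

text \<open>Tightness of a single law, by continuity from above; applied below to the identity under
  the limit law.\<close>

lemma exists_norm_tail_less:
  fixes Y :: "'a \<Rightarrow> 'b::{real_normed_vector,second_countable_topology}"
  assumes [measurable]: "Y \<in> borel_measurable M" and "0 < e"
  obtains K where "prob {\<omega> \<in> space M. \<not> norm (Y \<omega>) \<le> K} < e"
proof -
  let ?A = "\<lambda>i::nat. {\<omega> \<in> space M. \<not> norm (Y \<omega>) \<le> real i}"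
  have "(\<lambda>i. prob (?A i)) \<longlonglongrightarrow> prob (\<Inter>i. ?A i)"
    by (rule finite_Lim_measure_decseq) (auto simp: decseq_def)
  moreover have "(\<Inter>i. ?A i) = {}"
    using real_arch_simple by auto
  ultimately have "\<forall>\<^sub>F i in sequentially. prob (?A i) < e"
    using assms(2) by (intro order_tendstoD) auto
  then show ?thesis using that eventually_happens'[OF sequentially_bot] by blast
qed

lemma tendsto_expectation_trig_sum:
  fixes Y :: "nat \<Rightarrow> 'a \<Rightarrow> real^'d::finite"
  assumes "trig_sum g"
    and meas: "\<forall>\<^sub>F n in sequentially. Y n \<in> borel_measurable M"
    and L: "prob_space L" "sets L = sets borel"
    and cos: "\<And>t b. (\<lambda>n. expectation (\<lambda>\<omega>. cos (t \<bullet> Y n \<omega> + b))) \<longlonglongrightarrow> (LINT x|L. cos (t \<bullet> x + b))"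
  shows "(\<lambda>n. expectation (\<lambda>\<omega>. g (Y n \<omega>))) \<longlonglongrightarrow> (LINT x|L. g x)"
  using assms(1)
proof induction
  case (trig_sum_cos c t b)
  then show ?case using tendsto_mult_left[OF cos, of c] by simp
next
  case (trig_sum_add f g)
  interpret L: prob_space L by fact
  have intL: "integrable L h" if h: "trig_sum h" for h
  proof -
    obtain K where "\<forall>x. \<bar>h x\<bar> \<le> K" "continuous_on UNIV h"
      using trig_sum_bounded_continuous[OF h] by blast
    then show ?thesis
      using borel_measurable_continuous_onI[of h] L(2)
      by (intro L.integrable_const_bound[of _ K]) (auto cong: measurable_cong_sets)
  qed
  have intM: "integrable M (\<lambda>\<omega>. h (Y n \<omega>))" if h: "trig_sum h" "Y n \<in> borel_measurable M" for h n
  proof -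
    obtain K where "\<forall>x. \<bar>h x\<bar> \<le> K" "continuous_on UNIV h"
      using trig_sum_bounded_continuous[OF h(1)] by blast
    then show ?thesis
      using measurable_compose[OF h(2) borel_measurable_continuous_onI[of h]]
      by (intro integrable_const_bound[of _ K]) auto
  qed
  have "(\<lambda>n. expectation (\<lambda>\<omega>. f (Y n \<omega>)) + expectation (\<lambda>\<omega>. g (Y n \<omega>)))
      \<longlonglongrightarrow> (LINT x|L. f x + g x)"
    using tendsto_add[OF trig_sum_add.IH] trig_sum_add.hyps intL by simp
  then show ?case
  proof (rule Lim_transform_eventually)
    show "\<forall>\<^sub>F n in sequentially. expectation (\<lambda>\<omega>. f (Y n \<omega>)) + expectation (\<lambda>\<omega>. g (Y n \<omega>)) =
        expectation (\<lambda>\<omega>. f (Y n \<omega>) + g (Y n \<omega>))"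
      using meas by eventually_elim (simp add: intM trig_sum_add.hyps)
  qed
qed

text \<open>Plays the part of Levy's continuity theorem: cosines with phases determine the limit,
  and tightness makes it enough to approximate a test function on one large ball. Measurability is
  asked only eventually because a selection is specified only from sample size 1 on.\<close>

theorem converges_in_lawI:
  fixes Y :: "nat \<Rightarrow> 'a \<Rightarrow> real^'d::finite"
  assumes meas: "\<forall>\<^sub>F n in sequentially. Y n \<in> borel_measurable M"
    and L: "prob_space L" "sets L = sets borel"
    and cos: "\<And>t b. (\<lambda>n. expectation (\<lambda>\<omega>. cos (t \<bullet> Y n \<omega> + b))) \<longlonglongrightarrow> (LINT x|L. cos (t \<bullet> x + b))"
    and tight: "\<And>e. 0 < e \<Longrightarrow> \<exists>K. whp e (\<lambda>n \<omega>. norm (Y n \<omega>) \<le> K)"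
  shows "converges_in_law M Y L"
  unfolding converges_in_law_def weakly_converges_def
proof (intro allI impI, elim conjE)
  fix f :: "real^'d \<Rightarrow> real"
  assume f: "continuous_on UNIV f" and "bounded (range f)"
  then obtain K where "0 < K" and K: "\<And>x. \<bar>f x\<bar> \<le> K"
    by (auto simp: bounded_pos)
  interpret L: prob_space L by fact
  note [measurable_cong] = L(2)
  have fm [measurable]: "f \<in> borel_measurable borel"
    by (rule borel_measurable_continuous_onI) fact
  have "(\<lambda>n. expectation (\<lambda>\<omega>. f (Y n \<omega>))) \<longlonglongrightarrow> (LINT x|L. f x)"
  proof (rule tendstoI)
    fix \<eta> :: real assume "0 < \<eta>"
    \<comment> \<open>Replacing \<open>f\<close> by the trigonometric \<open>g\<close> costs at most
      \<open>(2 + 2 * K) * e\<close> under \<open>Y n\<close> and again under \<open>L\<close>, and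
      the convergence for \<open>g\<close> costs \<open>e\<close>; the total
      \<open>(5 + 4 * K) * e\<close> is below \<open>\<eta>\<close>. The cap 1 turns the bound
      \<open>K + e\<close> on \<open>g\<close> into \<open>K + 1\<close>.\<close>
    define e where "e = min 1 (\<eta> / (6 + 4 * K))"
    have "e \<le> \<eta> / (6 + 4 * K)" by (simp add: e_def)
    then have e3: "(6 + 4 * K) * e \<le> \<eta>"
      using \<open>0 < K\<close> by (simp add: pos_le_divide_eq mult.commute)
    have "0 < e" "e \<le> 1"
      using \<open>0 < \<eta>\<close> \<open>0 < K\<close> by (simp_all add: e_def)
    note e = this e3
    have bound: "e + (K + (K + e)) * p \<le> (2 + 2 * K) * e" if "0 \<le> p" "p < e" for p
    proof -
      have "(K + (K + e)) * p \<le> (2 * K + 1) * e"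
        using that e \<open>0 < K\<close> by (intro mult_mono) auto
      then show ?thesis by (simp add: algebra_simps)
    qed
    obtain R1 where R1: "whp e (\<lambda>n \<omega>. norm (Y n \<omega>) \<le> R1)" using tight[OF e(1)] by blast
    obtain R2 where R2: "L.prob {x \<in> space L. \<not> norm x \<le> R2} < e"
      using L.exists_norm_tail_less[of "\<lambda>x. x" e] e by auto
    \<comment> \<open>One approximation on the larger of the two balls serves both the sequence and
      the limit.\<close>
    obtain g where g: "trig_sum g" "\<And>x. norm x \<le> max R1 R2 \<Longrightarrow> \<bar>f x - g x\<bar> \<le> e" "\<And>x. \<bar>g x\<bar> \<le> K + e"
      using trig_sum_approximates[OF f K e(1)] by metis
    have gm [measurable]: "g \<in> borel_measurable borel"
      using trig_sum_bounded_continuous[OF g(1)] by (intro borel_measurable_continuous_onI) auto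
    have "\<bar>(LINT x|L. f x) - (LINT x|L. g x)\<bar> \<le> e + (K + (K + e)) * L.prob {x \<in> space L. \<not> norm x \<le> R2}"
      using K g e by (intro L.abs_expectation_diff_le) auto
    also have "\<dots> \<le> (2 + 2 * K) * e"
      by (rule bound) (use R2 in auto)
    finally have 1: "\<bar>(LINT x|L. f x) - (LINT x|L. g x)\<bar> \<le> (2 + 2 * K) * e" .
    have "\<forall>\<^sub>F n in sequentially. dist (expectation (\<lambda>\<omega>. g (Y n \<omega>))) (LINT x|L. g x) < e"
      using tendsto_expectation_trig_sum[OF g(1) meas L cos] e(1) by (rule tendstoD)
    then show "\<forall>\<^sub>F n in sequentially. dist (expectation (\<lambda>\<omega>. f (Y n \<omega>))) (LINT x|L. f x) < \<eta>"
      using R1[unfolded whp_def] meas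
    proof eventually_elim
      case (elim n)
      note [measurable] = elim(3)
      from elim(2) obtain A where A: "A \<in> events" "prob A < e" "\<forall>\<omega>\<in>space M - A. norm (Y n \<omega>) \<le> R1"
        by blast
      have "\<bar>f x - g x\<bar> \<le> e" if "norm x \<le> R1" for x using g(2)[of x] that by simp
      then have "\<bar>expectation (\<lambda>\<omega>. f (Y n \<omega>)) - expectation (\<lambda>\<omega>. g (Y n \<omega>))\<bar> \<le> e + (K + (K + e)) * prob A"
        using K g(3) e(1) A by (intro abs_expectation_diff_le) auto
      also have "\<dots> \<le> (2 + 2 * K) * e"
        by (rule bound) (use A in auto)
      finally have "\<bar>expectation (\<lambda>\<omega>. f (Y n \<omega>)) - (LINT x|L. f x)\<bar> < (2 + 2 * K) * e + e + (2 + 2 * K) * e"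
        using 1 elim(1) unfolding dist_real_def by linarith
      also have "\<dots> \<le> (6 + 4 * K) * e" using e by (simp add: algebra_simps)
      finally show ?case using e(3) by (simp add: dist_real_def)
    qed
  qed
  then show "(\<lambda>n. LINT x|distr M borel (Y n). f x) \<longlonglongrightarrow> (LINT x|L. f x)"
  proof (rule Lim_transform_eventually)
    show "\<forall>\<^sub>F n in sequentially. expectation (\<lambda>\<omega>. f (Y n \<omega>)) = (LINT x|distr M borel (Y n). f x)"
      using meas by eventually_elim (simp add: integral_distr)
  qed
qed

end


section \<open>Limit theorems for i.i.d. samples\<close>

context prob_space
begin

section \<open>Chebyshev and Markov bounds, second moments of independent sums\<close>

lemma whp_abs_le_of_second_moment:
  fixes Y :: "nat \<Rightarrow> 'a \<Rightarrow> real"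
  assumes Y: "\<forall>\<^sub>F n in sequentially. Y n \<in> borel_measurable M \<and>
      integrable M (\<lambda>\<omega>. (Y n \<omega>)\<^sup>2) \<and> expectation (\<lambda>\<omega>. (Y n \<omega>)\<^sup>2) < e * d\<^sup>2"
    and d: "0 < d"
  shows "whp e (\<lambda>n \<omega>. \<bar>Y n \<omega>\<bar> \<le> d)"
  unfolding whp_def using Y
proof eventually_elim
  case (elim n)
  then have [measurable]: "Y n \<in> borel_measurable M" by blast
  have "prob {\<omega> \<in> space M. d \<le> \<bar>Y n \<omega>\<bar>} \<le> expectation (\<lambda>\<omega>. (Y n \<omega>)\<^sup>2) / d\<^sup>2"
    using elim d by (intro second_moment_method) auto
  also have "\<dots> < e"
    using elim d by (simp add: pos_divide_less_eq)
  finally show ?case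
    by (intro bexI[of _ "{\<omega> \<in> space M. d \<le> \<bar>Y n \<omega>\<bar>}"]) auto
qed

lemma whp_le_of_expectation:
  fixes Y :: "nat \<Rightarrow> 'a \<Rightarrow> real"
  assumes Y: "\<forall>\<^sub>F n in sequentially. integrable M (Y n) \<and> (\<forall>\<omega>\<in>space M. 0 \<le> Y n \<omega>) \<and> expectation (Y n) < e * d"
    and d: "0 < d"
  shows "whp e (\<lambda>n \<omega>. Y n \<omega> \<le> d)"
  unfolding whp_def using Y
proof eventually_elim
  case (elim n)
  then have [measurable]: "Y n \<in> borel_measurable M" by blast
  have "prob {\<omega> \<in> space M. d \<le> Y n \<omega>} \<le> expectation (Y n) / d"
    using elim d by (intro integral_Markov_inequality_measure[of _ _ "{}"]) auto
  also have "\<dots> < e"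
    using elim d by (simp add: pos_divide_less_eq)
  finally show ?case
    by (intro bexI[of _ "{\<omega> \<in> space M. d \<le> Y n \<omega>}"]) auto
qed

lemma second_moment_sum_indep:
  fixes Y :: "nat \<Rightarrow> 'a \<Rightarrow> real"
  assumes ind: "indep_vars (\<lambda>_. borel) Y UNIV"
    and sq: "\<And>i. integrable M (\<lambda>\<omega>. (Y i \<omega>)\<^sup>2)" "\<And>i. expectation (\<lambda>\<omega>. (Y i \<omega>)\<^sup>2) = v"
    and mean: "\<And>i. expectation (Y i) = 0"
  shows "integrable M (\<lambda>\<omega>. (\<Sum>i<n. Y i \<omega>)\<^sup>2) \<and> expectation (\<lambda>\<omega>. (\<Sum>i<n. Y i \<omega>)\<^sup>2) = n * v"
proof (induction n)
  case 0
  then show ?case by simp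
next
  case (Suc n)
  have [measurable]: "Y i \<in> borel_measurable M" for i
    using ind by (simp add: indep_vars_def)
  let ?S = "\<lambda>\<omega>. \<Sum>i<n. Y i \<omega>"
  have intY: "integrable M (Y i)" for i
    by (rule square_integrable_imp_integrable[OF _ sq(1)]) simp
  have intS: "integrable M ?S" using intY by auto
  have indn: "indep_var borel (Y n) borel ?S"
    using ind by (intro indep_vars_sum) (auto intro: indep_vars_subset)
  have prod: "integrable M (\<lambda>\<omega>. Y n \<omega> * ?S \<omega>)" "expectation (\<lambda>\<omega>. Y n \<omega> * ?S \<omega>) = 0"
    using indep_var_integrable[OF indn intY intS] indep_var_lebesgue_integral[OF indn intY intS] mean
    by simp_all
  have "(\<lambda>\<omega>. (\<Sum>i<Suc n. Y i \<omega>)\<^sup>2) = (\<lambda>\<omega>. (?S \<omega>)\<^sup>2 + (2 * (Y n \<omega> * ?S \<omega>) + (Y n \<omega>)\<^sup>2))"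
    by (simp add: power2_eq_square algebra_simps)
  then show ?case
    using Suc sq prod by (simp add: algebra_simps)
qed

end

locale iid_sample = prob_space M for M :: "'a measure" +
  fixes X :: "nat \<Rightarrow> 'a \<Rightarrow> 'b::topological_space" and Q :: "'b measure"
  assumes indep: "indep_vars (\<lambda>_. borel) X UNIV"
    and distr_X: "\<And>i. distr M borel (X i) = Q"
begin

lemma measurable_X [measurable]: "X i \<in> borel_measurable M"
  using indep by (simp add: indep_vars_def)

lemma sets_Q [measurable_cong]: "sets Q = sets borel"
  by (subst distr_X[of 0, symmetric]) simp

lemma space_Q [simp]: "space Q = UNIV"
  by (subst distr_X[of 0, symmetric]) simp

lemma borel_measurable_Q_iff [simp]: "f \<in> borel_measurable Q \<longleftrightarrow> f \<in> borel_measurable borel"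
  by (simp cong: measurable_cong_sets add: sets_Q)

sublocale Q: prob_space Q
  by (subst distr_X[of 0, symmetric]) (rule prob_space_distr, simp)

lemma prob_Q_UNIV [simp]: "Q.prob UNIV = 1"
  using Q.prob_space by simp

lemma expectation_X:
  fixes f :: "'b \<Rightarrow> 'c::{banach,second_countable_topology}"
  assumes "f \<in> borel_measurable borel"
  shows "expectation (\<lambda>\<omega>. f (X i \<omega>)) = (LINT x|Q. f x)"
  using assms by (subst distr_X[of i, symmetric], subst integral_distr) auto

lemma integrable_X_iff:
  fixes f :: "'b \<Rightarrow> 'c::{banach,second_countable_topology}"
  assumes "f \<in> borel_measurable borel"
  shows "integrable M (\<lambda>\<omega>. f (X i \<omega>)) \<longleftrightarrow> integrable Q f"
  using assms by (subst distr_X[of i, symmetric], subst integrable_distr_eq) auto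

lemma nn_integral_X:
  assumes "f \<in> borel_measurable borel"
  shows "(\<integral>\<^sup>+\<omega>. f (X i \<omega>) \<partial>M) = (\<integral>\<^sup>+x. f x \<partial>Q)"
  using assms by (subst distr_X[of i, symmetric], subst nn_integral_distr) auto

lemma AE_X:
  assumes "{x. \<Phi> x} \<in> sets borel" "AE x in Q. \<Phi> x"
  shows "AE \<omega> in M. \<Phi> (X i \<omega>)"
  using assms by (subst (asm) distr_X[of i, symmetric], subst (asm) AE_distr_iff) auto

lemma indep_vars_X:
  assumes "f \<in> borel_measurable borel"
  shows "indep_vars (\<lambda>_. borel) (\<lambda>i \<omega>. f (X i \<omega>)) UNIV"
  by (rule indep_vars_compose2[OF indep]) (use assms in auto)

lemma centered_sum_second_moment:
  fixes f :: "'b \<Rightarrow> real"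
  assumes f: "integrable Q (\<lambda>x. (f x)\<^sup>2)" "f \<in> borel_measurable borel" "(LINT x|Q. f x) = 0"
  shows "integrable M (\<lambda>\<omega>. (\<Sum>i<n. f (X i \<omega>))\<^sup>2)"
    and "expectation (\<lambda>\<omega>. (\<Sum>i<n. f (X i \<omega>))\<^sup>2) = n * (LINT x|Q. (f x)\<^sup>2)"
  using second_moment_sum_indep[OF indep_vars_X[OF f(2)], of "LINT x|Q. (f x)\<^sup>2" n] f
    expectation_X[of "\<lambda>x. (f x)\<^sup>2"] integrable_X_iff[of "\<lambda>x. (f x)\<^sup>2"] expectation_X[OF f(2)]
  by simp_all

lemma tight_normalized_sum:
  fixes f :: "'b \<Rightarrow> real"
  assumes f: "integrable Q (\<lambda>x. (f x)\<^sup>2)" "f \<in> borel_measurable borel" "(LINT x|Q. f x) = 0"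
    and e: "0 < e"
  shows "\<exists>K. whp e (\<lambda>n \<omega>. \<bar>(\<Sum>i<n. f (X i \<omega>)) / sqrt n\<bar> \<le> K)"
proof -
  let ?v = "LINT x|Q. (f x)\<^sup>2"
  have v: "0 \<le> ?v" by simp
  \<comment> \<open>Chebyshev asks for \<open>?v < e * K\<^sup>2\<close>. The first summand gives
    \<open>?v < e * K\<close>, the second gives \<open>1 \<le> K\<close> and so
    \<open>K \<le> K\<^sup>2\<close>.\<close>
  define K where "K = (?v + 1) / e + 1"
  have "e * K = ?v + 1 + e" using e by (simp add: K_def field_simps)
  then have K: "1 \<le> K" "?v < e * K"
    using v e by (simp_all add: K_def)
  have "e * K \<le> e * K\<^sup>2"
    using K(1) e by (simp add: power2_eq_square)
  then have "?v < e * K\<^sup>2" using K(2) by linarith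
  then have "whp e (\<lambda>n \<omega>. \<bar>(\<Sum>i<n. f (X i \<omega>)) / sqrt n\<bar> \<le> K)"
    using K(1) e f(2) centered_sum_second_moment[OF f(1-3)] v
    by (intro whp_abs_le_of_second_moment always_eventually)
       (auto simp: power_divide)
  then show ?thesis ..
qed

text \<open>A bounded function has finite variance \<open>?v\<close>; the sample mean has variance
  \<open>?v / n\<close>, and Chebyshev applies.\<close>

lemma weak_law_bounded:
  fixes f :: "'b \<Rightarrow> real"
  assumes f: "f \<in> borel_measurable borel" "\<And>x. \<bar>f x\<bar> \<le> K" and e: "0 < e" and d: "0 < d"
  shows "whp e (\<lambda>n \<omega>. \<bar>(\<Sum>i<n. f (X i \<omega>)) / n - (LINT x|Q. f x)\<bar> \<le> d)"
proof -
  define m where "m = (LINT x|Q. f x)"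
  let ?v = "LINT x|Q. (f x - m)\<^sup>2"
  have int: "integrable Q f"
    by (rule Q.integrable_const_bound[of _ K]) (use f in auto)
  have "\<bar>(f x - m)\<^sup>2\<bar> \<le> (K + \<bar>m\<bar>)\<^sup>2" for x
  proof -
    have "\<bar>f x - m\<bar> \<le> \<bar>K + \<bar>m\<bar>\<bar>" using f(2)[of x] by linarith
    then show ?thesis by (simp flip: abs_le_square_iff)
  qed
  then have sq: "integrable Q (\<lambda>x. (f x - m)\<^sup>2)"
    by (intro Q.integrable_const_bound[of _ "(K + \<bar>m\<bar>)\<^sup>2"]) (use f in auto)
  have zero: "(LINT x|Q. f x - m) = 0"
    using int by (simp add: m_def Q.prob_space)
  have m: "(\<lambda>x. f x - m) \<in> borel_measurable borel" using f(1) by measurable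
  note sm = centered_sum_second_moment[OF sq m zero]
  have "(\<lambda>n. ?v / real n) \<longlonglongrightarrow> 0"
    by (rule lim_const_over_n)
  then have "\<forall>\<^sub>F n in sequentially. ?v / real n < e * d\<^sup>2"
    using e d by (intro order_tendstoD) auto
  then have "\<forall>\<^sub>F n in sequentially. (\<lambda>\<omega>. (\<Sum>i<n. f (X i \<omega>) - m) / n) \<in> borel_measurable M \<and>
      integrable M (\<lambda>\<omega>. ((\<Sum>i<n. f (X i \<omega>) - m) / n)\<^sup>2) \<and>
      expectation (\<lambda>\<omega>. ((\<Sum>i<n. f (X i \<omega>) - m) / n)\<^sup>2) < e * d\<^sup>2"
    using eventually_gt_at_top[of 0]
  proof eventually_elim
    case (elim n)
    then show ?case
      using f(1) sm[of n] by (simp add: power_divide power2_eq_square)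
  qed
  then have "whp e (\<lambda>n \<omega>. \<bar>(\<Sum>i<n. f (X i \<omega>) - m) / n\<bar> \<le> d)"
    using d by (rule whp_abs_le_of_second_moment)
  then show ?thesis
  proof (rule whp_mono)
    show "\<forall>\<^sub>F n in sequentially. \<forall>\<omega>\<in>space M. \<bar>(\<Sum>i<n. f (X i \<omega>) - m) / n\<bar> \<le> d \<longrightarrow>
        \<bar>(\<Sum>i<n. f (X i \<omega>)) / n - (LINT x|Q. f x)\<bar> \<le> d"
      using eventually_gt_at_top[of 0]
      by eventually_elim (auto simp: m_def sum_subtractf diff_divide_distrib)
  qed simp
qed

text \<open>Only a first moment is assumed, as is required for squared distances. The function is
  split into a bounded part, covered by Chebyshev, and a tail \<open>h k\<close> whose mean absolute
  value is small, so that Markov controls its sample mean.\<close>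

theorem weak_law:
  fixes f :: "'b \<Rightarrow> real"
  assumes f: "integrable Q f" and e: "0 < e" and d: "0 < d"
  shows "whp e (\<lambda>n \<omega>. \<bar>(\<Sum>i<n. f (X i \<omega>)) / n - (LINT x|Q. f x)\<bar> \<le> d)"
proof -
  have fm [measurable]: "f \<in> borel_measurable borel"
    using borel_measurable_integrable[OF f] by simp
  define h where "h k x = (if \<bar>f x\<bar> \<le> real k then 0 else f x)" for k :: nat and x
  have hm [measurable]: "h k \<in> borel_measurable borel" for k
    unfolding h_def by measurable
  have hint: "integrable Q (h k)" for k
    by (rule Bochner_Integration.integrable_bound[OF f]) (auto simp: h_def)
  have "(\<lambda>k. LINT x|Q. \<bar>h k x\<bar>) \<longlonglongrightarrow> (LINT x|Q. 0)"
  proof (rule integral_dominated_convergence[where w = "\<lambda>x. \<bar>f x\<bar>"])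
    have "(\<lambda>k. \<bar>h k x\<bar>) \<longlonglongrightarrow> 0" for x
    proof (rule tendsto_eventually)
      obtain k0 :: nat where "\<bar>f x\<bar> \<le> real k0" using real_arch_simple by blast
      then show "\<forall>\<^sub>F k in sequentially. \<bar>h k x\<bar> = 0"
        by (intro eventually_sequentiallyI[of k0]) (auto simp: h_def)
    qed
    then show "AE x in Q. (\<lambda>k. \<bar>h k x\<bar>) \<longlonglongrightarrow> 0" by simp
  qed (use f in \<open>auto simp: h_def\<close>)
  \<comment> \<open>Of the tolerance \<open>d\<close>, the bounded part receives
    \<open>d / 2\<close>, the sample mean of the tail \<open>d / 4\<close> and the expectation of
    the tail \<open>d / 4\<close>. The second bound in the minimum lets Markov hold with failure
    probability \<open>e / 2\<close>.\<close>
  then have "\<forall>\<^sub>F k in sequentially. (LINT x|Q. \<bar>h k x\<bar>) < min (d / 4) (e / 2 * (d / 4))"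
    using e d by (intro order_tendstoD) auto
  then obtain k where k: "(LINT x|Q. \<bar>h k x\<bar>) < d / 4" "(LINT x|Q. \<bar>h k x\<bar>) < e / 2 * (d / 4)"
    using eventually_happens'[OF sequentially_bot] by fastforce
  define g where "g x = f x - h k x" for x
  have "whp (e / 2) (\<lambda>n \<omega>. \<bar>(\<Sum>i<n. g (X i \<omega>)) / n - (LINT x|Q. g x)\<bar> \<le> d / 2)"
    using e d by (intro weak_law_bounded[of _ "real k"]) (auto simp: g_def h_def)
  moreover have "whp (e / 2) (\<lambda>n \<omega>. (\<Sum>i<n. \<bar>h k (X i \<omega>)\<bar>) / n \<le> d / 4)"
  proof (rule whp_le_of_expectation)
    have habs: "integrable M (\<lambda>\<omega>. \<bar>h k (X i \<omega>)\<bar>)" for i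
      using hint[of k] by (subst integrable_X_iff[of "\<lambda>x. \<bar>h k x\<bar>"]) auto
    show "\<forall>\<^sub>F n in sequentially. integrable M (\<lambda>\<omega>. (\<Sum>i<n. \<bar>h k (X i \<omega>)\<bar>) / n) \<and>
        (\<forall>\<omega>\<in>space M. 0 \<le> (\<Sum>i<n. \<bar>h k (X i \<omega>)\<bar>) / n) \<and>
        expectation (\<lambda>\<omega>. (\<Sum>i<n. \<bar>h k (X i \<omega>)\<bar>) / n) < e / 2 * (d / 4)"
      using eventually_gt_at_top[of 0]
    proof eventually_elim
      case (elim n)
      have "expectation (\<lambda>\<omega>. (\<Sum>i<n. \<bar>h k (X i \<omega>)\<bar>) / n) = (LINT x|Q. \<bar>h k x\<bar>)"
        using elim habs expectation_X[of "\<lambda>x. \<bar>h k x\<bar>"] by simp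
      then show ?case using habs k(2) by (auto intro: sum_nonneg)
    qed
  qed (use d in simp)
  ultimately have "whp (e / 2 + e / 2) (\<lambda>n \<omega>. \<bar>(\<Sum>i<n. g (X i \<omega>)) / n - (LINT x|Q. g x)\<bar> \<le> d / 2 \<and>
      (\<Sum>i<n. \<bar>h k (X i \<omega>)\<bar>) / n \<le> d / 4)"
    by (rule whp_conj)
  then show ?thesis
  proof (rule whp_mono)
    have "\<bar>(\<Sum>i<n. f (X i \<omega>)) / n - (LINT x|Q. f x)\<bar> \<le> d"
      if 1: "\<bar>(\<Sum>i<n. g (X i \<omega>)) / n - (LINT x|Q. g x)\<bar> \<le> d / 2"
        and 2: "(\<Sum>i<n. \<bar>h k (X i \<omega>)\<bar>) / n \<le> d / 4" for n \<omega>
    proof -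
      have "\<bar>(\<Sum>i<n. h k (X i \<omega>)) / n\<bar> \<le> (\<Sum>i<n. \<bar>h k (X i \<omega>)\<bar>) / n"
        by (simp add: divide_right_mono sum_abs)
      moreover have "\<bar>LINT x|Q. h k x\<bar> \<le> d / 4"
        using integral_abs_bound[of Q "h k"] k(1) by linarith
      moreover have "(\<Sum>i<n. f (X i \<omega>)) / n = (\<Sum>i<n. g (X i \<omega>)) / n + (\<Sum>i<n. h k (X i \<omega>)) / n"
        by (simp add: g_def sum_subtractf diff_divide_distrib)
      moreover have "(LINT x|Q. f x) = (LINT x|Q. g x) + (LINT x|Q. h k x)"
        using f hint by (simp add: g_def)
      ultimately show ?thesis using 1 2 by linarith
    qed
    then show "\<forall>\<^sub>F n in sequentially. \<forall>\<omega>\<in>space M. \<bar>(\<Sum>i<n. g (X i \<omega>)) / n - (LINT x|Q. g x)\<bar> \<le> d / 2 \<and>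
        (\<Sum>i<n. \<bar>h k (X i \<omega>)\<bar>) / n \<le> d / 4 \<longrightarrow> \<bar>(\<Sum>i<n. f (X i \<omega>)) / n - (LINT x|Q. f x)\<bar> \<le> d"
      by simp
  qed simp
qed

text \<open>The central limit theorem normalizes by the standard deviation, so zero variance is
  treated apart: then the summands vanish almost surely and both sides are
  \<open>cos b\<close>.\<close>

lemma tendsto_expectation_cos_normalized_sum:
  fixes f :: "'b \<Rightarrow> real"
  assumes f: "integrable Q (\<lambda>x. (f x)\<^sup>2)" "f \<in> borel_measurable borel" "(LINT x|Q. f x) = 0"
  shows "(\<lambda>n. expectation (\<lambda>\<omega>. cos ((\<Sum>i<n. f (X i \<omega>)) / sqrt n + b)))
    \<longlonglongrightarrow> exp (- (LINT x|Q. (f x)\<^sup>2) / 2) * cos b"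
proof (cases "(LINT x|Q. (f x)\<^sup>2) = 0")
  case True
  note [measurable] = f(2)
  have "AE x in Q. (f x)\<^sup>2 = 0"
    using integral_nonneg_eq_0_iff_AE[OF f(1)] True by simp
  then have "AE x in Q. f x = 0" by simp
  then have "AE \<omega> in M. f (X i \<omega>) = 0" for i
    by (intro AE_X) auto
  then have "AE \<omega> in M. \<forall>i. f (X i \<omega>) = 0"
    by (simp add: AE_all_countable)
  then have "expectation (\<lambda>\<omega>. cos ((\<Sum>i<n. f (X i \<omega>)) / sqrt n + b)) = expectation (\<lambda>\<omega>. cos b)" for n
    by (intro integral_cong_AE) (auto elim: AE_mp)
  then show ?thesis using True by (simp add: prob_space)
next
  case False
  note [measurable] = f(2)
  define s where "s = sqrt (LINT x|Q. (f x)\<^sup>2)"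
  have v: "0 < (LINT x|Q. (f x)\<^sup>2)"
    using False by (simp add: order_le_neq_trans)
  then have s: "0 < s" "s\<^sup>2 = (LINT x|Q. (f x)\<^sup>2)" by (simp_all add: s_def)
  let ?Z = "\<lambda>n \<omega>. (\<Sum>i<n. f (X i \<omega>)) / sqrt (real n * s\<^sup>2)"
  have conv: "weak_conv_m (\<lambda>n. distr M borel (?Z n)) std_normal_distribution"
  proof (rule central_limit_theorem_zero_mean[where \<mu> = "distr Q borel f"])
    show "distr M borel (\<lambda>\<omega>. f (X n \<omega>)) = distr Q borel f" for n
      by (subst distr_X[of n, symmetric], subst distr_distr) (auto simp: o_def)
  qed (use f s expectation_X[of "\<lambda>x. (f x)\<^sup>2"] integrable_X_iff[of "\<lambda>x. (f x)\<^sup>2"] in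
      \<open>auto simp: indep_vars_X expectation_X[OF f(2)]\<close>)
  \<comment> \<open>The factor \<open>s\<close> in the test function undoes the normalization by the
    standard deviation.\<close>
  have "(\<lambda>n. LINT z|distr M borel (?Z n). cos (s * z + b)) \<longlonglongrightarrow> (LINT z|std_normal_distribution. cos (s * z + b))"
  proof (rule weak_conv_imp_integral_bdd_continuous_conv[where B = 1, OF _ _ conv])
    show "real_distribution (distr M borel (?Z n))" for n
      by (rule real_distribution_distr) simp
  qed (auto simp: real_dist_normal_dist)
  moreover have "(LINT z|distr M borel (?Z n). cos (s * z + b)) = expectation (\<lambda>\<omega>. cos ((\<Sum>i<n. f (X i \<omega>)) / sqrt n + b))" for n
    using s(1) by (subst integral_distr) (auto simp: real_sqrt_mult)
  moreover have "(LINT z|std_normal_distribution. cos (s * z + b)) = exp (- (LINT x|Q. (f x)\<^sup>2) / 2) * cos b"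
  proof -
    interpret N: real_distribution std_normal_distribution by (rule real_dist_normal_dist)
    have int: "integrable std_normal_distribution (\<lambda>z. cis (s * z))"
      by (rule N.integrable_const_bound[of _ 1]) (auto simp: cis_conv_exp)
    have "(LINT z|std_normal_distribution. cos (s * z + b)) = (LINT z|std_normal_distribution. Re (cis b * cis (s * z)))"
      by (simp add: cis_mult add.commute)
    also have "\<dots> = Re (cis b * (CLINT z|std_normal_distribution. cis (s * z)))"
      using int by (subst integral_Re) auto
    also have "(CLINT z|std_normal_distribution. cis (s * z)) = char std_normal_distribution s"
      by (simp add: char_def cis_conv_exp)
    finally show ?thesis
      by (simp add: char_std_normal_distribution s(2))
  qed
  ultimately show ?thesis by simp
qed

end


section \<open>Consistency of sample Frechet means\<close>

text \<open>The empirical measure is the image of the uniform weights on the indices under the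
  sample map, so coinciding sample points need no separate treatment.\<close>

lemma nn_integral_empirical_measure:
  assumes n: "0 < n" and f: "f \<in> borel_measurable borel"
  shows "(\<integral>\<^sup>+ y. f y \<partial>empirical_measure n x) = (\<Sum>i<n. f (x i)) / of_nat n"
proof -
  let ?N = "point_measure {..<n} (\<lambda>_. 1 / of_nat n :: ennreal)"
  have x: "x \<in> ?N \<rightarrow>\<^sub>M borel" by (simp add: point_measure_def)
  have "empirical_measure n x = distr ?N borel x"
  proof (rule measure_eqI)
    fix A assume "A \<in> sets (empirical_measure n x)"
    then have A: "A \<in> sets borel" by simp
    have "emeasure (distr ?N borel x) A = (\<Sum>i\<in>x -` A \<inter> {..<n}. 1 / of_nat n)"
      using A x by (subst emeasure_distr) (auto simp: space_point_measure emeasure_point_measure_finite)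
    also have "\<dots> = (\<Sum>i<n. indicator A (x i) / of_nat n)"
      by (intro sum.mono_neutral_cong_left) (auto simp: indicator_def)
    also have "\<dots> = (\<Sum>i<n. emeasure (return borel (x i)) A) / of_nat n"
      using A by (simp add: divide_ennreal_def sum_distrib_right)
    finally show "emeasure (empirical_measure n x) A = emeasure (distr ?N borel x) A"
      using A by (simp add: emeasure_empirical_measure)
  qed simp
  then show ?thesis
    using f x by (simp add: nn_integral_distr nn_integral_point_measure_finite divide_ennreal_def
        sum_distrib_left mult.commute)
qed

lemma frechet_function_empirical_measure:
  assumes "0 < n"
  shows "frechet_function (empirical_measure n x) z = ennreal ((\<Sum>i<n. (dist z (x i))\<^sup>2) / n)"
  using assms unfolding frechet_function_def
  by (subst nn_integral_empirical_measure)
     (auto simp: divide_ennreal sum_nonneg ennreal_of_nat_eq_real_of_nat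
       intro!: borel_measurable_continuous_onI continuous_intros)

lemma frechet_mean_set_empirical_measure:
  assumes "0 < n"
  shows "z \<in> frechet_mean_set (empirical_measure n x) \<longleftrightarrow>
    (\<forall>y. (\<Sum>i<n. (dist z (x i))\<^sup>2) \<le> (\<Sum>i<n. (dist y (x i))\<^sup>2))"
  using assms
  by (simp add: frechet_mean_set_def frechet_function_empirical_measure ennreal_le_iff sum_nonneg
      divide_le_cancel)

text \<open>Difference of two squares, with distances to \<open>z\<close> estimated through the
  reference point \<open>p\<close>. The squared distance is thus Lipschitz on balls around
  \<open>p\<close>, with a constant that grows only linearly in \<open>dist p z\<close> and can
  therefore be averaged over \<open>z\<close>.\<close>

lemma abs_dist_square_diff_le:
  fixes x y z p :: "'b::metric_space"
  shows "\<bar>(dist x z)\<^sup>2 - (dist y z)\<^sup>2\<bar> \<le> dist x y * (dist x p + dist y p + 2 * dist p z)"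
proof -
  have "\<bar>(dist x z)\<^sup>2 - (dist y z)\<^sup>2\<bar> = \<bar>dist x z - dist y z\<bar> * (dist x z + dist y z)"
    by (simp add: power2_eq_square square_diff_square_factored abs_mult)
  also have "\<dots> \<le> dist x y * (dist x p + dist y p + 2 * dist p z)"
  proof (rule mult_mono)
    show "\<bar>dist x z - dist y z\<bar> \<le> dist x y" by metric
    show "dist x z + dist y z \<le> dist x p + dist y p + 2 * dist p z" by metric
  qed auto
  finally show ?thesis .
qed

locale frechet_sample = iid_sample M X Q
  for M :: "'a measure" and X :: "nat \<Rightarrow> 'a \<Rightarrow> 'b::{metric_space,second_countable_topology}"
    and Q :: "'b measure" +
  assumes proper: "\<And>S :: 'b set. closed S \<Longrightarrow> bounded S \<Longrightarrow> compact S"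
    and mean_exists: "frechet_mean_exists Q"
begin

abbreviation "p \<equiv> frechet_mean Q"

definition mean_sq_dist :: "'b \<Rightarrow> real" where "mean_sq_dist x = (LINT y|Q. (dist x y)\<^sup>2)"

definition mean_dist :: real where "mean_dist = (LINT y|Q. dist p y)"

lemma frechet_mean_unique: "x \<in> frechet_mean_set Q \<longleftrightarrow> x = p"
  using mean_exists unfolding frechet_mean_exists_def frechet_mean_def
  by (metis theI_unique)

text \<open>Were the Frechet function infinite at its minimizer, it would be infinite everywhere;
  every point would then be a minimizer, and uniqueness would reduce the space to one point, where
  the function is 0. So the second moment about \<open>p\<close> is finite, and the triangle
  inequality extends this to every center.\<close>

lemma integrable_dist_square: "integrable Q (\<lambda>y. (dist x y)\<^sup>2)"
proof -
  have fin: "frechet_function Q p \<noteq> \<infinity>"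
  proof
    assume inf: "frechet_function Q p = \<infinity>"
    have "frechet_function Q p \<le> frechet_function Q z" for z
      using frechet_mean_unique[of p] by (simp add: frechet_mean_set_def)
    then have top: "frechet_function Q z = \<infinity>" for z
      using inf by (simp add: top_unique)
    have all: "x = p" for x
      using top by (subst frechet_mean_unique[symmetric]) (simp add: frechet_mean_set_def)
    have "dist p y = 0" for y using all[of y] by simp
    then have "frechet_function Q p = (\<integral>\<^sup>+ y. 0 \<partial>Q)"
      unfolding frechet_function_def
      by (intro nn_integral_cong) (simp only: power_zero_numeral ennreal_0)
    then show False using inf by simp
  qed
  have p: "integrable Q (\<lambda>y. (dist p y)\<^sup>2)"
    using fin by (intro integrableI_nonneg) (auto simp: frechet_function_def less_top)
  show ?thesis
  proof (rule Bochner_Integration.integrable_bound)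
    show "integrable Q (\<lambda>y. 2 * (dist x p)\<^sup>2 + 2 * (dist p y)\<^sup>2)"
      using p by simp
    have "(dist x y)\<^sup>2 \<le> 2 * (dist x p)\<^sup>2 + 2 * (dist p y)\<^sup>2" for y
    proof -
      have "(dist x y)\<^sup>2 \<le> (dist x p + dist p y)\<^sup>2"
        by (intro power_mono dist_triangle) simp
      also have "\<dots> \<le> 2 * (dist x p)\<^sup>2 + 2 * (dist p y)\<^sup>2"
        using sum_squares_ge_zero[of "dist x p - dist p y" 0] by (simp add: power2_eq_square algebra_simps)
      finally show ?thesis .
    qed
    then show "AE y in Q. norm ((dist x y)\<^sup>2) \<le> norm (2 * (dist x p)\<^sup>2 + 2 * (dist p y)\<^sup>2)"
      by simp
  qed auto
qed

lemma integrable_dist: "integrable Q (dist p)"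
  by (rule Q.square_integrable_imp_integrable[OF _ integrable_dist_square]) simp

lemma frechet_function_eq_mean_sq_dist: "frechet_function Q x = ennreal (mean_sq_dist x)"
  unfolding frechet_function_def mean_sq_dist_def
  by (rule nn_integral_eq_integral[OF integrable_dist_square]) simp

lemma mean_sq_dist_nonneg: "0 \<le> mean_sq_dist x" by (simp add: mean_sq_dist_def)

lemma mean_sq_dist_mean_less:
  assumes "x \<noteq> p"
  shows "mean_sq_dist p < mean_sq_dist x"
proof -
  have min: "mean_sq_dist p \<le> mean_sq_dist z" for z
    using frechet_mean_unique[of p] by (simp add: frechet_mean_set_def frechet_function_eq_mean_sq_dist mean_sq_dist_nonneg)
  have "\<not> mean_sq_dist x \<le> mean_sq_dist p"
  proof
    assume "mean_sq_dist x \<le> mean_sq_dist p"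
    then have "x \<in> frechet_mean_set Q"
      using min by (auto simp: frechet_mean_set_def frechet_function_eq_mean_sq_dist mean_sq_dist_nonneg intro: order_trans)
    then show False using assms frechet_mean_unique by blast
  qed
  then show ?thesis by simp
qed

lemma mean_dist_nonneg: "0 \<le> mean_dist" by (simp add: mean_dist_def)

lemma abs_mean_sq_dist_diff_le: "\<bar>mean_sq_dist x - mean_sq_dist y\<bar> \<le> dist x y * (dist x p + dist y p + 2 * mean_dist)"
proof -
  have "\<bar>mean_sq_dist x - mean_sq_dist y\<bar> = \<bar>LINT z|Q. (dist x z)\<^sup>2 - (dist y z)\<^sup>2\<bar>"
    by (simp add: mean_sq_dist_def integrable_dist_square)
  also have "\<dots> \<le> (LINT z|Q. \<bar>(dist x z)\<^sup>2 - (dist y z)\<^sup>2\<bar>)"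
    by (rule integral_abs_bound)
  also have "\<dots> \<le> (LINT z|Q. dist x y * (dist x p + dist y p + 2 * dist p z))"
    by (intro integral_mono abs_dist_square_diff_le)
       (auto intro!: integrable_dist_square integrable_dist)
  also have "\<dots> = dist x y * (dist x p + dist y p + 2 * mean_dist)"
    using integrable_dist by (simp add: mean_dist_def algebra_simps)
  finally show ?thesis .
qed


lemma continuous_on_mean_sq_dist: "continuous_on S mean_sq_dist"
proof (rule continuous_on_subset[OF _ subset_UNIV], rule continuous_at_imp_continuous_on, rule ballI)
  fix x
  have "((\<lambda>y. dist y x * (dist y p + dist x p + 2 * mean_dist)) \<longlongrightarrow> dist x x * (dist x p + dist x p + 2 * mean_dist)) (at x)"
    by (intro tendsto_intros)
  then have "((\<lambda>y. dist y x * (dist y p + dist x p + 2 * mean_dist)) \<longlongrightarrow> 0) (at x)" by simp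
  then have "((\<lambda>y. mean_sq_dist y - mean_sq_dist x) \<longlongrightarrow> 0) (at x)"
    by (rule Lim_null_comparison[rotated]) (auto simp: abs_mean_sq_dist_diff_le)
  then show "isCont mean_sq_dist x" unfolding isCont_def by (simp add: LIM_zero_iff)
qed

text \<open>The closed annulus between the two radii is compact by properness, so the continuous
  function attains its minimum there, and by uniqueness this exceeds the value at
  \<open>p\<close>.\<close>

lemma mean_sq_dist_gap:
  assumes "0 < d"
  obtains \<delta> where "0 < \<delta>" "\<And>x. d \<le> dist x p \<Longrightarrow> dist x p \<le> R \<Longrightarrow> mean_sq_dist p + \<delta> \<le> mean_sq_dist x"
proof (cases "cball p R - ball p d = {}")
  case True
  have "\<not> (d \<le> dist x p \<and> dist x p \<le> R)" for x
  proof
    assume "d \<le> dist x p \<and> dist x p \<le> R"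
    then have "x \<in> cball p R - ball p d" by (simp add: dist_commute)
    then show False using True by blast
  qed
  then show ?thesis
    by (intro that[of 1]) auto
next
  case False
  have "compact (cball p R - ball p d)"
    by (rule proper) (auto intro: bounded_subset)
  then obtain x where x: "x \<in> cball p R - ball p d" "\<forall>y\<in>cball p R - ball p d. mean_sq_dist x \<le> mean_sq_dist y"
    using continuous_attains_inf[OF _ False continuous_on_mean_sq_dist] by blast
  moreover have "mean_sq_dist p < mean_sq_dist x"
    using x(1) assms by (intro mean_sq_dist_mean_less) auto
  ultimately show ?thesis
    by (intro that[of "mean_sq_dist x - mean_sq_dist p"]) (auto simp: dist_commute)
qed

text \<open>Comparing the values of the sample Frechet function at a minimizer and at \<open>p\<close> confines the
  minimizers to a ball of random but stochastically bounded radius, so that properness applies.\<close>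

lemma dist_minimizer_le:
  fixes n :: nat
  assumes n: "0 < n" and min: "(\<Sum>i<n. (dist z (x i))\<^sup>2) \<le> (\<Sum>i<n. (dist p (x i))\<^sup>2)"
  shows "dist z p \<le> 2 * ((\<Sum>i<n. dist p (x i)) / n)"
proof -
  \<comment> \<open>The squared reverse triangle inequality. Summed over the sample and combined
    with \<open>min\<close>, the terms \<open>(dist p y)\<^sup>2\<close> cancel and one factor
    \<open>dist z p\<close> can be divided out.\<close>
  have "(dist z p)\<^sup>2 - 2 * dist z p * dist p y + (dist p y)\<^sup>2 \<le> (dist z y)\<^sup>2" for y
  proof -
    have "\<bar>dist z p - dist p y\<bar> \<le> \<bar>dist z y\<bar>" by metric
    then have "(dist z p - dist p y)\<^sup>2 \<le> (dist z y)\<^sup>2" by (simp flip: abs_le_square_iff)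
    then show ?thesis by (simp add: power2_eq_square algebra_simps)
  qed
  then have "(\<Sum>i<n. (dist z p)\<^sup>2 - 2 * dist z p * dist p (x i) + (dist p (x i))\<^sup>2) \<le> (\<Sum>i<n. (dist z (x i))\<^sup>2)"
    by (intro sum_mono)
  also note min
  also have "(\<Sum>i<n. (dist z p)\<^sup>2 - 2 * dist z p * dist p (x i) + (dist p (x i))\<^sup>2) =
      n * (dist z p)\<^sup>2 - 2 * dist z p * (\<Sum>i<n. dist p (x i)) + (\<Sum>i<n. (dist p (x i))\<^sup>2)"
    by (simp add: sum.distrib sum_subtractf sum_distrib_left)
  finally have "dist z p * (n * dist z p) \<le> dist z p * (2 * (\<Sum>i<n. dist p (x i)))"
    by (simp add: power2_eq_square algebra_simps)
  then have "n * dist z p \<le> 2 * (\<Sum>i<n. dist p (x i)) \<or> dist z p = 0"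
    by (metis zero_le_dist mult_le_cancel_left_pos order_le_less)
  then show ?thesis
    using n by (auto simp: field_simps sum_nonneg)
qed

theorem sample_mean_consistent:
  assumes T: "\<And>n \<omega>. 1 \<le> n \<Longrightarrow> \<omega> \<in> space M \<Longrightarrow> T n \<omega> \<in> frechet_mean_set (empirical_measure n (\<lambda>i. X i \<omega>))"
    and e: "0 < e" and d: "0 < d"
  shows "whp e (\<lambda>n \<omega>. dist (T n \<omega>) p < d)"
proof -
  \<comment> \<open>A minimizer lies within twice the mean sample distance, and this mean is at most
    \<open>mean_dist + 1\<close> with high probability.\<close>
  define R where "R = 2 * (mean_dist + 1)"
  have R: "0 < R" using mean_dist_nonneg by (simp add: R_def)
  obtain \<delta> where \<delta>: "0 < \<delta>" "\<And>x. d \<le> dist x p \<Longrightarrow> dist x p \<le> R \<Longrightarrow> mean_sq_dist p + \<delta> \<le> mean_sq_dist x"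
    using mean_sq_dist_gap[OF d] by blast
  \<comment> \<open>On the annulus, the averaged Lipschitz constant of the sample Frechet function
    is at most \<open>R + R + 2 * (mean_dist + 1) = 3 * R\<close>; moving by less than
    \<open>\<eta>\<close> thus changes its value by at most \<open>\<delta> / 4\<close>.\<close>
  define \<eta> where "\<eta> = \<delta> / (4 * (3 * R))"
  have \<eta>: "0 < \<eta>" "\<eta> * (3 * R) = \<delta> / 4" using \<delta> R by (simp_all add: \<eta>_def)
  let ?K = "cball p R - ball p d"
  have "compact ?K"
    by (rule proper) (auto intro: bounded_subset)
  moreover have "\<forall>x\<in>?K. open (ball x \<eta>)" "?K \<subseteq> (\<Union>x\<in>?K. ball x \<eta>)"
    using \<eta> by auto
  \<comment> \<open>The net is taken inside the annulus, so that the gap \<open>\<delta>\<close>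
    applies to the net point nearby instead of to the random minimizer.\<close>
  ultimately obtain N where N: "N \<subseteq> ?K" "finite N" "?K \<subseteq> (\<Union>x\<in>N. ball x \<eta>)"
    using compactE_image[of ?K ?K "\<lambda>x. ball x \<eta>"] by metis
  define S where "S n \<omega> x = (\<Sum>i<n. (dist x (X i \<omega>))\<^sup>2)" for n \<omega> x
  have "whp (e / 2) (\<lambda>n \<omega>. \<forall>x\<in>insert p N. \<bar>S n \<omega> x / n - mean_sq_dist x\<bar> \<le> \<delta> / 8)"
    unfolding S_def mean_sq_dist_def using N(2) e \<delta>(1)
    by (intro whp_Ball weak_law integrable_dist_square) auto
  moreover have "whp (e / 2) (\<lambda>n \<omega>. \<bar>(\<Sum>i<n. dist p (X i \<omega>)) / n - mean_dist\<bar> \<le> 1)"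
    unfolding mean_dist_def using e by (intro weak_law integrable_dist) auto
  ultimately have "whp (e / 2 + e / 2) (\<lambda>n \<omega>. (\<forall>x\<in>insert p N. \<bar>S n \<omega> x / n - mean_sq_dist x\<bar> \<le> \<delta> / 8) \<and>
      \<bar>(\<Sum>i<n. dist p (X i \<omega>)) / n - mean_dist\<bar> \<le> 1)"
    by (rule whp_conj)
  then show ?thesis
  proof (rule whp_mono)
    show "\<forall>\<^sub>F n in sequentially. \<forall>\<omega>\<in>space M. (\<forall>x\<in>insert p N. \<bar>S n \<omega> x / n - mean_sq_dist x\<bar> \<le> \<delta> / 8) \<and>
      \<bar>(\<Sum>i<n. dist p (X i \<omega>)) / n - mean_dist\<bar> \<le> 1 \<longrightarrow> dist (T n \<omega>) p < d"
      using eventually_gt_at_top[of 0]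
    proof (eventually_elim, intro ballI impI, elim conjE)
      fix n :: nat and \<omega> assume n: "0 < n" and \<omega>: "\<omega> \<in> space M"
        and S: "\<forall>x\<in>insert p N. \<bar>S n \<omega> x / n - mean_sq_dist x\<bar> \<le> \<delta> / 8"
        and An: "\<bar>(\<Sum>i<n. dist p (X i \<omega>)) / n - mean_dist\<bar> \<le> 1"
      let ?z = "T n \<omega>"
      have min: "S n \<omega> ?z \<le> S n \<omega> p"
        using T[of n \<omega>] n \<omega> by (simp add: frechet_mean_set_empirical_measure S_def)
      have An': "(\<Sum>i<n. dist p (X i \<omega>)) / n \<le> mean_dist + 1"
        using An by (simp only: abs_le_iff) linarith
      have zR: "dist ?z p \<le> R"
        using dist_minimizer_le[OF n min[unfolded S_def]] An'
        unfolding R_def by (meson mult_le_cancel_left_pos order_trans zero_less_numeral)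
      show "dist ?z p < d"
      proof (rule ccontr)
        assume "\<not> dist ?z p < d"
        then have "?z \<in> ?K" using zR by (simp add: dist_commute)
        from subsetD[OF N(3) this] obtain x where x: "x \<in> N" "dist ?z x < \<eta>"
          by (auto simp: dist_commute)
        then have xK: "d \<le> dist x p" "dist x p \<le> R"
          using N(1) by (auto simp: dist_commute)
        have "S n \<omega> x - S n \<omega> ?z = (\<Sum>i<n. (dist x (X i \<omega>))\<^sup>2 - (dist ?z (X i \<omega>))\<^sup>2)"
          by (simp add: S_def sum_subtractf)
        also have "\<dots> \<le> (\<Sum>i<n. \<eta> * (R + R + 2 * dist p (X i \<omega>)))"
        proof (rule sum_mono)
          fix i
          have "(dist x (X i \<omega>))\<^sup>2 - (dist ?z (X i \<omega>))\<^sup>2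
              \<le> dist x ?z * (dist x p + dist ?z p + 2 * dist p (X i \<omega>))"
            using abs_dist_square_diff_le[of x "X i \<omega>" ?z p] by linarith
          also have "\<dots> \<le> \<eta> * (R + R + 2 * dist p (X i \<omega>))"
            using x xK zR \<eta> R by (intro mult_mono add_mono) (auto simp: dist_commute)
          finally show "(dist x (X i \<omega>))\<^sup>2 - (dist ?z (X i \<omega>))\<^sup>2 \<le> \<eta> * (R + R + 2 * dist p (X i \<omega>))" .
        qed
        also have "\<dots> = n * (\<eta> * (2 * R + 2 * ((\<Sum>i<n. dist p (X i \<omega>)) / n)))"
        proof -
          have "(\<Sum>i<n. \<eta> * (R + R + 2 * dist p (X i \<omega>))) = \<eta> * (n * (2 * R) + 2 * (\<Sum>i<n. dist p (X i \<omega>)))"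
            by (simp add: sum.distrib flip: sum_distrib_left)
          then show ?thesis using n by (simp add: field_simps)
        qed
        also have "\<dots> \<le> n * (\<eta> * (3 * R))"
          using mult_left_mono[OF An', of 2] \<eta>(1) n by (intro mult_left_mono) (simp_all add: R_def)
        also have "\<dots> = n * (\<delta> / 4)" by (simp only: \<eta>(2))
        finally have "S n \<omega> x / n \<le> S n \<omega> ?z / n + \<delta> / 4"
          using n by (simp add: field_simps)
        moreover have "S n \<omega> ?z / n \<le> S n \<omega> p / n" using min by (simp add: divide_right_mono)
        moreover have "mean_sq_dist x \<le> S n \<omega> x / n + \<delta> / 8" "S n \<omega> p / n \<le> mean_sq_dist p + \<delta> / 8"
          using bspec[OF S insertI2[OF x(1)]] bspec[OF S insertI1] unfolding abs_le_iff by linarith+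
        \<comment> \<open>The cost is \<open>\<delta> / 4\<close> for passing to the net point and
          \<open>\<delta> / 8\<close> for each of the two weak laws, at \<open>x\<close> and at
          \<open>p\<close>; the sum \<open>\<delta> / 2\<close> contradicts the gap.\<close>
        ultimately have "mean_sq_dist x \<le> mean_sq_dist p + \<delta> / 2" by linarith
        then show False using \<delta>(1) \<delta>(2)[OF xK] by linarith
      qed
    qed
  qed simp
qed

end


section \<open>Asymptotic normality from a linearized estimating equation\<close>

lemma abs_cos_diff_le: "\<bar>cos x - cos y\<bar> \<le> \<bar>x - y\<bar>" for x y :: real
proof -
  have "\<bar>cos x - cos y\<bar> = 2 * (\<bar>sin ((x + y) / 2)\<bar> * \<bar>sin ((y - x) / 2)\<bar>)"
    by (simp add: cos_diff_cos abs_mult)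
  also have "\<dots> \<le> 2 * (1 * \<bar>(y - x) / 2\<bar>)"
    by (intro mult_left_mono mult_mono abs_sin_le_one abs_sin_x_le_abs_x) auto
  finally show ?thesis by simp
qed

lemma borel_measurable_vec_lambda [measurable (raw)]:
  fixes f :: "'d::finite \<Rightarrow> 'a \<Rightarrow> real"
  assumes "\<And>r. f r \<in> borel_measurable N"
  shows "(\<lambda>\<omega>. \<chi> r. f r \<omega>) \<in> borel_measurable N"
  using assms by (subst borel_measurable_euclidean_space) (auto simp: Basis_vec_def inner_axis)

lemma norm_matrix_vector_mult_le:
  fixes A :: "real^'d::finite^'e::finite"
  shows "norm (A *v z) \<le> (\<Sum>r\<in>UNIV. \<Sum>s\<in>UNIV. \<bar>A $ r $ s\<bar>) * norm z"
proof -
  have "norm (A *v z) \<le> (\<Sum>r\<in>UNIV. \<bar>(A *v z) $ r\<bar>)"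
    by (rule norm_le_l1_cart)
  also have "\<dots> \<le> (\<Sum>r\<in>UNIV. (\<Sum>s\<in>UNIV. \<bar>A $ r $ s\<bar> * norm z))"
  proof (rule sum_mono)
    fix r
    have "\<bar>(A *v z) $ r\<bar> \<le> (\<Sum>s\<in>UNIV. \<bar>A $ r $ s * z $ s\<bar>)"
      unfolding matrix_vector_mult_def by simp
    also have "\<dots> \<le> (\<Sum>s\<in>UNIV. \<bar>A $ r $ s\<bar> * norm z)"
      by (intro sum_mono) (simp add: abs_mult mult_left_mono component_le_norm_cart)
    finally show "\<bar>(A *v z) $ r\<bar> \<le> (\<Sum>s\<in>UNIV. \<bar>A $ r $ s\<bar> * norm z)" .
  qed
  finally show ?thesis by (simp add: sum_distrib_right)
qed

lemma (in prob_space) tight_Ball: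
  fixes Y :: "'j \<Rightarrow> nat \<Rightarrow> 'a \<Rightarrow> real"
  assumes "finite J" "\<And>j e. j \<in> J \<Longrightarrow> 0 < e \<Longrightarrow> \<exists>K. whp e (\<lambda>n \<omega>. \<bar>Y j n \<omega>\<bar> \<le> K)" "0 < e"
  shows "\<exists>K. whp e (\<lambda>n \<omega>. \<forall>j\<in>J. \<bar>Y j n \<omega>\<bar> \<le> K)"
  using assms
proof (induction J arbitrary: e rule: finite_induct)
  case empty
  then show ?case by (auto intro!: whp_AE)
next
  case (insert j J)
  have "0 < e / 2" using insert.prems by simp
  obtain K where K: "whp (e / 2) (\<lambda>n \<omega>. \<bar>Y j n \<omega>\<bar> \<le> K)"
    using insert.prems(1)[of j "e / 2"] \<open>0 < e / 2\<close> by blast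
  obtain L where L: "whp (e / 2) (\<lambda>n \<omega>. \<forall>j\<in>J. \<bar>Y j n \<omega>\<bar> \<le> L)"
    using insert.IH[OF insert.prems(1) \<open>0 < e / 2\<close>] by blast
  have "whp e (\<lambda>n \<omega>. \<forall>j\<in>insert j J. \<bar>Y j n \<omega>\<bar> \<le> max K L)"
    by (rule whp_mono[OF whp_conj[OF K L]]) (auto simp: le_max_iff_disj)
  then show ?case ..
qed

text \<open>The error in \<open>lin\<close> is relative to \<open>norm (Z n \<omega>)\<close>
  itself. It is absorbed into the left-hand side, which yields closeness to the explicit sum
  \<open>V\<close> and with it tightness of \<open>Z\<close>.\<close>

theorem (in iid_sample) asymptotic_normality_linearized:
  fixes \<psi> :: "'d::finite \<Rightarrow> 'b \<Rightarrow> real" and h :: "'d \<Rightarrow> 'd \<Rightarrow> 'b \<Rightarrow> real"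
    and \<Lambda> C :: "real^'d^'d" and Z :: "nat \<Rightarrow> 'a \<Rightarrow> real^'d"
  assumes psi: "\<And>r. \<psi> r \<in> borel_measurable borel" "\<And>r. integrable Q (\<lambda>x. (\<psi> r x)\<^sup>2)"
      "\<And>r. (LINT x|Q. \<psi> r x) = 0"
    and h: "\<And>r s. integrable Q (h r s)"
    and \<Lambda>: "\<Lambda> = (\<chi> r s. LINT x|Q. h r s x)" "invertible \<Lambda>"
    and C: "C = (\<chi> r s. LINT x|Q. \<psi> r x * \<psi> s x)"
    and Z: "\<forall>\<^sub>F n in sequentially. Z n \<in> borel_measurable M"
    and lin: "\<And>\<eta> e. 0 < \<eta> \<Longrightarrow> 0 < e \<Longrightarrow> whp e (\<lambda>n \<omega>.
      norm ((\<chi> r. (\<Sum>i<n. \<psi> r (X i \<omega>)) / sqrt n) + (\<chi> r s. (\<Sum>i<n. h r s (X i \<omega>)) / n) *v Z n \<omega>)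
        \<le> \<eta> * norm (Z n \<omega>))"
  shows "converges_in_law M Z (mvnormal 0 (matrix_inv \<Lambda> ** C ** matrix_inv (transpose \<Lambda>)))"
proof -
  note [measurable] = psi(1)
  define \<Lambda>n :: "nat \<Rightarrow> 'a \<Rightarrow> real^'d^'d" where "\<Lambda>n n \<omega> = (\<chi> r s. (\<Sum>i<n. h r s (X i \<omega>)) / n)" for n \<omega>
  define S :: "nat \<Rightarrow> 'a \<Rightarrow> real^'d" where "S n \<omega> = (\<chi> r. (\<Sum>i<n. \<psi> r (X i \<omega>)) / sqrt n)" for n \<omega>
  define B where "B = matrix_inv \<Lambda>"
  define V where "V n \<omega> = - (B *v S n \<omega>)" for n \<omega>
  define \<Sigma> where "\<Sigma> = B ** C ** transpose B"
  \<comment> \<open>A bound for the operator norm of \<open>B\<close>; the added 1 makes it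
    positive, so that it can be divided by.\<close>
  define \<kappa> where "\<kappa> = (\<Sum>r\<in>UNIV. \<Sum>s\<in>UNIV. \<bar>B $ r $ s\<bar>) + 1"
  have \<kappa>: "0 < \<kappa>" "norm (B *v z) \<le> \<kappa> * norm z" for z
  proof -
    have "0 \<le> (\<Sum>r\<in>UNIV. \<Sum>s\<in>UNIV. \<bar>B $ r $ s\<bar>)" by (intro sum_nonneg) auto
    then show "0 < \<kappa>" by (simp add: \<kappa>_def)
    show "norm (B *v z) \<le> \<kappa> * norm z"
      using norm_matrix_vector_mult_le[of B z] by (simp add: \<kappa>_def distrib_right add_increasing2)
  qed
  define N :: real where "N = real CARD('d)"
  have N: "0 < N" by (simp add: N_def)

  \<comment> \<open>The random matrix is replaced by its mean. Each of the \<open>N * N\<close>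
    entries is within \<open>\<eta> / (2 * N * N)\<close>, which costs \<open>\<eta> / 2\<close> in
    norm and leaves \<open>\<eta> / 2\<close> for \<open>lin\<close>.\<close>
  have lin': "whp e (\<lambda>n \<omega>. norm (S n \<omega> + \<Lambda> *v Z n \<omega>) \<le> \<eta> * norm (Z n \<omega>))" if \<eta>: "0 < \<eta>" and e: "0 < e" for \<eta> e
  proof -
    have "whp (e / 2) (\<lambda>n \<omega>. \<forall>j\<in>UNIV. \<bar>(\<Sum>i<n. h (fst j) (snd j) (X i \<omega>)) / n - (LINT x|Q. h (fst j) (snd j) x)\<bar>
        \<le> \<eta> / (2 * N * N))"
      using e \<eta> N by (intro whp_Ball weak_law h) auto
    moreover have "whp (e / 2) (\<lambda>n \<omega>. norm (S n \<omega> + \<Lambda>n n \<omega> *v Z n \<omega>) \<le> \<eta> / 2 * norm (Z n \<omega>))"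
      unfolding S_def \<Lambda>n_def using e \<eta> by (intro lin) auto
    ultimately have "whp (e / 2 + e / 2) (\<lambda>n \<omega>.
      (\<forall>j\<in>UNIV. \<bar>(\<Sum>i<n. h (fst j) (snd j) (X i \<omega>)) / n - (LINT x|Q. h (fst j) (snd j) x)\<bar> \<le> \<eta> / (2 * N * N)) \<and>
      norm (S n \<omega> + \<Lambda>n n \<omega> *v Z n \<omega>) \<le> \<eta> / 2 * norm (Z n \<omega>))"
      by (rule whp_conj)
    then show ?thesis
    proof (rule whp_mono, simp, intro always_eventually allI ballI impI, elim conjE)
      fix n \<omega>
      assume a: "\<forall>j\<in>UNIV. \<bar>(\<Sum>i<n. h (fst j) (snd j) (X i \<omega>)) / n - (LINT x|Q. h (fst j) (snd j) x)\<bar> \<le> \<eta> / (2 * N * N)"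
        and b: "norm (S n \<omega> + \<Lambda>n n \<omega> *v Z n \<omega>) \<le> \<eta> / 2 * norm (Z n \<omega>)"
      have "\<bar>(\<Lambda> - \<Lambda>n n \<omega>) $ r $ s\<bar> \<le> \<eta> / (2 * N * N)" for r s
        using a[rule_format, of "(r, s)"] by (simp add: \<Lambda>(1) \<Lambda>n_def abs_minus_commute)
      then have "(\<Sum>r\<in>UNIV. \<Sum>s\<in>UNIV. \<bar>(\<Lambda> - \<Lambda>n n \<omega>) $ r $ s\<bar>) \<le> (\<Sum>r\<in>(UNIV::'d set). \<Sum>s\<in>(UNIV::'d set). \<eta> / (2 * N * N))"
        by (intro sum_mono)
      also have "\<dots> = \<eta> / 2" using N by (simp add: N_def)
      finally have "norm ((\<Lambda> - \<Lambda>n n \<omega>) *v Z n \<omega>) \<le> \<eta> / 2 * norm (Z n \<omega>)"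
        using norm_matrix_vector_mult_le[of "\<Lambda> - \<Lambda>n n \<omega>" "Z n \<omega>"]
        by (meson mult_right_mono norm_ge_zero order_trans)
      moreover have "S n \<omega> + \<Lambda> *v Z n \<omega> = (S n \<omega> + \<Lambda>n n \<omega> *v Z n \<omega>) + (\<Lambda> - \<Lambda>n n \<omega>) *v Z n \<omega>"
        by (simp add: matrix_vector_mult_diff_rdistrib)
      ultimately have "norm (S n \<omega> + \<Lambda> *v Z n \<omega>) \<le> \<eta> / 2 * norm (Z n \<omega>) + \<eta> / 2 * norm (Z n \<omega>)"
        using b norm_triangle_mono by metis
      then show "norm (S n \<omega> + \<Lambda> *v Z n \<omega>) \<le> \<eta> * norm (Z n \<omega>)" by simp
    qed
  qed

  have tightV: "\<exists>K\<ge>0. whp e (\<lambda>n \<omega>. norm (V n \<omega>) \<le> K)" if e: "0 < e" for e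
  proof -
    have "\<exists>K. whp e (\<lambda>n \<omega>. \<forall>r\<in>UNIV. \<bar>(\<Sum>i<n. \<psi> r (X i \<omega>)) / sqrt n\<bar> \<le> K)"
      by (rule tight_Ball[where Y = "\<lambda>r n \<omega>. (\<Sum>i<n. \<psi> r (X i \<omega>)) / sqrt n"])
         (use e psi in \<open>simp_all only: tight_normalized_sum finite_UNIV finite\<close>)
    then obtain K where K: "whp e (\<lambda>n \<omega>. \<forall>r\<in>UNIV. \<bar>(\<Sum>i<n. \<psi> r (X i \<omega>)) / sqrt n\<bar> \<le> K)" ..
    have "whp e (\<lambda>n \<omega>. norm (V n \<omega>) \<le> \<kappa> * (N * \<bar>K\<bar>))"
    proof (rule whp_mono[OF K order_refl], intro always_eventually allI ballI impI)
      fix n \<omega> assume "\<forall>r\<in>UNIV. \<bar>(\<Sum>i<n. \<psi> r (X i \<omega>)) / sqrt n\<bar> \<le> K"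
      then have "\<bar>S n \<omega> $ r\<bar> \<le> \<bar>K\<bar>" for r by (auto simp: S_def intro: order_trans)
      then have "(\<Sum>r\<in>UNIV. \<bar>S n \<omega> $ r\<bar>) \<le> N * \<bar>K\<bar>"
        using sum_bounded_above[of UNIV "\<lambda>r. \<bar>S n \<omega> $ r\<bar>" "\<bar>K\<bar>"] by (simp add: N_def)
      then have "norm (S n \<omega>) \<le> N * \<bar>K\<bar>"
        using norm_le_l1_cart[of "S n \<omega>"] by linarith
      then have "\<kappa> * norm (S n \<omega>) \<le> \<kappa> * (N * \<bar>K\<bar>)" using \<kappa>(1) by simp
      then show "norm (V n \<omega>) \<le> \<kappa> * (N * \<bar>K\<bar>)"
        using \<kappa>(2)[of "S n \<omega>"] by (simp add: V_def)
    qed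
    moreover have "0 \<le> \<kappa> * (N * \<bar>K\<bar>)" using \<kappa>(1) N by simp
    ultimately show ?thesis by blast
  qed

  have close: "whp e (\<lambda>n \<omega>. norm (Z n \<omega> - V n \<omega>) \<le> \<delta>)" if e: "0 < e" and \<delta>: "0 < \<delta>" for e \<delta>
  proof -
    obtain K where K: "0 \<le> K" "whp (e / 2) (\<lambda>n \<omega>. norm (V n \<omega>) \<le> K)"
      using tightV[of "e / 2"] e by auto
    \<comment> \<open>The bound \<open>1 / 2\<close> on \<open>\<kappa> * \<eta>\<close> allows half
      of \<open>norm (Z n \<omega> - V n \<omega>)\<close> to be absorbed; the other bound keeps the
      contribution of \<open>V\<close> below \<open>\<delta> / 2\<close>.\<close>
    define \<eta> where "\<eta> = min (1 / 2) (\<delta> / (2 * (K + 1))) / \<kappa>"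
    have "\<kappa> * \<eta> = min (1 / 2) (\<delta> / (2 * (K + 1)))" using \<kappa>(1) by (simp add: \<eta>_def)
    then have \<eta>: "\<kappa> * \<eta> \<le> 1 / 2" "\<kappa> * \<eta> \<le> \<delta> / (2 * (K + 1))"
      by (simp_all only: min.cobounded1 min.cobounded2)
    have \<eta>0: "0 < \<eta>" using \<kappa>(1) K(1) \<delta> by (simp add: \<eta>_def)
    have "\<kappa> * \<eta> * K \<le> \<delta> / (2 * (K + 1)) * K"
      using \<eta>(2) K(1) by (rule mult_right_mono)
    also have "\<dots> \<le> \<delta> / 2" using K(1) \<delta> by (simp add: field_simps)
    finally have \<eta>K: "\<kappa> * \<eta> * K \<le> \<delta> / 2" .
    have "whp (e / 2 + e / 2) (\<lambda>n \<omega>. norm (S n \<omega> + \<Lambda> *v Z n \<omega>) \<le> \<eta> * norm (Z n \<omega>) \<and> norm (V n \<omega>) \<le> K)"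
      using e \<eta>0 K by (intro whp_conj lin') auto
    then show ?thesis
    proof (rule whp_mono, simp, intro always_eventually allI ballI impI, elim conjE)
      fix n \<omega>
      assume a: "norm (S n \<omega> + \<Lambda> *v Z n \<omega>) \<le> \<eta> * norm (Z n \<omega>)" and b: "norm (V n \<omega>) \<le> K"
      \<comment> \<open>\<open>B\<close> is the inverse of \<open>\<Lambda>\<close>, so applying it
        to the linearized equation isolates the difference.\<close>
      have "Z n \<omega> - V n \<omega> = B *v (S n \<omega> + \<Lambda> *v Z n \<omega>)"
        using matrix_inv_mult(2)[OF \<Lambda>(2)]
        by (simp add: V_def B_def matrix_vector_right_distrib matrix_vector_mul_assoc)
      then have "norm (Z n \<omega> - V n \<omega>) \<le> \<kappa> * (\<eta> * norm (Z n \<omega>))"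
        using \<kappa> a by (metis mult_le_cancel_left_pos order_trans)
      also have "\<dots> \<le> \<kappa> * \<eta> * (norm (Z n \<omega> - V n \<omega>) + norm (V n \<omega>))"
        using \<kappa>(1) \<eta>0 norm_triangle_sub[of "Z n \<omega>" "V n \<omega>"] by (simp add: add.commute)
      also have "\<dots> = \<kappa> * \<eta> * norm (Z n \<omega> - V n \<omega>) + \<kappa> * \<eta> * norm (V n \<omega>)"
        by (rule distrib_left)
      also have "\<dots> \<le> 1 / 2 * norm (Z n \<omega> - V n \<omega>) + \<kappa> * \<eta> * K"
        using \<eta>(1) b \<kappa>(1) \<eta>0 by (intro add_mono mult_right_mono mult_left_mono) auto
      finally show "norm (Z n \<omega> - V n \<omega>) \<le> \<delta>" using \<eta>K by linarith
    qed
  qed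

  have Bt: "transpose B = matrix_inv (transpose \<Lambda>)"
    using \<Lambda>(2) by (simp add: B_def matrix_inv_transpose)
  have int: "integrable Q (\<lambda>x. \<psi> r x * \<psi> s x)" for r s
  proof (rule Bochner_Integration.integrable_bound)
    show "integrable Q (\<lambda>x. (\<psi> r x)\<^sup>2 + (\<psi> s x)\<^sup>2)" using psi by simp
    have "\<bar>\<psi> r x * \<psi> s x\<bar> \<le> (\<psi> r x)\<^sup>2 + (\<psi> s x)\<^sup>2" for x
      using sum_squares_bound[of "\<psi> r x" "\<psi> s x"] sum_squares_bound[of "\<psi> r x" "- \<psi> s x"]
        zero_le_power2[of "\<psi> r x"] zero_le_power2[of "\<psi> s x"]
      unfolding abs_le_iff power2_minus by linarith
    then show "AE x in Q. norm (\<psi> r x * \<psi> s x) \<le> norm ((\<psi> r x)\<^sup>2 + (\<psi> s x)\<^sup>2)" by simp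
  qed measurable
  \<comment> \<open>\<open>C\<close> is the matrix of mixed second moments, so its quadratic form is
    the second moment of a linear combination of the scores. This gives both the limiting variances
    and the nonnegativity of \<open>\<Sigma>\<close>.\<close>
  have quad: "(LINT x|Q. (\<Sum>r\<in>UNIV. a $ r * \<psi> r x)\<^sup>2) = a \<bullet> (C *v a)"
    and quad_int: "integrable Q (\<lambda>x. (\<Sum>r\<in>UNIV. a $ r * \<psi> r x)\<^sup>2)" for a
  proof -
    have *: "(\<Sum>r\<in>UNIV. a $ r * \<psi> r x)\<^sup>2 = (\<Sum>r\<in>UNIV. \<Sum>s\<in>UNIV. a $ r * a $ s * (\<psi> r x * \<psi> s x))" for x
      by (simp add: power2_eq_square sum_product mult_ac)
    show "integrable Q (\<lambda>x. (\<Sum>r\<in>UNIV. a $ r * \<psi> r x)\<^sup>2)"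
      unfolding * by (intro Bochner_Integration.integrable_sum integrable_mult_right int)
    show "(LINT x|Q. (\<Sum>r\<in>UNIV. a $ r * \<psi> r x)\<^sup>2) = a \<bullet> (C *v a)"
      unfolding * using int
      by (simp add: C inner_vec_def matrix_vector_mult_def sum_distrib_left mult_ac)
  qed
  have \<Sigma>t: "t \<bullet> (\<Sigma> *v t) = (transpose B *v t) \<bullet> (C *v (transpose B *v t))" for t
  proof -
    have "\<Sigma> *v t = B *v (C *v (transpose B *v t))"
      by (simp only: \<Sigma>_def matrix_vector_mul_assoc matrix_mul_assoc)
    then show ?thesis
      by (simp add: dot_lmul_matrix)
  qed
  have psd: "0 \<le> t \<bullet> (\<Sigma> *v t)" for t
    unfolding \<Sigma>t by (simp flip: quad)
  have sym: "transpose \<Sigma> = \<Sigma>"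
  proof -
    have "transpose C = C" by (simp add: C transpose_def mult.commute)
    then show ?thesis by (simp add: \<Sigma>_def matrix_transpose_mul matrix_mul_assoc)
  qed

  \<comment> \<open>Cramer-Wold reduction: \<open>t \<bullet> V n \<omega>\<close> is the normalized
    sum of one real function, the combination of the scores with coefficients
    \<open>- (transpose B *v t)\<close>.\<close>
  have cosV: "(\<lambda>n. expectation (\<lambda>\<omega>. cos (t \<bullet> V n \<omega> + b))) \<longlonglongrightarrow> exp (- (t \<bullet> (\<Sigma> *v t)) / 2) * cos b" for t b
  proof -
    define a where "a = - (transpose B *v t)"
    define f where "f x = (\<Sum>r\<in>UNIV. a $ r * \<psi> r x)" for x
    have [measurable]: "f \<in> borel_measurable borel" unfolding f_def by measurable
    have "integrable Q (\<psi> r)" for r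
      by (rule Q.square_integrable_imp_integrable) (use psi in auto)
    then have f0: "(LINT x|Q. f x) = 0" by (simp add: f_def psi)
    have f2: "(LINT x|Q. (f x)\<^sup>2) = t \<bullet> (\<Sigma> *v t)"
      unfolding f_def quad \<Sigma>t by (simp add: a_def linear_neg del: transpose_matrix_vector)
    have "t \<bullet> V n \<omega> = (\<Sum>i<n. f (X i \<omega>)) / sqrt n" for n \<omega>
    proof -
      have "t \<bullet> V n \<omega> = a \<bullet> S n \<omega>"
        by (simp add: V_def a_def dot_lmul_matrix)
      also have "\<dots> = (\<Sum>r\<in>UNIV. \<Sum>i<n. a $ r * \<psi> r (X i \<omega>)) / sqrt n"
        by (simp add: S_def inner_vec_def sum_distrib_left sum_divide_distrib)
      also have "\<dots> = (\<Sum>i<n. f (X i \<omega>)) / sqrt n"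
        unfolding f_def by (subst sum.swap) simp
      finally show ?thesis .
    qed
    then show ?thesis
      using tendsto_expectation_cos_normalized_sum[of f b] quad_int[of a] f0 f2 by (simp add: f_def)
  qed

  have Vm: "V n \<in> borel_measurable M" for n
  proof -
    have "S n \<in> borel_measurable M"
      unfolding S_def by measurable
    then show ?thesis unfolding V_def by measurable
  qed

  show ?thesis
  proof (rule converges_in_lawI[OF Z prob_space_mvnormal])
    fix t :: "real^'d" and b :: real
    have "(\<lambda>n. expectation (\<lambda>\<omega>. cos (t \<bullet> Z n \<omega> + b)) - expectation (\<lambda>\<omega>. cos (t \<bullet> V n \<omega> + b))) \<longlonglongrightarrow> 0"
    proof (rule tendstoI)
      fix \<epsilon> :: real assume \<epsilon>: "0 < \<epsilon>"
      \<comment> \<open>Off the bad event the cosines differ by at most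
        \<open>norm t * \<delta>\<close>, hence by \<open>\<epsilon> / 2\<close>; on it they differ
        by at most 2, which contributes less than \<open>2 * (\<epsilon> / 4)\<close>. The added 1
        covers \<open>t = 0\<close>.\<close>
      define \<delta> where "\<delta> = \<epsilon> / (2 * (norm t + 1))"
      have \<delta>: "0 < \<delta>" "norm t * \<delta> \<le> \<epsilon> / 2"
        using \<epsilon> by (auto simp: \<delta>_def field_simps add_pos_nonneg)
      have "whp (\<epsilon> / 4) (\<lambda>n \<omega>. norm (Z n \<omega> - V n \<omega>) \<le> \<delta>)"
        using \<epsilon> \<delta> by (intro close) auto
      then show "\<forall>\<^sub>F n in sequentially. dist (expectation (\<lambda>\<omega>. cos (t \<bullet> Z n \<omega> + b)) -
          expectation (\<lambda>\<omega>. cos (t \<bullet> V n \<omega> + b))) 0 < \<epsilon>"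
        using Z unfolding whp_def
      proof eventually_elim
        case (elim n)
        note [measurable] = elim(2) Vm[of n]
        from elim(1) obtain A where A: "A \<in> events" "prob A < \<epsilon> / 4"
          "\<forall>\<omega>\<in>space M - A. norm (Z n \<omega> - V n \<omega>) \<le> \<delta>" by blast
        have "\<bar>expectation (\<lambda>\<omega>. cos (t \<bullet> Z n \<omega> + b)) - expectation (\<lambda>\<omega>. cos (t \<bullet> V n \<omega> + b))\<bar>
            \<le> \<epsilon> / 2 + (1 + 1) * prob A"
        proof (rule abs_expectation_diff_le)
          fix \<omega> assume \<omega>: "\<omega> \<in> space M - A"
          have "\<bar>cos (t \<bullet> Z n \<omega> + b) - cos (t \<bullet> V n \<omega> + b)\<bar> \<le> \<bar>(t \<bullet> Z n \<omega> + b) - (t \<bullet> V n \<omega> + b)\<bar>"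
            by (rule abs_cos_diff_le)
          also have "\<dots> = \<bar>t \<bullet> (Z n \<omega> - V n \<omega>)\<bar>" by (simp add: inner_diff_right)
          also have "\<dots> \<le> norm t * norm (Z n \<omega> - V n \<omega>)" by (rule Cauchy_Schwarz_ineq2)
          also have "\<dots> \<le> norm t * \<delta>" using A(3) \<omega> by (intro mult_left_mono) auto
          finally show "\<bar>cos (t \<bullet> Z n \<omega> + b) - cos (t \<bullet> V n \<omega> + b)\<bar> \<le> \<epsilon> / 2" using \<delta>(2) by linarith
        qed (use A \<epsilon> in auto)
        then show ?case using A(2) by (simp add: dist_real_def)
      qed
    qed
    from tendsto_add[OF this cosV[of t b]]
    show "(\<lambda>n. expectation (\<lambda>\<omega>. cos (t \<bullet> Z n \<omega> + b))) \<longlonglongrightarrow>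
      (LINT x|mvnormal 0 (matrix_inv \<Lambda> ** C ** matrix_inv (transpose \<Lambda>)). cos (t \<bullet> x + b))"
      using integral_cos_mvnormal[OF sym psd] by (simp add: \<Sigma>_def Bt flip: B_def)
  next
    fix e :: real assume e: "0 < e"
    obtain K where K: "whp (e / 2) (\<lambda>n \<omega>. norm (V n \<omega>) \<le> K)"
      using tightV[of "e / 2"] e by auto
    have "whp (e / 2) (\<lambda>n \<omega>. norm (Z n \<omega> - V n \<omega>) \<le> 1)"
      using e by (intro close) auto
    from whp_conj[OF this K] have "whp e (\<lambda>n \<omega>. norm (Z n \<omega>) \<le> K + 1)"
    proof (rule whp_mono, simp, intro always_eventually allI ballI impI, elim conjE)
      fix n \<omega> assume "norm (Z n \<omega> - V n \<omega>) \<le> 1" "norm (V n \<omega>) \<le> K"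
      then show "norm (Z n \<omega>) \<le> K + 1" using norm_triangle_sub[of "Z n \<omega>" "V n \<omega>"] by linarith
    qed
    then show "\<exists>K. whp e (\<lambda>n \<omega>. norm (Z n \<omega>) \<le> K)" ..
  qed (simp add: mvnormal_def)
qed


section \<open>Partial derivatives\<close>

lemma has_real_derivative_line:
  fixes f :: "real^'d::finite \<Rightarrow> real"
  assumes "(f has_derivative D) (at x)"
  shows "((\<lambda>t. f (x + t *\<^sub>R v)) has_real_derivative D v) (at 0)"
proof -
  have D: "linear D" using assms by (rule has_derivative_linear)
  have "((\<lambda>t. f (x + t *\<^sub>R v)) has_derivative (\<lambda>t. D (t *\<^sub>R v))) (at 0)"
    by (rule has_derivative_compose[where g = f]) (use assms in \<open>auto intro!: derivative_eq_intros\<close>)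
  then show ?thesis
    using D by (simp add: has_field_derivative_def linear_scale mult_commute_abs)
qed

lemma partial_deriv_eq:
  fixes f :: "real^'d::finite \<Rightarrow> real"
  assumes "(f has_derivative D) (at x)"
  shows "partial_deriv r f x = D (axis r 1)"
  using has_real_derivative_line[OF assms, of "axis r 1"]
  unfolding partial_deriv_def has_real_derivative_iff_has_vector_derivative
  by (rule vector_derivative_at)

lemma has_derivative_partial_deriv:
  fixes f :: "real^'d::finite \<Rightarrow> real"
  assumes "f differentiable (at x)"
  shows "(f has_derivative (\<lambda>v. \<Sum>r\<in>UNIV. v $ r * partial_deriv r f x)) (at x)"
proof -
  obtain D where D: "(f has_derivative D) (at x)"
    using assms by (auto simp: differentiable_def)
  have "D = (\<lambda>v. \<Sum>r\<in>UNIV. v $ r * partial_deriv r f x)"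
    unfolding partial_deriv_eq[OF D] by (rule ext, rule linear_eq_sum_axis[OF has_derivative_linear[OF D]])
  then show ?thesis using D by (simp only:)
qed

lemma partial_deriv_LIMSEQ:
  fixes f :: "real^'d::finite \<Rightarrow> real"
  assumes "f differentiable (at x)"
  shows "(\<lambda>n. (f (x + inverse (real (Suc n)) *\<^sub>R axis r 1) - f x) / inverse (real (Suc n)))
    \<longlonglongrightarrow> partial_deriv r f x"
proof -
  obtain D where D: "(f has_derivative D) (at x)"
    using assms by (auto simp: differentiable_def)
  have "((\<lambda>t. (f (x + t *\<^sub>R axis r 1) - f x) / t) \<longlongrightarrow> partial_deriv r f x) (at 0)"
    using has_real_derivative_line[OF D, of "axis r 1"]
    by (simp add: DERIV_def partial_deriv_eq[OF D])
  moreover have "filterlim (\<lambda>n. inverse (real (Suc n))) (at 0) sequentially"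
    by (rule filterlim_atI[OF LIMSEQ_inverse_real_of_nat]) simp
  ultimately show ?thesis by (rule filterlim_compose)
qed

text \<open>Measurability in the parameter \<open>x\<close> of a derivative taken in
  \<open>\<theta>\<close>: along a sequence of increments it is a pointwise limit of difference
  quotients, each measurable in \<open>x\<close>.\<close>

lemma borel_measurable_partial_deriv:
  fixes g :: "'b::topological_space \<Rightarrow> real^'d::finite \<Rightarrow> real"
  assumes U: "U \<in> sets borel" and S: "open S" "\<theta> \<in> S"
    and meas: "\<And>\<theta>. \<theta> \<in> S \<Longrightarrow> (\<lambda>x. if x \<in> U then g x \<theta> else 0) \<in> borel_measurable borel"
    and diff: "\<And>x. x \<in> U \<Longrightarrow> g x differentiable (at \<theta>)"
  shows "(\<lambda>x. if x \<in> U then partial_deriv r (g x) \<theta> else 0) \<in> borel_measurable borel"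
proof -
  let ?\<theta> = "\<lambda>n. \<theta> + inverse (real (Suc n)) *\<^sub>R axis r 1"
  have "?\<theta> \<longlonglongrightarrow> \<theta> + 0 *\<^sub>R axis r 1"
    by (intro tendsto_intros LIMSEQ_inverse_real_of_nat)
  then have ev: "\<forall>\<^sub>F n in sequentially. ?\<theta> n \<in> S"
    using S by (intro topological_tendstoD) auto
  \<comment> \<open>The shifted point may lie outside \<open>S\<close> for small \<open>n\<close>;
    the quotient is set to 0 until it enters.\<close>
  define G where "G n x = (if ?\<theta> n \<in> S then
      ((if x \<in> U then g x (?\<theta> n) else 0) - (if x \<in> U then g x \<theta> else 0)) / inverse (real (Suc n)) else 0)" for n x
  show ?thesis
  proof (rule borel_measurable_LIMSEQ_real)
    fix n show "G n \<in> borel_measurable borel"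
      using meas[OF S(2)] meas[of "?\<theta> n"] unfolding G_def
      by (cases "?\<theta> n \<in> S") (auto intro!: borel_measurable_divide borel_measurable_diff)
  next
    fix x
    show "(\<lambda>n. G n x) \<longlonglongrightarrow> (if x \<in> U then partial_deriv r (g x) \<theta> else 0)"
    proof (cases "x \<in> U")
      case True
      show ?thesis
      proof (rule Lim_transform_eventually)
        show "(\<lambda>n. (g x (?\<theta> n) - g x \<theta>) / inverse (real (Suc n))) \<longlonglongrightarrow>
            (if x \<in> U then partial_deriv r (g x) \<theta> else 0)"
          using partial_deriv_LIMSEQ[OF diff[OF True], of r] True by simp
        show "\<forall>\<^sub>F n in sequentially. (g x (?\<theta> n) - g x \<theta>) / inverse (real (Suc n)) = G n x"
          using ev by eventually_elim (use True in \<open>simp add: G_def\<close>)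
      qed
    next
      case False
      then have "G n x = 0" for n by (auto simp: G_def)
      then show ?thesis using False by simp
    qed
  qed
qed

text \<open>The one-dimensional mean value theorem along the segment from \<mu> to \<theta>. An
  exact intermediate point exists because \<open>f\<close> is real-valued; for the score it is
  applied to each component, with its own intermediate point.\<close>

lemma mvt_partial_deriv:
  fixes f :: "real^'d::finite \<Rightarrow> real"
  assumes diff: "\<And>\<theta>. norm (\<theta> - \<mu>) < c \<Longrightarrow> f differentiable (at \<theta>)" and \<theta>: "norm (\<theta> - \<mu>) < c"
  obtains \<xi> where "norm (\<xi> - \<mu>) \<le> norm (\<theta> - \<mu>)"
    "f \<theta> - f \<mu> = (\<Sum>r\<in>UNIV. (\<theta> - \<mu>) $ r * partial_deriv r f \<xi>)"
proof -
  let ?l = "\<lambda>t. \<mu> + t *\<^sub>R (\<theta> - \<mu>)"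
  have le: "norm (?l t - \<mu>) \<le> norm (\<theta> - \<mu>)" if "0 \<le> t" "t \<le> 1" for t
    using that by (simp add: mult_left_le_one_le)
  let ?D = "\<lambda>t s. \<Sum>r\<in>UNIV. (s *\<^sub>R (\<theta> - \<mu>)) $ r * partial_deriv r f (?l t)"
  have "((\<lambda>t. f (?l t)) has_derivative ?D t) (at t within {0..1})" if t: "0 \<le> t" "t \<le> 1" for t
  proof -
    have f: "(f has_derivative (\<lambda>v. \<Sum>r\<in>UNIV. v $ r * partial_deriv r f (?l t))) (at (?l t))"
      using le[OF t] \<theta> by (intro has_derivative_partial_deriv diff) linarith
    have l: "(?l has_derivative (\<lambda>s. s *\<^sub>R (\<theta> - \<mu>))) (at t within {0..1})"
      by (auto intro!: derivative_eq_intros)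
    show ?thesis by (rule has_derivative_compose[OF l f])
  qed
  then have "\<exists>t\<in>{0..1}. f (?l 1) - f (?l 0) = ?D t (1 - 0)"
    by (intro mvt_very_simple[where f = "\<lambda>t. f (?l t)" and f' = ?D]) auto
  then obtain t where "t \<in> {0..1}" "f \<theta> - f \<mu> = (\<Sum>r\<in>UNIV. (\<theta> - \<mu>) $ r * partial_deriv r f (?l t))"
    by auto
  then show ?thesis using that[of "?l t"] le[of t] by auto
qed


section \<open>The Frechet score in a chart\<close>

locale frechet_chart_sample = frechet_sample M X Q
  for M :: "'a measure" and X :: "nat \<Rightarrow> 'a \<Rightarrow> 'b::{metric_space,second_countable_topology}"
    and Q :: "'b measure" +
  fixes U :: "'b set" and \<phi> :: "'b \<Rightarrow> real^'d::finite"
  assumes chart: "chart U \<phi>"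
    and QU: "measure Q U = 1"
    and pU: "frechet_mean Q \<in> U"
    and C2: "\<And>u. u \<in> \<phi> ` U \<Longrightarrow> Ck_on 2 (\<lambda>\<theta>. (rho_chart U \<phi> \<theta> u)\<^sup>2) (\<phi> ` U)"
    and Psi_L2: "(\<integral>\<^sup>+ \<omega>. ennreal ((norm (Psi U \<phi> (restrict \<phi> U (X 0 \<omega>)) (\<phi> (frechet_mean Q))))\<^sup>2) \<partial>M) < \<infinity>"
    and DPsi_L2: "\<And>r s. (\<integral>\<^sup>+ \<omega>. ennreal (\<bar>DPsi U \<phi> (restrict \<phi> U (X 0 \<omega>)) (\<phi> (frechet_mean Q)) $ r $ s\<bar>\<^sup>2) \<partial>M) < \<infinity>"
    and osc: "\<And>r s. ((\<lambda>c. \<integral>\<^sup>+ \<omega>. osc_DPsi U \<phi> (\<phi> (frechet_mean Q)) r s (restrict \<phi> U (X 0 \<omega>)) c \<partial>M) \<longlongrightarrow> 0) (at_right 0)"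
begin

definition \<mu> :: "real^'d" where "\<mu> = \<phi> p"

text \<open>The data argument is a point of the manifold, not its coordinates: this makes
  \<open>g\<close> defined and Borel in \<open>x\<close> everywhere, and on \<open>U\<close> it
  agrees with the squared chart metric.\<close>

definition g :: "'b \<Rightarrow> real^'d \<Rightarrow> real" where "g x \<theta> = (dist x (inv_into U \<phi> \<theta>))\<^sup>2"

definition \<psi> :: "'d \<Rightarrow> 'b \<Rightarrow> real^'d \<Rightarrow> real" where "\<psi> r x = partial_deriv r (g x)"

definition h :: "'d \<Rightarrow> 'd \<Rightarrow> 'b \<Rightarrow> real^'d \<Rightarrow> real" where "h r s x = partial_deriv s (\<psi> r x)"

lemma open_U: "open U" and open_image: "open (\<phi> ` U)" and inj_\<phi>: "inj_on \<phi> U"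
  and continuous_\<phi>: "continuous_on U \<phi>"
proof -
  have "homeomorphism U (\<phi> ` U) \<phi> (inv_into U \<phi>)" using chart by (simp add: chart_def)
  then show "inj_on \<phi> U" "continuous_on U \<phi>"
    unfolding homeomorphism_def by (metis inj_on_inverseI)+
qed (use chart in \<open>auto simp: chart_def\<close>)

lemma U_borel [measurable]: "U \<in> sets borel"
  using open_U by simp

lemma inv_\<phi>: "x \<in> U \<Longrightarrow> inv_into U \<phi> (\<phi> x) = x"
  using inj_\<phi> by simp

lemma rho_chart_g: "x \<in> U \<Longrightarrow> (rho_chart U \<phi> (\<phi> x) \<theta>)\<^sup>2 = g x \<theta>"
  by (simp add: rho_chart_def g_def inv_\<phi>)

lemma Psi_eq: "x \<in> U \<Longrightarrow> Psi U \<phi> (\<phi> x) \<theta> $ r = \<psi> r x \<theta>"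
  by (simp add: Psi_def rho_chart_g \<psi>_def)

lemma DPsi_eq: "x \<in> U \<Longrightarrow> DPsi U \<phi> (\<phi> x) \<theta> $ r $ s = h r s x \<theta>"
  by (simp add: DPsi_def Psi_eq h_def)

text \<open>The smoothness hypothesis differentiates in the first argument of
  \<open>rho_chart\<close>, the score in the second; symmetry of the distance identifies
  them.\<close>

lemma g_C2: "x \<in> U \<Longrightarrow> Ck_on (Suc (Suc 0)) (g x) (\<phi> ` U)"
  using C2[of "\<phi> x"] rho_chart_g[of x]
  by (simp add: numeral_2_eq_2 rho_chart_def dist_commute del: Ck_on.simps)

lemma differentiable_g: "x \<in> U \<Longrightarrow> \<theta> \<in> \<phi> ` U \<Longrightarrow> g x differentiable (at \<theta>)"
  and differentiable_\<psi>: "x \<in> U \<Longrightarrow> \<theta> \<in> \<phi> ` U \<Longrightarrow> \<psi> r x differentiable (at \<theta>)"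
  and continuous_h: "x \<in> U \<Longrightarrow> continuous_on (\<phi> ` U) (h r s x)"
  using g_C2[of x] by (auto simp: \<psi>_def h_def)

lemma measurable_g [measurable]: "(\<lambda>x. g x \<theta>) \<in> borel_measurable borel"
  unfolding g_def by measurable

lemma measurable_\<psi>:
  assumes "\<theta> \<in> \<phi> ` U"
  shows "(\<lambda>x. if x \<in> U then \<psi> r x \<theta> else 0) \<in> borel_measurable borel"
  unfolding \<psi>_def
  by (rule borel_measurable_partial_deriv[OF U_borel open_image assms])
     (use assms in \<open>auto intro: differentiable_g\<close>)

lemma measurable_h:
  assumes "\<theta> \<in> \<phi> ` U"
  shows "(\<lambda>x. if x \<in> U then h r s x \<theta> else 0) \<in> borel_measurable borel"
  unfolding h_def
  by (rule borel_measurable_partial_deriv[OF U_borel open_image assms])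
     (use assms in \<open>auto intro: differentiable_\<psi> measurable_\<psi>\<close>)

lemma \<mu>_image: "\<mu> \<in> \<phi> ` U"
  using pU by (simp add: \<mu>_def)

lemma inv_\<mu>: "inv_into U \<phi> \<mu> = p"
  using pU by (simp add: \<mu>_def inv_\<phi>)

lemma AE_U: "AE x in Q. x \<in> U"
  using QU Q.AE_in_set_eq_1[of U] by (simp add: sets_Q)

text \<open>Score at the true parameter, extended by 0 off \<open>U\<close>, so that limit theorems
  for Borel functions on the whole manifold apply.\<close>

definition "\<psi>0 r x = (if x \<in> U then \<psi> r x \<mu> else 0)"

definition "h0 r s x = (if x \<in> U then h r s x \<mu> else 0)"

lemma measurable_\<psi>0 [measurable]: "\<psi>0 r \<in> borel_measurable borel"
  using measurable_\<psi>[OF \<mu>_image] unfolding \<psi>0_def by simp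

lemma measurable_h0 [measurable]: "h0 r s \<in> borel_measurable borel"
  using measurable_h[OF \<mu>_image] unfolding h0_def by simp

text \<open>Turns a moment hypothesis on chart expressions of the sample into integrability under
  \<open>Q\<close>. Monotonicity of the nonnegative integral transfers the bound from
  \<open>k\<close> to the Borel function \<open>f\<close>.\<close>

lemma integrable_square_of_nn_integral:
  assumes f [measurable]: "f \<in> borel_measurable borel"
    and le: "\<And>\<omega>. \<bar>f (X 0 \<omega>)\<bar> \<le> k \<omega>" and fin: "(\<integral>\<^sup>+ \<omega>. ennreal ((k \<omega>)\<^sup>2) \<partial>M) < \<infinity>"
  shows "integrable Q (\<lambda>x. (f x)\<^sup>2)"
proof (rule integrableI_nonneg)
  have "(\<integral>\<^sup>+ x. ennreal ((f x)\<^sup>2) \<partial>Q) = (\<integral>\<^sup>+ \<omega>. ennreal ((f (X 0 \<omega>))\<^sup>2) \<partial>M)"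
    by (rule nn_integral_X[of "\<lambda>x. ennreal ((f x)\<^sup>2)", symmetric]) measurable
  also have "\<dots> \<le> (\<integral>\<^sup>+ \<omega>. ennreal ((k \<omega>)\<^sup>2) \<partial>M)"
  proof (intro nn_integral_mono ennreal_leI)
    fix \<omega>
    have "\<bar>f (X 0 \<omega>)\<bar> \<le> \<bar>k \<omega>\<bar>" using le[of \<omega>] by linarith
    then show "(f (X 0 \<omega>))\<^sup>2 \<le> (k \<omega>)\<^sup>2" by (simp flip: abs_le_square_iff)
  qed
  finally show "(\<integral>\<^sup>+ x. ennreal ((f x)\<^sup>2) \<partial>Q) < \<infinity>" using fin by (rule le_less_trans)
qed auto

lemma \<psi>0_L2: "integrable Q (\<lambda>x. (\<psi>0 r x)\<^sup>2)"
proof (rule integrable_square_of_nn_integral[OF measurable_\<psi>0 _ Psi_L2])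
  fix \<omega>
  show "\<bar>\<psi>0 r (X 0 \<omega>)\<bar> \<le> norm (Psi U \<phi> (restrict \<phi> U (X 0 \<omega>)) (\<phi> p))"
    using component_le_norm_cart[of "Psi U \<phi> (restrict \<phi> U (X 0 \<omega>)) (\<phi> p)" r]
    by (auto simp: \<psi>0_def Psi_eq \<mu>_def)
qed

lemma integrable_\<psi>0: "integrable Q (\<psi>0 r)"
  by (rule Q.square_integrable_imp_integrable[OF _ \<psi>0_L2]) simp

lemma integrable_h0: "integrable Q (h0 r s)"
proof (rule Q.square_integrable_imp_integrable)
  show "integrable Q (\<lambda>x. (h0 r s x)\<^sup>2)"
    by (rule integrable_square_of_nn_integral[OF measurable_h0 _ DPsi_L2])
       (auto simp: h0_def DPsi_eq \<mu>_def)
qed simp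

text \<open>Off \<open>U\<close> the restricted chart has the single value \<open>undefined\<close>,
  so the composition is \<open>f\<close> on \<open>U\<close> and constant elsewhere.\<close>

lemma measurable_chart_function:
  assumes "f \<in> borel_measurable borel" "\<And>x. x \<in> U \<Longrightarrow> F' (\<phi> x) = f x"
  shows "(\<lambda>x. F' (restrict \<phi> U x)) \<in> borel_measurable borel"
proof -
  have "(\<lambda>x. F' (restrict \<phi> U x)) = (\<lambda>x. if x \<in> U then f x else F' undefined)"
    using assms(2) by (auto simp: fun_eq_iff)
  then show ?thesis using assms(1) by simp
qed

lemma expectation_chart_function:
  fixes F' :: "real^'d \<Rightarrow> real"
  assumes "f \<in> borel_measurable borel" "\<And>x. x \<in> U \<Longrightarrow> F' (\<phi> x) = f x"
  shows "expectation (\<lambda>\<omega>. F' (restrict \<phi> U (X 0 \<omega>))) = (LINT x|Q. f x)"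
proof -
  have m: "(\<lambda>x. F' (restrict \<phi> U x)) \<in> borel_measurable borel"
    using assms by (rule measurable_chart_function)
  have "expectation (\<lambda>\<omega>. F' (restrict \<phi> U (X 0 \<omega>))) = (LINT x|Q. F' (restrict \<phi> U x))"
    by (rule expectation_X[OF m])
  also have "\<dots> = (LINT x|Q. f x)"
  proof (rule integral_cong_AE)
    show "AE x in Q. F' (restrict \<phi> U x) = f x"
      using AE_U by eventually_elim (simp add: assms(2))
  qed (use m assms(1) in auto)
  finally show ?thesis .
qed

lemma ball_in_image: obtains c where "0 < c" "\<And>\<theta>. norm (\<theta> - \<mu>) < c \<Longrightarrow> \<theta> \<in> \<phi> ` U"
proof -
  obtain c where "0 < c" "ball \<mu> c \<subseteq> \<phi> ` U"
    using open_image \<mu>_image by (meson openE)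
  then show ?thesis
    by (intro that[of c]) (auto simp: subset_iff dist_norm norm_minus_commute)
qed

text \<open>The supremum defining \<open>osc_DPsi\<close> is replaced by one over a countable dense set, which is
  measurable in \<open>x\<close> and, by continuity, still dominates the oscillation.\<close>

lemma oscillation_majorant:
  assumes "0 < \<eta>"
  shows "\<exists>c k. 0 < c \<and> (\<forall>\<theta>. norm (\<theta> - \<mu>) < c \<longrightarrow> \<theta> \<in> \<phi> ` U) \<and>
    (\<forall>r s. integrable Q (k r s)) \<and> (\<forall>r s x. 0 \<le> k r s x) \<and> (\<forall>r s. (LINT x|Q. k r s x) < \<eta>) \<and>
    (AE x in Q. x \<in> U \<and> (\<forall>r s \<theta>. norm (\<theta> - \<mu>) < c \<longrightarrow> \<bar>h r s x \<theta> - h r s x \<mu>\<bar> \<le> k r s x))"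
proof -
  obtain c1 where c1: "0 < c1" "\<And>\<theta>. norm (\<theta> - \<mu>) < c1 \<Longrightarrow> \<theta> \<in> \<phi> ` U"
    using ball_in_image by blast
  have "\<forall>\<^sub>F c in at_right 0. (\<integral>\<^sup>+ \<omega>. osc_DPsi U \<phi> (\<phi> p) r s (restrict \<phi> U (X 0 \<omega>)) c \<partial>M) < ennreal \<eta>" for r s
    using osc assms(1) by (intro order_tendstoD) auto
  then have "\<forall>\<^sub>F c in at_right 0. \<forall>r s. (\<integral>\<^sup>+ \<omega>. osc_DPsi U \<phi> (\<phi> p) r s (restrict \<phi> U (X 0 \<omega>)) c \<partial>M) < ennreal \<eta>"
    by (intro eventually_all_finite) auto
  moreover have "\<forall>\<^sub>F c::real in at_right 0. 0 < c \<and> c < c1"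
    using c1(1) by (intro eventually_conj eventually_at_right_less eventually_at_right_real[THEN eventually_mono, of 0 c1]) auto
  ultimately have "\<forall>\<^sub>F c::real in at_right 0. (0 < c \<and> c < c1) \<and>
      (\<forall>r s. (\<integral>\<^sup>+ \<omega>. osc_DPsi U \<phi> (\<phi> p) r s (restrict \<phi> U (X 0 \<omega>)) c \<partial>M) < ennreal \<eta>)"
    by eventually_elim simp
  then obtain c where c: "0 < c" "c < c1"
    and small: "\<And>r s. (\<integral>\<^sup>+ \<omega>. osc_DPsi U \<phi> (\<phi> p) r s (restrict \<phi> U (X 0 \<omega>)) c \<partial>M) < ennreal \<eta>"
    using eventually_happens'[OF trivial_limit_at_right_real] by blast
  have im: "\<theta> \<in> \<phi> ` U" if "norm (\<theta> - \<mu>) < c" for \<theta> using c1(2)[of \<theta>] c(2) that by simp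
  obtain D :: "(real^'d) set" where D: "countable D" "\<And>S. open S \<Longrightarrow> S \<noteq> {} \<Longrightarrow> \<exists>d\<in>D. d \<in> S"
    using countable_dense_exists by metis
  \<comment> \<open>The open ball keeps all points in the image of \<open>U\<close> and is contained
    in the closed ball of \<open>osc_DPsi\<close>, so \<open>w\<close> is at most that supremum for
    sample points in \<open>U\<close>; off \<open>U\<close> it is 0.\<close>
  define w where "w r s x = (SUP \<theta>\<in>D \<inter> ball \<mu> c.
      ennreal \<bar>(if x \<in> U then h r s x \<theta> else 0) - (if x \<in> U then h r s x \<mu> else 0)\<bar>)" for r s x
  have wm [measurable]: "w r s \<in> borel_measurable borel" for r s
    unfolding w_def
  proof (rule borel_measurable_SUP)
    show "countable (D \<inter> ball \<mu> c)" using D(1) by simp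
    fix \<theta> assume "\<theta> \<in> D \<inter> ball \<mu> c"
    then have "\<theta> \<in> \<phi> ` U" by (intro im) (simp add: dist_norm norm_minus_commute)
    from measurable_h[OF this] measurable_h[OF \<mu>_image]
    show "(\<lambda>x. ennreal \<bar>(if x \<in> U then h r s x \<theta> else 0) - (if x \<in> U then h r s x \<mu> else 0)\<bar>) \<in> borel_measurable borel"
      by (intro measurable_compose[OF _ measurable_ennreal] borel_measurable_abs borel_measurable_diff)
  qed
  have wint: "(\<integral>\<^sup>+ x. w r s x \<partial>Q) < ennreal \<eta>" for r s
  proof -
    have "(\<integral>\<^sup>+ x. w r s x \<partial>Q) = (\<integral>\<^sup>+ \<omega>. w r s (X 0 \<omega>) \<partial>M)"
      by (rule nn_integral_X[symmetric]) simp
    also have "\<dots> \<le> (\<integral>\<^sup>+ \<omega>. osc_DPsi U \<phi> (\<phi> p) r s (restrict \<phi> U (X 0 \<omega>)) c \<partial>M)"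
    proof (rule nn_integral_mono)
      fix \<omega>
      show "w r s (X 0 \<omega>) \<le> osc_DPsi U \<phi> (\<phi> p) r s (restrict \<phi> U (X 0 \<omega>)) c"
      proof (cases "X 0 \<omega> \<in> U")
        case True
        then show ?thesis
          unfolding w_def osc_DPsi_def
          by (auto intro!: SUP_mono simp: DPsi_eq \<mu>_def dist_norm norm_minus_commute)
      next
        case False
        then show ?thesis by (simp add: w_def SUP_le_iff)
      qed
    qed
    finally show ?thesis using small[of r s] by (rule le_less_trans)
  qed
  have wh: "ennreal \<bar>h r s x \<theta> - h r s x \<mu>\<bar> \<le> w r s x" if x: "x \<in> U" and \<theta>: "norm (\<theta> - \<mu>) < c" for r s x \<theta>
  proof (rule ccontr)
    \<comment> \<open>If the oscillation at \<open>\<theta>\<close> exceeded \<open>w\<close>, then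
      by continuity it would do so on a nonempty open subset of the ball, which contains a point of
      \<open>D\<close>, contrary to the definition of \<open>w\<close>.\<close>
    assume "\<not> ennreal \<bar>h r s x \<theta> - h r s x \<mu>\<bar> \<le> w r s x"
    then have gt: "w r s x < ennreal \<bar>h r s x \<theta> - h r s x \<mu>\<bar>" by simp
    have cont: "continuous_on (ball \<mu> c) (\<lambda>\<theta>. ennreal \<bar>h r s x \<theta> - h r s x \<mu>\<bar>)"
      using continuous_h[OF x, of r s]
      by (intro continuous_on_ennreal continuous_intros continuous_on_subset[OF continuous_h[OF x, of r s]])
         (auto intro!: im simp: dist_norm norm_minus_commute)
    define V where "V = ball \<mu> c \<inter> (\<lambda>\<theta>. ennreal \<bar>h r s x \<theta> - h r s x \<mu>\<bar>) -` {w r s x<..}"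
    have "open V"
      unfolding V_def using continuous_on_open_vimage[of "ball \<mu> c"] cont
      by (metis Int_commute open_ball open_greaterThan)
    moreover have "\<theta> \<in> V" using gt \<theta> by (simp add: V_def dist_norm norm_minus_commute)
    ultimately obtain d where d: "d \<in> D" "d \<in> V" using D(2)[of V] by blast
    then have "ennreal \<bar>h r s x d - h r s x \<mu>\<bar> \<le> w r s x"
      unfolding w_def using x by (intro SUP_upper2[of d]) (auto simp: V_def)
    then show False using d(2) by (auto simp: V_def)
  qed
  \<comment> \<open>\<open>enn2real\<close> sends an infinite value to 0, so \<open>k\<close> agrees
    with \<open>w\<close> only where \<open>w\<close> is finite; the finite integral makes this
    almost everywhere.\<close>
  define k where "k r s x = enn2real (w r s x)" for r s x
  have fin: "AE x in Q. w r s x \<noteq> \<infinity>" for r s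
    using wint[of r s] by (intro nn_integral_PInf_AE) auto
  have kw: "AE x in Q. ennreal (k r s x) = w r s x" for r s
    using fin[of r s] by eventually_elim (simp add: k_def less_top)
  have knn: "(\<integral>\<^sup>+ x. ennreal (k r s x) \<partial>Q) < ennreal \<eta>" for r s
    using wint[of r s] nn_integral_cong_AE[OF kw[of r s]] by simp
  have km [measurable]: "k r s \<in> borel_measurable borel" for r s
    unfolding k_def by measurable
  have k0: "0 \<le> k r s x" for r s x by (simp add: k_def)
  have ki: "integrable Q (k r s)" for r s
    using knn[of r s] k0 by (intro integrableI_nonneg) (auto intro: less_trans)
  show ?thesis
  proof (intro exI[of _ c] exI[of _ k] conjI allI impI)
    show "(LINT x|Q. k r s x) < \<eta>" for r s
      using knn[of r s] nn_integral_eq_integral[OF ki[of r s]] k0 assms(1)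
      by (simp add: ennreal_less_iff)
    have "AE x in Q. \<forall>r s. ennreal (k r s x) = w r s x"
      unfolding AE_all_countable using kw by blast
    with AE_U show "AE x in Q. x \<in> U \<and> (\<forall>r s \<theta>. norm (\<theta> - \<mu>) < c \<longrightarrow> \<bar>h r s x \<theta> - h r s x \<mu>\<bar> \<le> k r s x)"
    proof eventually_elim
      case (elim x)
      then show ?case using wh[of x] k0 by (metis ennreal_le_iff)
    qed
  qed (use c im ki k0 in auto)
qed

text \<open>First-order expansion of one score component: the mean value theorem puts the derivative
  at an intermediate point, and moving it to \<mu> costs the oscillation bound
  \<open>k\<close>.\<close>

lemma \<psi>_expansion:
  assumes x: "x \<in> U" and c: "\<And>\<theta>. norm (\<theta> - \<mu>) < c \<Longrightarrow> \<theta> \<in> \<phi> ` U"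
    and k: "\<And>s \<theta>. norm (\<theta> - \<mu>) < c \<Longrightarrow> \<bar>h r s x \<theta> - h r s x \<mu>\<bar> \<le> k s"
    and \<theta>: "norm (\<theta> - \<mu>) < c"
  shows "\<bar>\<psi> r x \<theta> - \<psi> r x \<mu> - (\<Sum>s\<in>UNIV. (\<theta> - \<mu>) $ s * h r s x \<mu>)\<bar> \<le> norm (\<theta> - \<mu>) * (\<Sum>s\<in>UNIV. k s)"
proof -
  have "\<psi> r x differentiable (at \<theta>)" if "norm (\<theta> - \<mu>) < c" for \<theta>
    by (intro differentiable_\<psi> x c that)
  from mvt_partial_deriv[OF this \<theta>] obtain \<xi> where \<xi>: "norm (\<xi> - \<mu>) \<le> norm (\<theta> - \<mu>)"
    "\<psi> r x \<theta> - \<psi> r x \<mu> = (\<Sum>s\<in>UNIV. (\<theta> - \<mu>) $ s * h r s x \<xi>)"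
    unfolding h_def by blast
  have "\<psi> r x \<theta> - \<psi> r x \<mu> - (\<Sum>s\<in>UNIV. (\<theta> - \<mu>) $ s * h r s x \<mu>)
      = (\<Sum>s\<in>UNIV. (\<theta> - \<mu>) $ s * (h r s x \<xi> - h r s x \<mu>))"
    by (simp add: \<xi>(2) sum_subtractf right_diff_distrib)
  also have "\<bar>\<dots>\<bar> \<le> (\<Sum>s\<in>UNIV. \<bar>(\<theta> - \<mu>) $ s * (h r s x \<xi> - h r s x \<mu>)\<bar>)"
    by (rule sum_abs)
  also have "\<dots> \<le> (\<Sum>s\<in>UNIV. norm (\<theta> - \<mu>) * k s)"
    unfolding abs_mult using \<xi>(1) \<theta>
    by (intro sum_mono mult_mono component_le_norm_cart k) auto
  finally show ?thesis by (simp add: sum_distrib_left)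
qed

text \<open>Only the one-sided second-order bound for the Frechet function and the minimality of \<open>p\<close> are
  used, so no differentiation under the integral is needed.\<close>

lemma mean_\<psi>0: "(LINT x|Q. \<psi>0 r x) = 0"
proof -
  \<comment> \<open>Here the majorant has to be integrable, not small; the level 1 is
    arbitrary.\<close>
  obtain c k where c: "0 < c" "\<And>\<theta>. norm (\<theta> - \<mu>) < c \<Longrightarrow> \<theta> \<in> \<phi> ` U"
    and k: "\<And>r s. integrable Q (k r s)" "\<And>r s x. 0 \<le> k r s x"
      "AE x in Q. x \<in> U \<and> (\<forall>r s \<theta>. norm (\<theta> - \<mu>) < c \<longrightarrow> \<bar>h r s x \<theta> - h r s x \<mu>\<bar> \<le> k r s x)"
    using oscillation_majorant[OF zero_less_one] by blast
  \<comment> \<open>Dominates, entrywise summed, the second derivatives of \<open>g x\<close> on the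
    whole ball: value at \<mu> plus oscillation.\<close>
  define G where "G x = (\<Sum>r\<in>UNIV. \<Sum>s\<in>UNIV. \<bar>h0 r s x\<bar> + k r s x)" for x
  have Gint: "integrable Q G"
    unfolding G_def using k(1) integrable_h0 by auto
  have G0: "0 \<le> G x" for x unfolding G_def using k(2) by (intro sum_nonneg) auto
  \<comment> \<open>Two mean value steps: from \<open>g\<close> to the score at an intermediate
    point, then from that score to the one at \<mu>. Each contributes a factor
    \<open>norm y\<close>.\<close>
  have taylor: "g x (\<mu> + y) - g x \<mu> \<le> (\<Sum>r\<in>UNIV. y $ r * \<psi>0 r x) + (norm y)\<^sup>2 * G x"
    if y: "norm y < c" and x: "x \<in> U"
      and kx: "\<And>r s \<theta>. norm (\<theta> - \<mu>) < c \<Longrightarrow> \<bar>h r s x \<theta> - h r s x \<mu>\<bar> \<le> k r s x" for y x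
  proof -
    have d: "g x differentiable (at \<theta>)" if "norm (\<theta> - \<mu>) < c" for \<theta>
      by (intro differentiable_g x c that)
    have "norm ((\<mu> + y) - \<mu>) < c" using y by simp
    from mvt_partial_deriv[OF d this]
    obtain \<xi> where \<xi>: "norm (\<xi> - \<mu>) \<le> norm y" "g x (\<mu> + y) - g x \<mu> = (\<Sum>r\<in>UNIV. y $ r * \<psi> r x \<xi>)"
      unfolding \<psi>_def add_diff_cancel_left' by blast
    have "\<bar>\<psi> r x \<xi> - \<psi> r x \<mu>\<bar> \<le> norm y * (\<Sum>s\<in>UNIV. \<bar>h0 r s x\<bar> + k r s x)" for r
    proof -
      have "\<bar>\<Sum>s\<in>UNIV. (\<xi> - \<mu>) $ s * h r s x \<mu>\<bar> \<le> (\<Sum>s\<in>UNIV. norm (\<xi> - \<mu>) * \<bar>h r s x \<mu>\<bar>)"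
        by (rule order_trans[OF sum_abs])
           (intro sum_mono, simp add: abs_mult mult_right_mono component_le_norm_cart del: vector_minus_component)
      moreover have "\<bar>\<psi> r x \<xi> - \<psi> r x \<mu> - (\<Sum>s\<in>UNIV. (\<xi> - \<mu>) $ s * h r s x \<mu>)\<bar> \<le> norm (\<xi> - \<mu>) * (\<Sum>s\<in>UNIV. k r s x)"
        using \<xi>(1) y by (intro \<psi>_expansion[where c = c] x c kx) auto
      ultimately have "\<bar>\<psi> r x \<xi> - \<psi> r x \<mu>\<bar> \<le> norm (\<xi> - \<mu>) * (\<Sum>s\<in>UNIV. \<bar>h0 r s x\<bar> + k r s x)"
        using x by (simp add: h0_def sum.distrib distrib_left sum_distrib_left)
      also have "\<dots> \<le> norm y * (\<Sum>s\<in>UNIV. \<bar>h0 r s x\<bar> + k r s x)"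
        using \<xi>(1) k(2) by (intro mult_right_mono sum_nonneg) auto
      finally show ?thesis .
    qed
    then have "\<bar>y $ r * (\<psi> r x \<xi> - \<psi> r x \<mu>)\<bar> \<le> norm y * (norm y * (\<Sum>s\<in>UNIV. \<bar>h0 r s x\<bar> + k r s x))" for r
      unfolding abs_mult by (intro mult_mono component_le_norm_cart) auto
    then have "y $ r * (\<psi> r x \<xi> - \<psi> r x \<mu>) \<le> norm y * (norm y * (\<Sum>s\<in>UNIV. \<bar>h0 r s x\<bar> + k r s x))" for r
      by (rule abs_le_D1)
    then have "(\<Sum>r\<in>UNIV. y $ r * (\<psi> r x \<xi> - \<psi> r x \<mu>)) \<le> (\<Sum>r\<in>UNIV. norm y * (norm y * (\<Sum>s\<in>UNIV. \<bar>h0 r s x\<bar> + k r s x)))"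
      by (rule sum_mono)
    then show ?thesis
      unfolding \<xi>(2) G_def using x
      by (simp add: \<psi>0_def right_diff_distrib sum_subtractf power2_eq_square mult.assoc flip: sum_distrib_left)
  qed
  define m :: "real^'d" where "m = (\<chi> r. LINT x|Q. \<psi>0 r x)"
  define E where "E = (LINT x|Q. G x)"
  have E0: "0 \<le> E" unfolding E_def using G0 by simp
  have quad: "0 \<le> y \<bullet> m + (norm y)\<^sup>2 * E" if y: "norm y < c" for y
  proof -
    have gF: "(LINT x|Q. g x \<theta>) = mean_sq_dist (inv_into U \<phi> \<theta>)" "integrable Q (\<lambda>x. g x \<theta>)" for \<theta>
      using integrable_dist_square[of "inv_into U \<phi> \<theta>"] unfolding g_def mean_sq_dist_def by (simp_all add: dist_commute)
    have "mean_sq_dist p \<le> mean_sq_dist (inv_into U \<phi> (\<mu> + y))"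
      using mean_sq_dist_mean_less by (metis less_imp_le order_refl)
    then have "0 \<le> (LINT x|Q. g x (\<mu> + y) - g x \<mu>)"
      using gF by (simp add: inv_\<mu>)
    also have "\<dots> \<le> (LINT x|Q. (\<Sum>r\<in>UNIV. y $ r * \<psi>0 r x) + (norm y)\<^sup>2 * G x)"
    proof (rule integral_mono_AE)
      show "AE x in Q. g x (\<mu> + y) - g x \<mu> \<le> (\<Sum>r\<in>UNIV. y $ r * \<psi>0 r x) + (norm y)\<^sup>2 * G x"
        using k(3) by eventually_elim (rule taylor[OF y], auto)
    qed (use gF Gint integrable_\<psi>0 in auto)
    also have "\<dots> = y \<bullet> m + (norm y)\<^sup>2 * E"
      using Gint integrable_\<psi>0 by (simp add: m_def E_def inner_vec_def)
    finally show ?thesis .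
  qed
  have "m = 0"
  proof -
    \<comment> \<open>The direction \<open>- t *\<^sub>R m\<close> is inserted in
      \<open>quad\<close>. The first entry makes the quadratic term at most half of the linear one,
      the second keeps the point inside the ball of radius \<open>c\<close>; then \<open>m\<close>
      must vanish.\<close>
    define t where "t = min (1 / (2 * (E + 1))) (c / (2 * (norm m + 1)))"
    have t: "0 < t" using E0 c(1) by (simp add: t_def add_nonneg_pos)
    have "t * E \<le> 1 / (2 * (E + 1)) * E" unfolding t_def using E0 by (intro mult_right_mono) auto
    also have "\<dots> \<le> 1 / 2" using E0 by (simp add: field_simps)
    finally have tE: "t * E \<le> 1 / 2" .
    have "t * norm m \<le> c / (2 * (norm m + 1)) * norm m" unfolding t_def by (intro mult_right_mono) auto
    also have "\<dots> < c"
    proof -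
      have "0 < norm m + 1" by (simp add: add_nonneg_pos)
      then show ?thesis using c(1) by (simp add: field_simps add_nonneg_pos)
    qed
    finally have "norm ((- t) *\<^sub>R m) < c" using t by simp
    note quad[OF this]
    moreover have "((- t) *\<^sub>R m) \<bullet> m = - (t * (norm m)\<^sup>2)" by (simp add: power2_norm_eq_inner)
    moreover have "(norm ((- t) *\<^sub>R m))\<^sup>2 = t * (t * (norm m)\<^sup>2)"
      by (simp add: power_mult_distrib power2_eq_square)
    ultimately have "0 \<le> - (t * (norm m)\<^sup>2) + t * (t * (norm m)\<^sup>2) * E" by (simp only:)
    then have "0 \<le> t * ((norm m)\<^sup>2 * (t * E - 1))" by (simp add: algebra_simps)
    then have "0 \<le> (norm m)\<^sup>2 * (t * E - 1)"
      using t by (simp add: zero_le_mult_iff)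
    then have "(norm m)\<^sup>2 \<le> 0"
      using tE by (simp add: zero_le_mult_iff)
    then show ?thesis by simp
  qed
  then show ?thesis by (metis m_def vec_lambda_beta zero_index)
qed

text \<open>A minimizer over the whole manifold that lies in \<open>U\<close> is an interior
  minimizer in the chart, whose image is open, so the total derivative vanishes there.\<close>

lemma score_equation:
  fixes n :: nat and x :: "nat \<Rightarrow> 'b"
  assumes x: "\<And>i. x i \<in> U" and z: "z \<in> U"
    and min: "\<And>y. (\<Sum>i<n. (dist z (x i))\<^sup>2) \<le> (\<Sum>i<n. (dist y (x i))\<^sup>2)"
  shows "(\<Sum>i<n. \<psi> r (x i) (\<phi> z)) = 0"
proof -
  let ?D = "\<lambda>v. \<Sum>i<n. \<Sum>r\<in>UNIV. v $ r * \<psi> r (x i) (\<phi> z)"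
  have "((\<lambda>\<theta>. \<Sum>i<n. g (x i) \<theta>) has_derivative ?D) (at (\<phi> z))"
    unfolding \<psi>_def by (intro has_derivative_sum has_derivative_partial_deriv differentiable_g x imageI z)
  moreover have "(\<Sum>i<n. g (x i) (\<phi> z)) \<le> (\<Sum>i<n. g (x i) \<theta>)" for \<theta>
    using min[of "inv_into U \<phi> \<theta>"] by (simp add: g_def inv_\<phi> z dist_commute)
  ultimately have "?D = (\<lambda>v. 0)"
    using z open_image by (intro differential_zero_maxmin[of "\<phi> z" "\<phi> ` U"]) auto
  from fun_cong[OF this, of "axis r 1"] show ?thesis
    by (simp add: axis_def if_distrib[of "\<lambda>a. a * _"] cong: if_cong)
qed

section \<open>Sample Frechet means in the chart\<close>

context
  fixes T :: "nat \<Rightarrow> 'a \<Rightarrow> 'b" and v :: "real^'d" and \<mu>n :: "nat \<Rightarrow> 'a \<Rightarrow> real^'d"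
  assumes selection: "measurable_frechet_selection M X T"
    and \<mu>n: "\<And>n \<omega>. \<mu>n n \<omega> = (if T n \<omega> \<in> U then \<phi> (T n \<omega>) else v)"
begin

lemma selection_min:
  assumes "1 \<le> n" "\<omega> \<in> space M"
  shows "(\<Sum>i<n. (dist (T n \<omega>) (X i \<omega>))\<^sup>2) \<le> (\<Sum>i<n. (dist y (X i \<omega>))\<^sup>2)"
  using selection assms frechet_mean_set_empirical_measure[of n "T n \<omega>" "\<lambda>i. X i \<omega>"]
  by (auto simp: measurable_frechet_selection_def)

lemma measurable_\<mu>n:
  assumes "1 \<le> n"
  shows "\<mu>n n \<in> borel_measurable M"
proof -
  have "(\<lambda>x. if x \<in> U then \<phi> x else v) \<in> borel_measurable borel"
    using open_U continuous_\<phi> by (intro borel_measurable_continuous_on_if) auto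
  moreover have "T n \<in> borel_measurable M"
    using selection assms by (simp add: measurable_frechet_selection_def)
  ultimately have "(\<lambda>\<omega>. (\<lambda>x. if x \<in> U then \<phi> x else v) (T n \<omega>)) \<in> borel_measurable M"
    by (rule measurable_compose[rotated])
  then show ?thesis by (simp add: \<mu>n[abs_def])
qed

text \<open>Consistency on the manifold passes to coordinates by continuity of the chart at
  \<open>p\<close>. The event includes membership in \<open>U\<close>, so on it
  \<open>\<mu>n\<close> is the coordinate of the selected minimizer and not the default value
  \<open>v\<close>.\<close>

lemma whp_selection_near:
  assumes "0 < e" "0 < c"
  shows "whp e (\<lambda>n \<omega>. T n \<omega> \<in> U \<and> norm (\<mu>n n \<omega> - \<mu>) < c)"
proof -
  have "isCont \<phi> p"
    using continuous_\<phi> open_U pU by (simp add: continuous_on_eq_continuous_at)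
  then obtain d1 where d1: "0 < d1" "\<And>x. dist x p < d1 \<Longrightarrow> dist (\<phi> x) (\<phi> p) < c"
    using assms(2) unfolding continuous_at_eps_delta by blast
  obtain d2 where d2: "0 < d2" "ball p d2 \<subseteq> U"
    using open_U pU by (meson openE)
  have "whp e (\<lambda>n \<omega>. dist (T n \<omega>) p < min d1 d2)"
    using selection d1(1) d2(1) assms(1)
    by (intro sample_mean_consistent) (auto simp: measurable_frechet_selection_def)
  then show ?thesis
  proof (rule whp_mono[OF _ order_refl], intro always_eventually allI ballI impI)
    fix n \<omega> assume "dist (T n \<omega>) p < min d1 d2"
    then have "T n \<omega> \<in> U" "dist (\<phi> (T n \<omega>)) (\<phi> p) < c"
      using d1(2)[of "T n \<omega>"] d2(2) by (auto simp: subset_iff dist_commute)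
    then show "T n \<omega> \<in> U \<and> norm (\<mu>n n \<omega> - \<mu>) < c"
      by (simp add: \<mu>n \<mu>_def dist_norm)
  qed
qed

lemma consistent: "consistent_estimator M \<mu>n \<mu>"
  unfolding consistent_estimator_def
proof (intro allI impI)
  fix \<epsilon> :: real assume \<epsilon>: "0 < \<epsilon>"
  show "(\<lambda>n. prob {\<omega> \<in> space M. \<epsilon> < dist (\<mu>n n \<omega>) \<mu>}) \<longlonglongrightarrow> 0"
  proof (rule tendstoI)
    fix e :: real assume e: "0 < e"
    show "\<forall>\<^sub>F n in sequentially. dist (prob {\<omega> \<in> space M. \<epsilon> < dist (\<mu>n n \<omega>) \<mu>}) 0 < e"
      using whp_selection_near[OF e \<epsilon>] unfolding whp_def
    proof eventually_elim
      case (elim n)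
      then obtain A where A: "A \<in> events" "prob A < e" "\<forall>\<omega>\<in>space M - A. norm (\<mu>n n \<omega> - \<mu>) < \<epsilon>" by blast
      have "{\<omega> \<in> space M. \<epsilon> < dist (\<mu>n n \<omega>) \<mu>} \<subseteq> A"
        using A(3) by (force simp: dist_norm)
      then have "prob {\<omega> \<in> space M. \<epsilon> < dist (\<mu>n n \<omega>) \<mu>} \<le> prob A"
        using A(1) by (rule finite_measure_mono)
      then show ?case using A(2) by simp
    qed
  qed
qed

text \<open>Deterministic statement for one outcome: the vanishing score sum is expanded around
  \<mu>, and the remainder is a sample mean of the majorants times \<open>norm Z\<close>, the
  relative form in which it can be absorbed later.\<close>

lemma linearization:
  assumes x: "\<And>i. X i \<omega> \<in> U" and T: "T n \<omega> \<in> U" and n: "1 \<le> n" and \<omega>: "\<omega> \<in> space M"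
    and near: "norm (\<mu>n n \<omega> - \<mu>) < c" and c: "\<And>\<theta>. norm (\<theta> - \<mu>) < c \<Longrightarrow> \<theta> \<in> \<phi> ` U"
    and k: "\<And>i r s \<theta>. norm (\<theta> - \<mu>) < c \<Longrightarrow> \<bar>h r s (X i \<omega>) \<theta> - h r s (X i \<omega>) \<mu>\<bar> \<le> k r s (X i \<omega>)"
  defines "Z \<equiv> sqrt n *\<^sub>R (\<mu>n n \<omega> - \<mu>)"
  shows "norm ((\<chi> r. (\<Sum>i<n. \<psi>0 r (X i \<omega>)) / sqrt n) + (\<chi> r s. (\<Sum>i<n. h0 r s (X i \<omega>)) / n) *v Z)
    \<le> (\<Sum>i<n. \<Sum>r\<in>UNIV. \<Sum>s\<in>UNIV. k r s (X i \<omega>)) / n * norm Z"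
proof -
  define y where "y = \<mu>n n \<omega> - \<mu>"
  have sn: "0 < sqrt n" using n by simp
  have comp: "\<bar>(\<Sum>i<n. \<psi>0 r (X i \<omega>)) + (\<Sum>s\<in>UNIV. (\<Sum>i<n. h0 r s (X i \<omega>)) * y $ s)\<bar>
      \<le> norm y * (\<Sum>i<n. \<Sum>s\<in>UNIV. k r s (X i \<omega>))" for r
  proof -
    have zero: "(\<Sum>i<n. \<psi> r (X i \<omega>) (\<mu>n n \<omega>)) = 0"
      using score_equation[OF x T selection_min[OF n \<omega>], where r = r] T by (simp add: \<mu>n)
    \<comment> \<open>Because the scores at \<open>\<mu>n\<close> sum to zero, the linear expression
      is exactly minus the sum of the expansion remainders.\<close>
    have "(\<Sum>i<n. \<psi>0 r (X i \<omega>)) + (\<Sum>s\<in>UNIV. (\<Sum>i<n. h0 r s (X i \<omega>)) * y $ s)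
        = - (\<Sum>i<n. \<psi> r (X i \<omega>) (\<mu>n n \<omega>) - \<psi> r (X i \<omega>) \<mu> - (\<Sum>s\<in>UNIV. y $ s * h r s (X i \<omega>) \<mu>))"
      unfolding sum_subtractf zero
      by (subst sum.swap) (simp add: x \<psi>0_def h0_def sum_distrib_left mult.commute)
    also have "\<bar>\<dots>\<bar> \<le> (\<Sum>i<n. norm y * (\<Sum>s\<in>UNIV. k r s (X i \<omega>)))"
      unfolding abs_minus_cancel y_def
      by (intro order_trans[OF sum_abs] sum_mono \<psi>_expansion[where c = c] x c k near)
    finally show ?thesis by (simp add: sum_distrib_left)
  qed
  let ?W = "(\<chi> r. (\<Sum>i<n. \<psi>0 r (X i \<omega>)) / sqrt n) + (\<chi> r s. (\<Sum>i<n. h0 r s (X i \<omega>)) / n) *v Z"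
  have "norm ?W \<le> (\<Sum>r\<in>UNIV. \<bar>?W $ r\<bar>)" by (rule norm_le_l1_cart)
  also have "\<dots> \<le> (\<Sum>r\<in>UNIV. norm y * (\<Sum>i<n. \<Sum>s\<in>UNIV. k r s (X i \<omega>)) / sqrt n)"
  proof (rule sum_mono)
    fix r
    have "(\<Sum>i<n. h0 r s (X i \<omega>)) / n * (sqrt n * y $ s) = (\<Sum>i<n. h0 r s (X i \<omega>)) * y $ s / sqrt n" for s
      using n by (simp add: field_simps flip: power2_eq_square)
    then have "?W $ r = ((\<Sum>i<n. \<psi>0 r (X i \<omega>)) + (\<Sum>s\<in>UNIV. (\<Sum>i<n. h0 r s (X i \<omega>)) * y $ s)) / sqrt n"
      by (simp add: Z_def matrix_vector_mult_def add_divide_distrib sum_divide_distrib flip: y_def)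
    then show "\<bar>?W $ r\<bar> \<le> norm y * (\<Sum>i<n. \<Sum>s\<in>UNIV. k r s (X i \<omega>)) / sqrt n"
      using comp[of r] sn by (simp only: abs_divide) (simp add: divide_right_mono)
  qed
  also have "\<dots> = norm y * (\<Sum>r\<in>UNIV. \<Sum>i<n. \<Sum>s\<in>UNIV. k r s (X i \<omega>)) / sqrt n"
    by (simp add: sum_distrib_left sum_divide_distrib)
  also have "(\<Sum>r\<in>UNIV. \<Sum>i<n. \<Sum>s\<in>UNIV. k r s (X i \<omega>)) = (\<Sum>i<n. \<Sum>r\<in>UNIV. \<Sum>s\<in>UNIV. k r s (X i \<omega>))"
    by (rule sum.swap)
  \<comment> \<open>\<open>norm Z\<close> is \<open>sqrt n\<close> times
    \<open>norm y\<close>.\<close>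
  also have "norm y * \<dots> / sqrt n = \<dots> / n * norm Z"
    using n by (simp add: Z_def field_simps flip: y_def power2_eq_square)
  finally show ?thesis .
qed

lemma asymptotically_normal:
  fixes \<Lambda> C :: "real^'d^'d"
  assumes \<Lambda>: "\<Lambda> = (\<chi> r s. expectation (\<lambda>\<omega>. DPsi U \<phi> (restrict \<phi> U (X 0 \<omega>)) \<mu> $ r $ s))" "invertible \<Lambda>"
    and C: "C = covariance_matrix M (\<lambda>\<omega>. Psi U \<phi> (restrict \<phi> U (X 0 \<omega>)) \<mu>)"
  shows "converges_in_law M (\<lambda>n \<omega>. sqrt n *\<^sub>R (\<mu>n n \<omega> - \<mu>)) (mvnormal 0 (matrix_inv \<Lambda> ** C ** matrix_inv (transpose \<Lambda>)))"
proof (rule asymptotic_normality_linearized[where \<psi> = \<psi>0 and h = h0])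
  show "\<Lambda> = (\<chi> r s. LINT x|Q. h0 r s x)"
    using expectation_chart_function[OF measurable_h0, of "\<lambda>u. DPsi U \<phi> u \<mu> $ r $ s" for r s]
    by (simp add: \<Lambda>(1) DPsi_eq h0_def vec_eq_iff)
  \<comment> \<open>With centered scores the covariance matrix is the matrix of mixed second
    moments.\<close>
  have mean: "expectation (\<lambda>\<omega>. Psi U \<phi> (restrict \<phi> U (X 0 \<omega>)) \<mu> $ r) = 0" for r
    unfolding mean_\<psi>0[of r, symmetric]
    by (rule expectation_chart_function[OF measurable_\<psi>0, where F' = "\<lambda>u. Psi U \<phi> u \<mu> $ r"])
       (simp add: Psi_eq \<psi>0_def)
  have "expectation (\<lambda>\<omega>. Psi U \<phi> (restrict \<phi> U (X 0 \<omega>)) \<mu> $ r * Psi U \<phi> (restrict \<phi> U (X 0 \<omega>)) \<mu> $ s)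
      = (LINT x|Q. \<psi>0 r x * \<psi>0 s x)" for r s
    by (rule expectation_chart_function[where F' = "\<lambda>u. Psi U \<phi> u \<mu> $ r * Psi U \<phi> u \<mu> $ s"])
       (measurable, simp add: Psi_eq \<psi>0_def)
  then show "C = (\<chi> r s. LINT x|Q. \<psi>0 r x * \<psi>0 s x)"
    by (simp only: C covariance_matrix_def mean diff_zero)
  show "\<forall>\<^sub>F n in sequentially. (\<lambda>\<omega>. sqrt n *\<^sub>R (\<mu>n n \<omega> - \<mu>)) \<in> borel_measurable M"
    using eventually_ge_at_top[of 1]
    by eventually_elim (intro borel_measurable_scaleR borel_measurable_diff measurable_\<mu>n borel_measurable_const)
  fix \<eta> e :: real assume \<eta>: "0 < \<eta>" and e: "0 < e"
  define N :: real where "N = real CARD('d)"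
  have N: "0 < N" by (simp add: N_def)
  \<comment> \<open>The \<open>N * N\<close> majorants add up to a function \<open>K\<close> of mean
    below \<open>e / 3 * \<eta>\<close>, so by Markov its sample mean exceeds \<open>\<eta>\<close>
    with probability below \<open>e / 3\<close>, one of the three parts of \<open>e\<close>.\<close>
  have "0 < e / 3 * \<eta> / (N * N)" using \<eta> e N by simp
  from oscillation_majorant[OF this] obtain c k where c: "0 < c" "\<And>\<theta>. norm (\<theta> - \<mu>) < c \<Longrightarrow> \<theta> \<in> \<phi> ` U"
    and k: "\<And>r s. integrable Q (k r s)" "\<And>r s x. 0 \<le> k r s x" "\<And>r s. (LINT x|Q. k r s x) < e / 3 * \<eta> / (N * N)"
      "AE x in Q. x \<in> U \<and> (\<forall>r s \<theta>. norm (\<theta> - \<mu>) < c \<longrightarrow> \<bar>h r s x \<theta> - h r s x \<mu>\<bar> \<le> k r s x)"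
    by blast
  define K where "K x = (\<Sum>r\<in>UNIV. \<Sum>s\<in>UNIV. k r s x)" for x
  have K: "integrable Q K" "\<And>x. 0 \<le> K x"
    unfolding K_def using k(1,2) by (auto intro!: sum_nonneg)
  then have Km: "K \<in> borel_measurable borel" using borel_measurable_integrable[OF K(1)] by simp
  have "(LINT x|Q. K x) = (\<Sum>r\<in>UNIV. \<Sum>s\<in>UNIV. LINT x|Q. k r s x)"
    unfolding K_def using k(1) by simp
  also have "\<dots> < (\<Sum>r\<in>(UNIV::'d set). \<Sum>s\<in>(UNIV::'d set). e / 3 * \<eta> / (N * N))"
    using k(3) by (intro sum_strict_mono) auto
  also have "\<dots> = e / 3 * \<eta>" using N by (simp add: N_def)
  finally have EK: "(LINT x|Q. K x) < e / 3 * \<eta>" .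
  have "whp (e / 3) (\<lambda>n \<omega>. (\<Sum>i<n. K (X i \<omega>)) / n \<le> \<eta>)"
  proof (rule whp_le_of_expectation[OF _ \<eta>])
    show "\<forall>\<^sub>F n in sequentially. integrable M (\<lambda>\<omega>. (\<Sum>i<n. K (X i \<omega>)) / n) \<and>
        (\<forall>\<omega>\<in>space M. 0 \<le> (\<Sum>i<n. K (X i \<omega>)) / n) \<and> expectation (\<lambda>\<omega>. (\<Sum>i<n. K (X i \<omega>)) / n) < e / 3 * \<eta>"
      using eventually_gt_at_top[of 0]
    proof eventually_elim
      case (elim n)
      have "integrable M (\<lambda>\<omega>. K (X i \<omega>))" for i
        using K(1) integrable_X_iff[OF Km] by simp
      then show ?case
        using elim EK K(2) expectation_X[OF Km] by (auto intro!: divide_nonneg_nonneg sum_nonneg)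
    qed
  qed
  moreover have "whp (e / 3) (\<lambda>n \<omega>. T n \<omega> \<in> U \<and> norm (\<mu>n n \<omega> - \<mu>) < c)"
    using e c(1) by (intro whp_selection_near) auto
  moreover have "whp (e / 3) (\<lambda>n \<omega>. \<forall>i. X i \<omega> \<in> U \<and>
      (\<forall>r s \<theta>. norm (\<theta> - \<mu>) < c \<longrightarrow> \<bar>h r s (X i \<omega>) \<theta> - h r s (X i \<omega>) \<mu>\<bar> \<le> k r s (X i \<omega>)))"
  proof (rule whp_AE, use e in simp, rule always_eventually, rule allI, subst AE_all_countable, rule allI)
    fix i
    \<comment> \<open>The exceptional set involves all \<open>\<theta>\<close> in a ball and is not
      known to be Borel; a null set of \<open>Q\<close> containing it is transported to the sample
      instead.\<close>
    obtain N where N: "N \<in> null_sets Q" "{x \<in> space Q. \<not> (x \<in> U \<and> (\<forall>r s \<theta>. norm (\<theta> - \<mu>) < c \<longrightarrow>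
        \<bar>h r s x \<theta> - h r s x \<mu>\<bar> \<le> k r s x))} \<subseteq> N"
      using k(4) unfolding eventually_ae_filter by blast
    then have "AE x in Q. x \<notin> N" by (intro AE_not_in)
    moreover have "N \<in> sets borel" using N(1) by (auto simp: sets_Q dest: null_setsD2)
    ultimately have "AE \<omega> in M. X i \<omega> \<notin> N" by (intro AE_X) (auto simp: Collect_neg_eq)
    then show "AE \<omega> in M. X i \<omega> \<in> U \<and>
      (\<forall>r s \<theta>. norm (\<theta> - \<mu>) < c \<longrightarrow> \<bar>h r s (X i \<omega>) \<theta> - h r s (X i \<omega>) \<mu>\<bar> \<le> k r s (X i \<omega>))"
      by eventually_elim (use N(2) in auto)
  qed
  ultimately have "whp (e / 3 + (e / 3 + e / 3)) (\<lambda>n \<omega>. (\<Sum>i<n. K (X i \<omega>)) / n \<le> \<eta> \<and>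
      (T n \<omega> \<in> U \<and> norm (\<mu>n n \<omega> - \<mu>) < c) \<and> (\<forall>i. X i \<omega> \<in> U \<and>
      (\<forall>r s \<theta>. norm (\<theta> - \<mu>) < c \<longrightarrow> \<bar>h r s (X i \<omega>) \<theta> - h r s (X i \<omega>) \<mu>\<bar> \<le> k r s (X i \<omega>))))"
    by (intro whp_conj)
  then show "whp e (\<lambda>n \<omega>. norm ((\<chi> r. (\<Sum>i<n. \<psi>0 r (X i \<omega>)) / sqrt n) +
      (\<chi> r s. (\<Sum>i<n. h0 r s (X i \<omega>)) / n) *v (sqrt n *\<^sub>R (\<mu>n n \<omega> - \<mu>)))
        \<le> \<eta> * norm (sqrt n *\<^sub>R (\<mu>n n \<omega> - \<mu>)))"
  proof (rule whp_mono, simp, use eventually_ge_at_top[of 1] in eventually_elim, intro ballI impI, elim conjE)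
    fix n :: nat and \<omega>
    assume n: "1 \<le> n" and \<omega>: "\<omega> \<in> space M" and K\<eta>: "(\<Sum>i<n. K (X i \<omega>)) / n \<le> \<eta>"
      and T: "T n \<omega> \<in> U" "norm (\<mu>n n \<omega> - \<mu>) < c"
      and x: "\<forall>i. X i \<omega> \<in> U \<and> (\<forall>r s \<theta>. norm (\<theta> - \<mu>) < c \<longrightarrow>
        \<bar>h r s (X i \<omega>) \<theta> - h r s (X i \<omega>) \<mu>\<bar> \<le> k r s (X i \<omega>))"
    have "norm ((\<chi> r. (\<Sum>i<n. \<psi>0 r (X i \<omega>)) / sqrt n) +
        (\<chi> r s. (\<Sum>i<n. h0 r s (X i \<omega>)) / n) *v (sqrt n *\<^sub>R (\<mu>n n \<omega> - \<mu>)))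
        \<le> (\<Sum>i<n. \<Sum>r\<in>UNIV. \<Sum>s\<in>UNIV. k r s (X i \<omega>)) / n * norm (sqrt n *\<^sub>R (\<mu>n n \<omega> - \<mu>))"
      by (rule linearization[OF _ T(1) n \<omega> T(2) c(2)]) (use x in auto)
    also have "\<dots> \<le> \<eta> * norm (sqrt n *\<^sub>R (\<mu>n n \<omega> - \<mu>))"
      using K\<eta> unfolding K_def by (rule mult_right_mono) simp
    finally show "norm ((\<chi> r. (\<Sum>i<n. \<psi>0 r (X i \<omega>)) / sqrt n) +
        (\<chi> r s. (\<Sum>i<n. h0 r s (X i \<omega>)) / n) *v (sqrt n *\<^sub>R (\<mu>n n \<omega> - \<mu>)))
        \<le> \<eta> * norm (sqrt n *\<^sub>R (\<mu>n n \<omega> - \<mu>))" .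
  qed
qed (simp_all add: \<psi>0_L2 mean_\<psi>0 integrable_h0 \<Lambda>(2))

end

end

theorem theorem2p1:
  fixes \<A> :: "('m::{metric_space,second_countable_topology} set \<times> ('m \<Rightarrow> real^'d::finite)) set"
    and Q :: "'m measure"
    and P :: "'w measure"
    and X :: "nat \<Rightarrow> 'w \<Rightarrow> 'm"
    and U :: "'m set"
    and \<phi> :: "'m \<Rightarrow> real^'d"
    and \<mu> :: "real^'d"
    and Xt :: "nat \<Rightarrow> 'w \<Rightarrow> real^'d"
    and \<Lambda> C :: "real^'d^'d"
  assumes manifold: "differentiable_atlas \<A>"
    and proper: "\<And>S :: 'm set. closed S \<Longrightarrow> bounded S \<Longrightarrow> compact S"
    and Q: "prob_space Q" "sets Q = sets borel"
    and P: "prob_space P"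
    and indep: "prob_space.indep_vars P (\<lambda>_. borel) X UNIV"
    and ident: "\<And>i. distr P borel (X i) = Q"
    and mean: "frechet_mean_exists Q"
    and nbhd: "coordinate_neighborhood \<A> U \<phi>" "measure Q U = 1" "frechet_mean Q \<in> U"
    and C2: "\<And>u. u \<in> \<phi> ` U \<Longrightarrow> Ck_on 2 (\<lambda>\<theta>. (rho_chart U \<phi> \<theta> u)\<^sup>2) (\<phi> ` U)"
    and mu: "\<mu> = \<phi> (frechet_mean Q)"
    and Xt: "\<And>i \<omega>. Xt i \<omega> = restrict \<phi> U (X i \<omega>)"
    and Psi_L2: "(\<integral>\<^sup>+ \<omega>. ennreal ((norm (Psi U \<phi> (Xt 0 \<omega>) \<mu>))\<^sup>2) \<partial>P) < \<infinity>"
    and DPsi_L2: "\<And>r r'. (\<integral>\<^sup>+ \<omega>. ennreal (\<bar>DPsi U \<phi> (Xt 0 \<omega>) \<mu> $ r $ r'\<bar>\<^sup>2) \<partial>P) < \<infinity>"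
    and osc: "\<And>r r'. ((\<lambda>c. \<integral>\<^sup>+ \<omega>. osc_DPsi U \<phi> \<mu> r r' (Xt 0 \<omega>) c \<partial>P) \<longlongrightarrow> 0) (at_right 0)"
    and Lambda: "\<Lambda> = (\<chi> r r'. LINT \<omega>|P. DPsi U \<phi> (Xt 0 \<omega>) \<mu> $ r $ r')"
    and nonsingular: "invertible \<Lambda>"
    and C: "C = covariance_matrix P (\<lambda>\<omega>. Psi U \<phi> (Xt 0 \<omega>) \<mu>)"
  shows "\<forall>T v \<mu>n. measurable_frechet_selection P X T \<and>
           (\<forall>n \<omega>. \<mu>n n \<omega> = (if T n \<omega> \<in> U then \<phi> (T n \<omega>) else v)) \<longrightarrow>
           consistent_estimator P \<mu>n \<mu> \<and>
           converges_in_law P (\<lambda>n \<omega>. sqrt (real n) *\<^sub>R (\<mu>n n \<omega> - \<mu>))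
             (mvnormal 0 (matrix_inv \<Lambda> ** C ** matrix_inv (transpose \<Lambda>)))"
proof (intro allI impI, elim conjE)
  fix T :: "nat \<Rightarrow> 'w \<Rightarrow> 'm" and v :: "real^'d" and \<mu>n :: "nat \<Rightarrow> 'w \<Rightarrow> real^'d"
  assume selection: "measurable_frechet_selection P X T"
    and \<mu>n: "\<forall>n \<omega>. \<mu>n n \<omega> = (if T n \<omega> \<in> U then \<phi> (T n \<omega>) else v)"
  have "iid_sample P X Q"
    by (intro iid_sample.intro iid_sample_axioms.intro P indep ident)
  then have sample: "frechet_sample P X Q"
    by (intro frechet_sample.intro frechet_sample_axioms.intro proper mean)
  interpret S: frechet_chart_sample P X Q U \<phi>
  proof (intro frechet_chart_sample.intro frechet_chart_sample_axioms.intro)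
    show "chart U \<phi>" using nbhd(1) by (simp add: coordinate_neighborhood_def)
  qed (fact sample nbhd C2 Psi_L2[unfolded Xt mu] DPsi_L2[unfolded Xt mu] osc[unfolded Xt mu])+
  have \<mu>: "\<mu> = S.\<mu>" by (simp add: mu S.\<mu>_def)
  have "consistent_estimator P \<mu>n \<mu>"
    unfolding \<mu> by (rule S.consistent[OF selection \<mu>n[rule_format]])
  moreover have "converges_in_law P (\<lambda>n \<omega>. sqrt (real n) *\<^sub>R (\<mu>n n \<omega> - \<mu>))
      (mvnormal 0 (matrix_inv \<Lambda> ** C ** matrix_inv (transpose \<Lambda>)))"
    unfolding \<mu>
    by (rule S.asymptotically_normal[OF selection \<mu>n[rule_format] _ nonsingular])
       (simp_all only: Lambda C Xt \<mu>)
  ultimately show "consistent_estimator P \<mu>n \<mu> \<and>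
      converges_in_law P (\<lambda>n \<omega>. sqrt (real n) *\<^sub>R (\<mu>n n \<omega> - \<mu>))
        (mvnormal 0 (matrix_inv \<Lambda> ** C ** matrix_inv (transpose \<Lambda>)))" ..
qed

end
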